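(* Let the observations be generated by model $m$ with true parameter $\theta_{m,0}\in\Theta_m$, and let $m^*$ be a model number whose covariance structure is to be tested. Assume: (a) each drift $B\in\{B_{1,m},B_{2,m},B_{3,m},B_{4,m}\}$ is globally Lipschitz and belongs to $C^4_{\uparrow}$, and each process $Y\in\{\xi_m,\delta_m,\varepsilon_m,\zeta_m\}$ satisfies $\sup_t \mathbb{E}[|Y_t|^{\ell}]<\infty$ for all $\ell\ge 0$; (b) each process $Y\in\{\xi_m,\delta_m,\varepsilon_m,\zeta_m\}$ is ergodic with an invariant measure $\pi_Y$: for every $\pi_Y$-integrable $g$, $\frac1T\int_0^T g(Y_t)\,dt\to\int g\,d\pi_Y$ in probability as $T\to\infty$; (c) for $\mu\in\{m,m^*\}$ and all $\theta_\mu\in\Theta_\mu$: $\Sigma_{\delta\delta,\mu}>0$, $\Sigma_{\varepsilon\varepsilon,\mu}>0$, $\Psi_\mu$ is non-singular, and $\operatorname{rank}\Lambda_{x_1,\mu}=k_{1,\mu}$; (d) for $\theta,\tilde\theta\in\Theta_{m^*}$, $\Sigma_{m^*}(\theta)=\Sigma_{m^*}(\tilde\theta)$ implies $\theta=\tilde\theta$; (e) the null hypothesis $H_0$ holds: there is $\theta_{m^*,0}\in\Theta_{m^*}$ with $\Sigma_m(\theta_{m,0})=\Sigma_{m^*}(\theta_{m^*,0})$; (f) $\operatorname{rank}\Delta_{m^*}=q_{m^*}$. Then, as $n\to\infty$ with $h_n\to0$, $nh_n\to\infty$ and $nh_n^2\to0$, $$\mathbb{T}_{m^*,n}\xrightarrow{d}\chi^2_{\bar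 p-q_{m^*}},$$ where $\chi^2_r$ is the chi-squared distribution with $r$ degrees of freedom.
   Context: Notation. $p=p_1+p_2$, $\bar p=p(p+1)/2$. $|\cdot|$ is the Euclidean norm; $A>0$ means positive definite. For symmetric $A\in\mathbb{R}^{p\times p}$, $\operatorname{vec}A$ and $\operatorname{vech}A$ are the vectorization and half-vectorization, $\mathbb{D}_p$ is the $p^2\times\bar p$ duplication matrix ($\operatorname{vec}A=\mathbb{D}_p\operatorname{vech}A$). $C^4_{\uparrow}(\mathbb{R}^d)$ is the set of functions on $\mathbb{R}^d$ that are four times continuously differentiable and which, together with all these derivatives, are of polynomial growth. Model ($m$ is a model number). $p_1,p_2\ge1$, $k_{1,m}\le p_1$, $k_{2,m}\le p_2$ are fixed integers independent of $n$; $p_1,p_2$ do not depend on the model number. The observable process is $X_t=(X_{1,t}^\top,X_{2,t}^\top)^\top\in\mathbb{R}^{p_1+p_2}$ with $$X_{1,t}=\Lambda_{x_1,m}\xi_{m,t}+\delta_{m,t},\quad X_{2,t}=\Lambda_{x_2,m}\eta_{m,t}+\varepsilon_{m,t},\quad \eta_{m,t}=B_{0,m}\eta_{m,t}+\Gamma_m\xi_{m,t}+\zeta_{m,t},$$ where $\Lambda_{x_1,m}\in\mathbb{R}^{p_1\times k_{1,m}}$, $\Lambda_{x_2,m}\in\mathbb{R}^{p_2\times k_{2,m}}$, $\Gamma_m\in\mathbb{R}^{k_{2,m}\times k_{1,m}}$, $B_{0,m}\in\mathbb{R}^{k_{2,m}\times k_{2,m}}$ (zero diagonal) are constant, and $\Psi_m=\mathbb{I}_{k_{2,m}}-B_{0,m}$.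 The latent processes (dimensions $k_{1,m},p_1,p_2,k_{2,m}$) solve $$d\xi_{m,t}=B_{1,m}(\xi_{m,t})dt+S_{1,m}dW_{1,t},\quad d\delta_{m,t}=B_{2,m}(\delta_{m,t})dt+S_{2,m}dW_{2,t},$$ $$d\varepsilon_{m,t}=B_{3,m}(\varepsilon_{m,t})dt+S_{3,m}dW_{3,t},\quad d\zeta_{m,t}=B_{4,m}(\zeta_{m,t})dt+S_{4,m}dW_{4,t},$$ with deterministic initial values, constant matrices $S_{i,m}$, and independent standard Wiener processes $W_1,\dots,W_4$ of dimensions $r_1,\dots,r_4$. Put $\Sigma_{\xi\xi,m}=S_{1,m}S_{1,m}^\top$, $\Sigma_{\delta\delta,m}=S_{2,m}S_{2,m}^\top$, $\Sigma_{\varepsilon\varepsilon,m}=S_{3,m}S_{3,m}^\top$, $\Sigma_{\zeta\zeta,m}=S_{4,m}S_{4,m}^\top$. Parameter. $\theta_m\in\Theta_m$, with $\Theta_m\subset\mathbb{R}^{q_m}$ convex and compact, collects the unknown, non-duplicated entries of $\Lambda_{x_1,m},\Lambda_{x_2,m},\Gamma_m,\Psi_m,\Sigma_{\xi\xi,m},\Sigma_{\delta\delta,m},\Sigma_{\varepsilon\varepsilon,m},\Sigma_{\zeta\zeta,m}$ (all other entries are known constants or equal to other entries), so these matrices are functions of $\theta_m$. The covariance structure is $$\Sigma_m(\theta_m)=\begin{pmatrix}\Sigma_{X_1X_1,m}&\Sigma_{X_1X_2,m}\\ \Sigma_{X_1X_2,m}^\top&\Sigma_{X_2X_2,m}\end{pmatrix},$$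 $\Sigma_{X_1X_1,m}=\Lambda_{x_1,m}\Sigma_{\xi\xi,m}\Lambda_{x_1,m}^\top+\Sigma_{\delta\delta,m}$, $\Sigma_{X_1X_2,m}=\Lambda_{x_1,m}\Sigma_{\xi\xi,m}\Gamma_m^\top\Psi_m^{-1\top}\Lambda_{x_2,m}^\top$, $\Sigma_{X_2X_2,m}=\Lambda_{x_2,m}\Psi_m^{-1}(\Gamma_m\Sigma_{\xi\xi,m}\Gamma_m^\top+\Sigma_{\zeta\zeta,m})\Psi_m^{-1\top}\Lambda_{x_2,m}^\top+\Sigma_{\varepsilon\varepsilon,m}$. The model $m^*$ has its own dimensions $k_{1,m^*},k_{2,m^*}$, matrices, parameter set $\Theta_{m^*}\subset\mathbb{R}^{q_{m^*}}$ (convex compact) and covariance structure $\Sigma_{m^*}(\theta_{m^*})$, defined in the same way with $m$ replaced by $m^*$. Observations. $X_{t_i^n}$ with $t_i^n=ih_n$, $0\le i\le n$, $T=nh_n$, and $Q_{XX}=\frac1T\sum_{i=1}^n(X_{t_i^n}-X_{t_{i-1}^n})(X_{t_i^n}-X_{t_{i-1}^n})^\top$. Further definitions. $\Delta_{m^*}=\partial\operatorname{vech}\Sigma_{m^*}(\theta)/\partial\theta^\top\big|_{\theta=\theta_{m^*,0}}\in\mathbb{R}^{\bar p\times q_{m^*}}$ (Jacobian). For positive definite $X,Y\in\mathbb{R}^{p\times p}$, $$V(X,Y)=\mathbb{D}_p^\top\int_0^1\!\!\int_0^1\lambda_2\,(Y+\lambda_1\lambda_2(X-Y))^{-1}\otimes(Y+\lambda_1\lambda_2(X-Y))^{-1}\,d\lambda_1d\lambda_2\,\mathbb{D}_p.$$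 Set $\tilde V(Q_{XX},\Sigma)=V(Q_{XX},\Sigma)$ if $Q_{XX}$ is non-singular and $\mathbb{I}_{\bar p}$ otherwise, and $$\mathbb{F}_{m^*,n}(\theta)=(\operatorname{vech}Q_{XX}-\operatorname{vech}\Sigma_{m^*}(\theta))^\top\tilde V(Q_{XX},\Sigma_{m^*}(\theta))(\operatorname{vech}Q_{XX}-\operatorname{vech}\Sigma_{m^*}(\theta)),\quad\theta\in\Theta_{m^*}.$$ (When $Q_{XX}>0$, $\mathbb{F}_{m^*,n}(\theta)=\log\det\Sigma_{m^*}(\theta)-\log\det Q_{XX}+\operatorname{tr}\{\Sigma_{m^*}(\theta)^{-1}Q_{XX}\}-p$.) The estimator $\hat\theta_{m^*,n}\in\Theta_{m^*}$ satisfies $\mathbb{F}_{m^*,n}(\hat\theta_{m^*,n})=\inf_{\theta\in\Theta_{m^*}}\mathbb{F}_{m^*,n}(\theta)$, and the quasi-likelihood ratio test statistic is $\mathbb{T}_{m^*,n}=n\,\mathbb{F}_{m^*,n}(\hat\theta_{m^*,n})$.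
   Formalization: The true value θ_{m*,0} is additionally assumed to be an interior point of Θ_{m*}; at a boundary point the limit is not χ² with p̄−q degrees of freedom, so the claim fails there. All dimensions (k's, q's) are at least 1. *)

theory Defs
  imports "HOL-Probability.Probability" "HOL-Library.Uprod"
begin

section \<open>Matrices\<close>

definition pos_def :: "real^'n^'n \<Rightarrow> bool" where
  "pos_def A \<longleftrightarrow> transpose A = A \<and> (\<forall>x. x \<noteq> 0 \<longrightarrow> 0 < x \<bullet> (A *v x))"

definition stack_vec :: "real^'a \<Rightarrow> real^'b \<Rightarrow> real^('a + 'b)" where
  "stack_vec x y = (\<chi> k. case k of Inl i \<Rightarrow> x $ i | Inr j \<Rightarrow> y $ j)"

definition block_mat ::
  "real^'a^'a \<Rightarrow> real^'b^'a \<Rightarrow> real^'a^'b \<Rightarrow> real^'b^'b \<Rightarrow> real^('a + 'b)^('a + 'b)" where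
  "block_mat A B C D = (\<chi> k l. case k of
      Inl i \<Rightarrow> (case l of Inl i' \<Rightarrow> A $ i $ i' | Inr j' \<Rightarrow> B $ i $ j')
    | Inr j \<Rightarrow> (case l of Inl i' \<Rightarrow> C $ j $ i' | Inr j' \<Rightarrow> D $ j $ j'))"

definition kronecker :: "real^'a^'b \<Rightarrow> real^'c^'d \<Rightarrow> real^('a \<times> 'c)^('b \<times> 'd)" where
  "kronecker A B = (\<chi> r c. A $ fst r $ fst c * B $ snd r $ snd c)"

text \<open>
  The coordinates of \<open>vec A\<close> are indexed by pairs (column, row), which is the order that matches
  \<open>kronecker\<close>. Those of the half-vectorization are indexed by unordered pairs of indices; there are
  \<open>p (p + 1) / 2\<close> of them (see \<open>card_UNIV_uprod\<close>), and for symmetric \<open>A\<close> the coordinate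
  \<open>Upair i j\<close> is the common value of \<open>A $ i $ j\<close> and \<open>A $ j $ i\<close>. Compared with stacking the lower
  triangle this is only a relabelling of the coordinates. For a non-symmetric matrix, \<open>vech\<close> picks one
  of the two entries arbitrarily; it is only applied to symmetric matrices.
\<close>

instance uprod :: (finite) finite
proof
  have "UNIV = (\<lambda>(x, y). Upair x y) ` (UNIV :: ('a \<times> 'a) set)"
    by (auto simp: image_iff) (metis uprod_exhaust)
  then show "finite (UNIV :: 'a uprod set)"
    by (metis finite finite_imageI)
qed

definition vec_of :: "real^'p^'p \<Rightarrow> real^('p \<times> 'p)" where
  "vec_of A = (\<chi> (k :: 'p \<times> 'p). A $ snd k $ fst k)"

definition vech :: "real^'p^'p \<Rightarrow> real^('p uprod)" where
  "vech A = (\<chi> u. SOME a. \<exists>i j. u = Upair i j \<and> a = A $ i $ j)"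

definition duplication :: "real^('p::finite uprod)^('p \<times> 'p)" where
  "duplication = (\<chi> (k :: 'p \<times> 'p) u. if u = Upair (fst k) (snd k) then 1 else 0)"

lemma vech_Upair:
  assumes "transpose A = A"
  shows "vech A $ Upair i j = A $ i $ j"
proof -
  have sym: "A $ i $ j = A $ j $ i" for i j
    using assms by (metis transpose_def vec_lambda_beta)
  have "(SOME a. \<exists>k l. Upair i j = Upair k l \<and> a = A $ k $ l) = A $ i $ j"
    by (rule some_equality) (use sym in auto)
  then show ?thesis
    by (simp add: vech_def)
qed

lemma duplication_vech:
  fixes A :: "real^'p^'p"
  assumes "transpose A = A"
  shows "duplication *v vech A = vec_of A"
proof -
  have "(duplication *v vech A) $ k = vec_of A $ k" for k :: "'p \<times> 'p"
  proof -
    have "(duplication *v vech A) $ k =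
        (\<Sum>u\<in>UNIV. if u = Upair (fst k) (snd k) then vech A $ u else 0)"
      unfolding matrix_vector_mult_def duplication_def vec_lambda_beta by (intro sum.cong) auto
    also have "\<dots> = A $ fst k $ snd k"
      by (simp add: vech_Upair[OF assms])
    also have "\<dots> = vec_of A $ k"
      using assms by (simp add: vec_of_def) (metis transpose_def vec_lambda_beta)
    finally show ?thesis .
  qed
  then show ?thesis
    by (simp add: vec_eq_iff)
qed

definition V_mat :: "real^'p^'p \<Rightarrow> real^'p^'p \<Rightarrow> real^('p uprod)^('p uprod)" where
  "V_mat X Y = transpose duplication **
     integral {0..1} (\<lambda>l2::real. integral {0..1} (\<lambda>l1::real.
       l2 *\<^sub>R kronecker (matrix_inv (Y + (l1 * l2) *\<^sub>R (X - Y)))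
                     (matrix_inv (Y + (l1 * l2) *\<^sub>R (X - Y))))) ** duplication"

definition V_tilde :: "real^'p^'p \<Rightarrow> real^'p^'p \<Rightarrow> real^('p uprod)^('p uprod)" where
  "V_tilde Q Y = (if invertible Q then V_mat Q Y else mat 1)"

text \<open>For positive definite \<open>Q\<close> and \<open>Y\<close> this is the normal discrepancy
  \<open>log det Y - log det Q + tr (Y\<^sup>-\<^sup>1 Q) - p\<close>, by Taylor's formula with integral remainder.\<close>

definition contrast :: "real^'p^'p \<Rightarrow> real^'p^'p \<Rightarrow> real" where
  "contrast Q Y = (vech Q - vech Y) \<bullet> (V_tilde Q Y *v (vech Q - vech Y))"

definition outer :: "real^'a \<Rightarrow> real^'b \<Rightarrow> real^'b^'a" where
  "outer x y = (\<chi> i j. x $ i * y $ j)"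

definition realized_cov :: "nat \<Rightarrow> real \<Rightarrow> (real \<Rightarrow> real^'p) \<Rightarrow> real^'p^'p" where
  "realized_cov n h x = (1 / (real n * h)) *\<^sub>R
     (\<Sum>i=1..n. outer (x (real i * h) - x (real (i - 1) * h)) (x (real i * h) - x (real (i - 1) * h)))"

section \<open>Covariance structures\<close>

text \<open>
  Every entry of a model matrix is either a known constant or a coordinate of the parameter
  \<open>\<theta>\<close>; several entries may share a coordinate. A model is given by the patterns of its eight
  matrices, and the matrices at \<open>\<theta>\<close> are obtained by filling in the parameter values. In particular
  they are defined for all \<open>\<theta>\<close> in the Euclidean space, not only in the parameter set.
\<close>

datatype 'q entry = Known real | Free 'q

fun entry_val :: "real^'q \<Rightarrow> 'q entry \<Rightarrow> real" where
  "entry_val \<theta> (Known c) = c"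
| "entry_val \<theta> (Free j) = \<theta> $ j"

definition fill :: "'q entry^'c^'r \<Rightarrow> real^'q \<Rightarrow> real^'c^'r" where
  "fill P \<theta> = (\<chi> i j. entry_val \<theta> (P $ i $ j))"

definition pattern_entries :: "'q entry^'c^'r \<Rightarrow> 'q entry set" where
  "pattern_entries P = {P $ i $ j | i j. True}"

record ('k1::finite, 'k2::finite, 'p1::finite, 'p2::finite, 'q) sem =
  Lambda_x1 :: "'q entry^'k1^'p1"
  Lambda_x2 :: "'q entry^'k2^'p2"
  Gamma_pat :: "'q entry^'k1^'k2"
  Psi_pat :: "'q entry^'k2^'k2"
  Sigma_xi :: "'q entry^'k1^'k1"
  Sigma_delta :: "'q entry^'p1^'p1"
  Sigma_eps :: "'q entry^'p2^'p2"
  Sigma_zeta :: "'q entry^'k2^'k2"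

text \<open>
  Standing assumptions on a model with parameter set \<open>\<Theta>\<close>: every parameter coordinate occurs as an
  entry; \<open>\<Psi> = I - B\<^sub>0\<close> with \<open>B\<^sub>0\<close> of zero diagonal; the four \<open>\<Sigma>\<close>-matrices have the form \<open>S S\<^sup>T\<close>,
  hence are symmetric, and square \<open>S\<close> suffice for this.
\<close>

definition gram :: "real^'d^'d \<Rightarrow> bool" where
  "gram A \<longleftrightarrow> (\<exists>S :: real^'d^'d. A = S ** transpose S)"

definition sem_model ::
  "('k1::finite, 'k2::finite, 'p1::finite, 'p2::finite, 'q::finite) sem \<Rightarrow> (real^'q) set \<Rightarrow> bool" where
  "sem_model m \<Theta> \<longleftrightarrow>
     CARD('k1) \<le> CARD('p1) \<and> CARD('k2) \<le> CARD('p2) \<and>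
     convex \<Theta> \<and> compact \<Theta> \<and>
     (\<forall>q. Free q \<in> pattern_entries (Lambda_x1 m) \<union> pattern_entries (Lambda_x2 m) \<union>
       pattern_entries (Gamma_pat m) \<union> pattern_entries (Psi_pat m) \<union>
       pattern_entries (Sigma_xi m) \<union> pattern_entries (Sigma_delta m) \<union>
       pattern_entries (Sigma_eps m) \<union> pattern_entries (Sigma_zeta m)) \<and>
     (\<forall>i. Psi_pat m $ i $ i = Known 1) \<and>
     transpose (Sigma_xi m) = Sigma_xi m \<and> transpose (Sigma_delta m) = Sigma_delta m \<and>
     transpose (Sigma_eps m) = Sigma_eps m \<and> transpose (Sigma_zeta m) = Sigma_zeta m \<and>
     (\<forall>\<theta>\<in>\<Theta>. gram (fill (Sigma_xi m) \<theta>) \<and> gram (fill (Sigma_delta m) \<theta>) \<and>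
            gram (fill (Sigma_eps m) \<theta>) \<and> gram (fill (Sigma_zeta m) \<theta>))"

definition sem_regular ::
  "('k1::finite, 'k2::finite, 'p1::finite, 'p2::finite, 'q::finite) sem \<Rightarrow> (real^'q) set \<Rightarrow> bool" where
  "sem_regular m \<Theta> \<longleftrightarrow>
     (\<forall>\<theta>\<in>\<Theta>. pos_def (fill (Sigma_delta m) \<theta>) \<and> pos_def (fill (Sigma_eps m) \<theta>) \<and>
            invertible (fill (Psi_pat m) \<theta>) \<and> rank (fill (Lambda_x1 m) \<theta>) = CARD('k1))"

definition Sigma_struct ::
  "('k1::finite, 'k2::finite, 'p1::finite, 'p2::finite, 'q::finite) sem \<Rightarrow> real^'q
     \<Rightarrow> real^('p1 + 'p2)^('p1 + 'p2)" where
  "Sigma_struct m \<theta> =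
    (let L1 = fill (Lambda_x1 m) \<theta>; L2 = fill (Lambda_x2 m) \<theta>; G = fill (Gamma_pat m) \<theta>;
         Psi_inv = matrix_inv (fill (Psi_pat m) \<theta>);
         Sxi = fill (Sigma_xi m) \<theta>; Sdelta = fill (Sigma_delta m) \<theta>;
         Seps = fill (Sigma_eps m) \<theta>; Szeta = fill (Sigma_zeta m) \<theta>;
         S11 = L1 ** Sxi ** transpose L1 + Sdelta;
         S12 = L1 ** Sxi ** transpose G ** transpose Psi_inv ** transpose L2;
         S22 = L2 ** Psi_inv ** (G ** Sxi ** transpose G + Szeta) ** transpose Psi_inv **
               transpose L2 + Seps
     in block_mat S11 S12 (transpose S12) S22)"

section \<open>Diffusions\<close>

text \<open>Processes are indexed by real time; only times \<open>t \<ge> 0\<close> matter.\<close>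

definition generated_sigma :: "'a measure \<Rightarrow> real set \<Rightarrow> (real \<Rightarrow> 'a \<Rightarrow> real^'d) \<Rightarrow> 'a set set" where
  "generated_sigma M I Y =
     sigma_sets (space M) {Y t -` A \<inter> space M | t A. t \<in> I \<and> A \<in> sets borel}"

definition std_wiener :: "'a measure \<Rightarrow> (real \<Rightarrow> 'a \<Rightarrow> real^'r) \<Rightarrow> bool" where
  "std_wiener M W \<longleftrightarrow>
     (\<forall>t\<ge>0. W t \<in> borel_measurable M) \<and>
     (\<forall>\<omega>\<in>space M. continuous_on {0..} (\<lambda>t. W t \<omega>)) \<and>
     (AE \<omega> in M. W 0 \<omega> = 0) \<and>
     (\<forall>s t. 0 \<le> s \<longrightarrow> s < t \<longrightarrow>
        distributed M lborel (\<lambda>\<omega>. W t \<omega> - W s \<omega>)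
          (\<lambda>x. \<Prod>i\<in>UNIV. ennreal (normal_density 0 (sqrt (t - s)) (x $ i))) \<and>
        prob_space.indep_set M (generated_sigma M {0..s} W)
          {(\<lambda>\<omega>. W t \<omega> - W s \<omega>) -` A \<inter> space M | A. A \<in> sets borel})"

text \<open>\<open>dY = B(Y) dt + S dW\<close>, \<open>Y\<^sub>0 = y0\<close>. Since \<open>S\<close> is constant, the stochastic integral
  \<open>\<integral>\<^sub>0\<^sup>t S dW\<close> is \<open>S W\<^sub>t\<close>.\<close>

definition sde_solution ::
  "'a measure \<Rightarrow> (real \<Rightarrow> 'a \<Rightarrow> real^'r) \<Rightarrow> (real^'d \<Rightarrow> real^'d) \<Rightarrow> real^'r^'d \<Rightarrow> real^'d
     \<Rightarrow> (real \<Rightarrow> 'a \<Rightarrow> real^'d) \<Rightarrow> bool" where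
  "sde_solution M W B S y0 Y \<longleftrightarrow>
     (\<forall>t\<ge>0. Y t \<in> borel_measurable M) \<and>
     (\<forall>\<omega>\<in>space M. continuous_on {0..} (\<lambda>t. Y t \<omega>)) \<and>
     (AE \<omega> in M. \<forall>t\<ge>0. Y t \<omega> = y0 + integral {0..t} (\<lambda>s. B (Y s \<omega>)) + S *v W t \<omega>)"

definition poly_growth :: "('b::real_normed_vector \<Rightarrow> 'c::real_normed_vector) \<Rightarrow> bool" where
  "poly_growth f \<longleftrightarrow> (\<exists>C (k::nat). \<forall>x. norm (f x) \<le> C * (1 + norm x) ^ k)"

text \<open>\<open>C_up k f\<close>: \<open>f\<close> is \<open>k\<close> times continuously differentiable, and \<open>f\<close> and all its partial
  derivatives up to order \<open>k\<close> are of polynomial growth. In the recursion \<open>g i\<close> is the \<open>i\<close>-th partial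
  derivative of \<open>f\<close>.\<close>

primrec C_up :: "nat \<Rightarrow> (real^'d \<Rightarrow> 'b::real_normed_vector) \<Rightarrow> bool" where
  "C_up 0 f \<longleftrightarrow> continuous_on UNIV f \<and> poly_growth f"
| "C_up (Suc k) f \<longleftrightarrow> continuous_on UNIV f \<and> poly_growth f \<and>
     (\<exists>g. (\<forall>x. (f has_derivative (\<lambda>v. \<Sum>i\<in>UNIV. (v $ i) *\<^sub>R g i x)) (at x)) \<and> (\<forall>i. C_up k (g i)))"

definition regular_drift :: "(real^'d \<Rightarrow> real^'d) \<Rightarrow> bool" where
  "regular_drift B \<longleftrightarrow> (\<exists>L. L-lipschitz_on UNIV B) \<and> C_up 4 B"

definition bounded_moments :: "'a measure \<Rightarrow> (real \<Rightarrow> 'a \<Rightarrow> real^'d) \<Rightarrow> bool" where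
  "bounded_moments M Y \<longleftrightarrow>
     (\<forall>l::real. 0 \<le> l \<longrightarrow> (SUP t\<in>{0..}. \<integral>\<^sup>+ \<omega>. ennreal (norm (Y t \<omega>) powr l) \<partial>M) < \<infinity>)"

text \<open>\<open>\<pi>\<close> is an invariant law of the diffusion: if \<open>Z x\<close> is the solution started at \<open>x\<close>, then
  \<open>\<integral> P(Z x t \<in> A) \<pi>(dx) = \<pi>(A)\<close>.\<close>

definition invariant_law ::
  "'a measure \<Rightarrow> (real \<Rightarrow> 'a \<Rightarrow> real^'r) \<Rightarrow> (real^'d \<Rightarrow> real^'d) \<Rightarrow> real^'r^'d
     \<Rightarrow> (real^'d) measure \<Rightarrow> bool" where
  "invariant_law M W B S \<pi> \<longleftrightarrow> prob_space \<pi> \<and> sets \<pi> = sets borel \<and>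
     (\<forall>Z. (\<forall>x. sde_solution M W B S x (Z x)) \<longrightarrow>
       (\<forall>t\<ge>0. \<forall>A\<in>sets borel.
          emeasure \<pi> A = (\<integral>\<^sup>+ x. emeasure M {\<omega>\<in>space M. Z x t \<omega> \<in> A} \<partial>\<pi>)))"

definition ergodic ::
  "'a measure \<Rightarrow> (real \<Rightarrow> 'a \<Rightarrow> real^'r) \<Rightarrow> (real^'d \<Rightarrow> real^'d) \<Rightarrow> real^'r^'d
     \<Rightarrow> (real \<Rightarrow> 'a \<Rightarrow> real^'d) \<Rightarrow> bool" where
  "ergodic M W B S Y \<longleftrightarrow> (\<exists>\<pi>. invariant_law M W B S \<pi> \<and>
     (\<forall>g :: real^'d \<Rightarrow> real. integrable \<pi> g \<longrightarrow>
       (\<forall>e>0. ((\<lambda>T. measure M {\<omega>\<in>space M.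
            e < \<bar>(1 / T) * (LBINT t:{0..T}. g (Y t \<omega>)) - (\<integral>x. g x \<partial>\<pi>)\<bar>}) \<longlongrightarrow> 0) at_top)))"

section \<open>The chi-squared distribution\<close>

text \<open>The law of the sum of squares of \<open>r\<close> independent standard normal variables; for \<open>r = 0\<close>
  the point mass at 0.\<close>

definition chi_squared :: "nat \<Rightarrow> real measure" where
  "chi_squared r = distr (PiM {..<r} (\<lambda>_. density lborel std_normal_density)) borel
     (\<lambda>x. \<Sum>i<r. (x i)\<^sup>2)"

end

theory Submission
  imports Defs
begin

text \<open>
  Write \<open>\<Sigma> = \<sigma> \<sigma>\<^sup>T\<close> for the true covariance, \<open>\<Delta>\<^sub>iW = sqrt h Z\<^sub>i\<close> for the increments of the four Wiener
  processes taken together, and \<open>A\<close> for the sum of the \<open>Z\<^sub>i Z\<^sub>i\<^sup>T - I\<close> divided by \<open>sqrt n\<close>. The drift over one step is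
  \<open>h \<beta> + O(h\<^sup>3)\<close> in mean square with \<open>\<beta>\<close> known beforehand, so the products of drift and noise form a
  martingale up to terms of order \<open>sqrt n h\<close>, and \<open>sqrt n (Q - \<Sigma>) = \<sigma> A \<sigma>\<^sup>T + o(1)\<close> in \<open>L\<^sup>1\<close>.

  The contrast is a double integral of \<open>tr (P\<^sup>-\<^sup>1 D P\<^sup>-\<^sup>1 D)\<close> with \<open>D = Q - \<Sigma>(\<theta>)\<close> and \<open>P\<close> on the segment
  between \<open>\<Sigma>(\<theta>)\<close> and \<open>Q\<close>. It is bounded below by a multiple of \<open>|D|\<^sup>2\<close>, so the minimizer is, without any
  probability, within \<open>O(|Q - \<Sigma>|)\<close> of the true parameter, and the minimum is \<open>1/2 |p|\<^sup>2 + o(|Q - \<Sigma>|\<^sup>2)\<close>.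
  Here \<open>\<Sigma> = R R\<^sup>T\<close> and \<open>p\<close> is the part of \<open>R\<^sup>-\<^sup>1 (Q - \<Sigma>) R\<^sup>-\<^sup>T\<close> orthogonal to the image of the derivative of
  \<open>\<Sigma>(\<theta>)\<close>; it lives in a space of dimension \<open>p (p + 1) / 2 - q\<close>.

  Its coordinates are linear functionals of \<open>A\<close> and satisfy a central limit theorem by a one-dimensional
  characteristic function argument. Averaging these characteristic functions over a Gaussian argument gives
  the Laplace transform of the statistic, and the Weierstrass approximation theorem turns convergence of
  Laplace transforms into weak convergence.
\<close>

section \<open>Matrices\<close>

text \<open>A drift-noise product has size h^(3/2). Bounding n of them one by one leaves a multiple
  of sqrt (n h), which diverges; because \<beta> is fixed before the noise of its step they add up
  like orthogonal variables and leave only sqrt h. The other products, of two drifts or of the error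
  with the noise, leave sqrt n h, and there n h^2 -> 0 enters. Hence the care about what the past
  knows: it is generated by the Wiener processes alone, and a diffusion is placed in it through its
  Euler scheme.

  The factor 1/2 of the residual is the integral of the weight \<open>l2\<close> over the unit
  square. It cancels against the variance \<open>2 * (norm G)\<^sup>2\<close> of a Gaussian
  quadratic form, so the limit has unit variances.

  Since h changes with n, the increments form a triangular array, but their normalized law is free
  of h and each characteristic function is an exact n-th power. The noise may have any dimension:
  \<sigma> is rectangular in general, and R^-1 \<sigma>, whose rows are orthonormal, carries the
  residual basis to an orthonormal family of matrices of the size of \<open>A\<close>.\<close>

lemma inner_matrix: "(A::real^'n^'m) \<bullet> B = (\<Sum>i\<in>UNIV. \<Sum>j\<in>UNIV. A $ i $ j * B $ i $ j)"
  by (simp add: inner_vec_def)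

text \<open>The inner product of nested vectors is the Frobenius product. Written as a trace it lets
  a factor move to the other side as its transpose, which drives \<open>inner_mult_left\<close> and
  \<open>inner_mult_right\<close>.\<close>

lemma inner_matrix_trace: "(A::real^'n^'m) \<bullet> B = trace (transpose A ** B)"
  unfolding inner_matrix trace_def matrix_matrix_mult_def transpose_def
  by (simp, subst sum.swap) simp

lemma inner_transpose: "transpose A \<bullet> transpose B = (A::real^'n^'m) \<bullet> B"
  unfolding inner_matrix transpose_def by (simp, subst sum.swap) simp

lemma inner_mult_left: "((A::real^'n^'m) ** (B::real^'k^'n)) \<bullet> C = B \<bullet> (transpose A ** C)"
  by (simp add: inner_matrix_trace matrix_transpose_mul matrix_mul_assoc)

lemma inner_mult_right: "((A::real^'n^'m) ** (B::real^'k^'n)) \<bullet> C = A \<bullet> (C ** transpose B)"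
  by (metis (no_types) inner_mult_left inner_transpose matrix_transpose_mul transpose_transpose)

lemma bounded_bilinear_matrix_mult:
  "bounded_bilinear ((**) :: real^'n^'m \<Rightarrow> real^'k^'n \<Rightarrow> real^'k^'m)"
  unfolding bilinear_conv_bounded_bilinear[symmetric] bilinear_def
  by (auto intro!: linearI simp: matrix_add_ldistrib vec_eq_iff matrix_matrix_mult_def sum.distrib algebra_simps sum_distrib_left)

lemmas continuous_on_matrix_mult [continuous_intros] =
  bounded_bilinear.continuous_on[OF bounded_bilinear_matrix_mult]

lemma linear_congruence: "linear (\<lambda>D::real^'n^'n. (A::real^'n^'m) ** D ** transpose A)"
  by (intro bounded_linear.linear bounded_linear_compose[OF bounded_bilinear.bounded_linear_left[OF bounded_bilinear_matrix_mult]
        bounded_bilinear.bounded_linear_right[OF bounded_bilinear_matrix_mult]])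

text \<open>Cauchy-Schwarz for every row of \<open>A\<close> against every column of
  \<open>B\<close>; the double sum of products then factors. \<open>norm\<close> is the Frobenius
  norm, so the later matrix estimates use it instead of the operator norm.\<close>

lemma norm_matrix_mult_le: "norm ((A::real^'n^'m) ** (B::real^'k^'n)) \<le> norm A * norm B"
proof -
  have "(norm (A ** B))\<^sup>2 = (\<Sum>i\<in>UNIV. \<Sum>j\<in>UNIV. (A $ i \<bullet> column j B)\<^sup>2)"
    unfolding power2_norm_eq_inner by (simp add: inner_matrix power2_eq_square
        matrix_matrix_mult_def column_def inner_vec_def)
  also have "\<dots> \<le> (\<Sum>i\<in>UNIV. \<Sum>j\<in>UNIV. (norm (A $ i))\<^sup>2 * (norm (column j B))\<^sup>2)"
    by (intro sum_mono) (metis Cauchy_Schwarz_ineq power2_norm_eq_inner)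
  also have "\<dots> = (\<Sum>i\<in>UNIV. (norm (A $ i))\<^sup>2) * (\<Sum>j\<in>UNIV. (norm (column j B))\<^sup>2)"
    by (simp add: sum_product)
  also have "(\<Sum>i\<in>UNIV. (norm (A $ i))\<^sup>2) = (norm A)\<^sup>2"
    by (simp add: power2_norm_eq_inner inner_vec_def)
  also have "(\<Sum>j\<in>UNIV. (norm (column j B))\<^sup>2) = (norm B)\<^sup>2"
    unfolding power2_norm_eq_inner inner_matrix column_def
    by (subst sum.swap) (simp add: inner_vec_def)
  finally show ?thesis
    by (simp add: power_mult_distrib[symmetric])
qed

section \<open>Inverses and determinants: algebra and smoothness\<close>

lemma pos_def_invertible:
  fixes A :: "real^'n^'n"
  assumes "pos_def A" shows "invertible A"
proof -
  have "x = 0" if "A *v x = 0" for x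
    using assms that unfolding pos_def_def by (metis inner_zero_right less_irrefl)
  then show ?thesis
    by (metis invertible_left_inverse matrix_left_invertible_ker)
qed

lemma matrix_inv_left_right:
  fixes A :: "real^'n^'n"
  assumes "invertible A" shows "A ** matrix_inv A = mat 1" "matrix_inv A ** A = mat 1"
  using assms unfolding invertible_def matrix_inv_def by (metis (mono_tags, lifting) someI_ex)+

lemma matrix_inv_unique:
  fixes A :: "real^'n^'n"
  assumes "A ** B = mat 1" shows "matrix_inv A = B"
  using assms by (metis invertible_right_inverse matrix_inv_left_right(2) matrix_mul_assoc matrix_mul_lid matrix_mul_rid)

lemma transpose_matrix_inv:
  fixes A :: "real^'n^'n"
  assumes "invertible A" shows "transpose (matrix_inv A) = matrix_inv (transpose A)"
  by (metis assms matrix_inv_left_right(2) matrix_inv_unique matrix_transpose_mul transpose_mat)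

text \<open>Each entry of the inverse becomes a quotient of determinants, hence of polynomials in
  the entries, and smoothness of the inverse follows from the quotient rule.\<close>

lemma matrix_inv_cramer:
  fixes A :: "real^'n^'n"
  assumes "invertible A"
  shows "matrix_inv A $ k $ j = det (\<chi> i l. if l = k then axis j 1 $ i else A $ i $ l) / det A"
proof -
  have "A *v (column j (matrix_inv A)) = axis j 1"
    using matrix_inv_left_right(1)[OF assms]
    by (metis matrix_vector_mul_assoc matrix_vector_mul_lid matrix_vector_mult_basis)
  then show ?thesis
    using cramer[of A "column j (matrix_inv A)" "axis j 1"] assms
    by (simp add: invertible_det_nz vec_eq_iff column_def)
qed

lemma det_differentiable:
  fixes f :: "'a::real_normed_vector \<Rightarrow> real^'n^'n"
  assumes "\<And>i j. (\<lambda>x. f x $ i $ j) differentiable (at x within S)"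
  shows "(\<lambda>x. det (f x)) differentiable (at x within S)"
proof -
  have "(\<lambda>x. \<Prod>i\<in>I. f x $ i $ p i) differentiable (at x within S)" for p and I :: "'n set"
    by (induction I rule: infinite_finite_induct) (auto intro!: differentiable_mult assms)
  then show ?thesis
    unfolding det_def by (intro differentiable_sum finite_permutations differentiable_mult) auto
qed

lemma matrix_inv_differentiable:
  fixes A :: "real^'n^'n"
  assumes "invertible A" shows "matrix_inv differentiable (at A)"
proof -
  have nth: "(\<lambda>B::real^'n^'n. B $ i $ j) differentiable (at A)" for i j
    by (intro bounded_linear_imp_differentiable bounded_linear_vec_nth
      bounded_linear_compose[OF bounded_linear_vec_nth])
  have d: "(det :: real^'n^'n \<Rightarrow> real) differentiable (at A)"
    by (rule det_differentiable[of "\<lambda>x. x"]) (rule nth)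
  have cont: "isCont (det :: real^'n^'n \<Rightarrow> real) A"
    by (rule differentiable_imp_continuous_within[OF d])
  have ev: "\<forall>\<^sub>F B in nhds A. invertible B"
    unfolding invertible_det_nz
    by (rule tendsto_imp_eventually_ne) (use cont assms in \<open>auto simp: tendsto_at_iff_tendsto_nhds isCont_def invertible_det_nz\<close>)
  have "(\<lambda>B. matrix_inv B $ k $ j) differentiable (at A)" for k j
  proof -
    have "(\<lambda>B. det (\<chi> i l. if l = k then axis j 1 $ i else B $ i $ l) / det B) differentiable (at A)"
    proof (intro differentiable_divide det_differentiable d)
      show "(\<lambda>B. (\<chi> i l. if l = k then axis j 1 $ i else B $ i $ l) $ i $ l) differentiable (at A)" for i l
        using nth[of i l] by (cases "l = k") auto
    qed (use assms in \<open>auto simp: invertible_det_nz intro: nth\<close>)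
    then obtain D where D: "((\<lambda>B. det (\<chi> i l. if l = k then axis j 1 $ i else B $ i $ l) / det B) has_derivative D) (at A)"
      unfolding differentiable_def by blast
    \<comment> \<open>\<open>matrix_inv\<close> has no prescribed value at singular matrices, so
      Cramer's formula may replace it only on the neighbourhood of \<open>A\<close> given by
      \<open>ev\<close>.\<close>
    have "((\<lambda>B. matrix_inv B $ k $ j) has_derivative D) (at A)"
      by (rule has_derivative_transform_eventually[OF D])
        (use ev assms in \<open>auto simp: matrix_inv_cramer eventually_at_filter elim!: eventually_mono\<close>)
    then show ?thesis unfolding differentiable_def by blast
  qed
  then show ?thesis
    unfolding differentiable_componentwise_within[of matrix_inv]
    by (auto simp: Basis_vec_def inner_axis)
qed

lemma continuous_on_matrix_inv [continuous_intros]: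
  fixes f :: "'a::topological_space \<Rightarrow> real^'n^'n"
  assumes "continuous_on S f" "\<And>x. x \<in> S \<Longrightarrow> invertible (f x)"
  shows "continuous_on S (\<lambda>x. matrix_inv (f x))"
proof -
  have "continuous_on {A::real^'n^'n. invertible A} matrix_inv"
    by (intro continuous_at_imp_continuous_on ballI differentiable_imp_continuous_within matrix_inv_differentiable) auto
  then show ?thesis
    by (rule continuous_on_compose2[OF _ assms(1)]) (use assms(2) in auto)
qed

text \<open>Cholesky elimination by induction on the set of rows that may be non-zero: subtracting
  the rank-one matrix \<open>outer u u\<close> clears row and column \<open>i\<close>, and
  Cauchy-Schwarz for the form of \<open>P\<close> keeps the difference positive semidefinite. Zero
  pivots are allowed, so \<open>P\<close> may be singular.\<close>

lemma psd_gram: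
  fixes P :: "real^'n^'n"
  assumes sym: "transpose P = P" and psd: "\<And>x. 0 \<le> x \<bullet> (P *v x)"
  shows "gram P"
proof -
  have "\<exists>r :: 'n \<Rightarrow> real^'n. P = (\<Sum>i\<in>S. outer (r i) (r i))"
    if "finite S" "transpose P = P" "\<And>x. 0 \<le> x \<bullet> (P *v x)" "\<And>i j. i \<notin> S \<Longrightarrow> P $ i $ j = 0" for S and P :: "real^'n^'n"
    using that
  proof (induction S arbitrary: P rule: finite_induct)
    case empty
    then show ?case by (simp add: vec_eq_iff)
  next
    case (insert i S)
    have sym: "P $ k $ l = P $ l $ k" for k l
      using insert.prems(1) by (metis transpose_def vec_lambda_beta)
    have form: "x \<bullet> (P *v y) = y \<bullet> (P *v x)" for x y
      by (metis insert.prems(1) dot_lmul_matrix inner_commute transpose_matrix_vector)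
    define e :: "real^'n" where "e = axis i 1"
    have Pe: "x \<bullet> (P *v e) = (\<Sum>k\<in>UNIV. x $ k * P $ k $ i)" for x
      by (simp add: e_def matrix_vector_mult_basis inner_vec_def column_def)
    have ePe: "e \<bullet> (P *v e) = P $ i $ i"
      by (simp add: e_def matrix_vector_mult_basis inner_axis' column_def)
    have quad: "(x - t *\<^sub>R e) \<bullet> (P *v (x - t *\<^sub>R e)) = x \<bullet> (P *v x) - 2 * t * (x \<bullet> (P *v e)) + t\<^sup>2 * P $ i $ i" for x t
      using form[of x e] ePe
      by (simp add: matrix_vector_mult_diff_distrib inner_diff matrix_vector_mult_scaleR power2_eq_square algebra_simps)
    have ineq: "(x \<bullet> (P *v e))\<^sup>2 \<le> P $ i $ i * (x \<bullet> (P *v x))" for x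
    proof (cases "P $ i $ i = 0")
      case True
      have "x \<bullet> (P *v e) = 0"
      proof (rule ccontr)
        assume n: "x \<bullet> (P *v e) \<noteq> 0"
        \<comment> \<open>With a zero pivot the form is affine in \<open>t\<close> along
          \<open>x - t *\<^sub>R e\<close>; this \<open>t\<close> would give it the value
          -1.\<close>
        define t where "t = (x \<bullet> (P *v x) + 1) / (2 * (x \<bullet> (P *v e)))"
        have "2 * t * (x \<bullet> (P *v e)) = x \<bullet> (P *v x) + 1"
          using n by (simp add: t_def)
        then show False
          using insert.prems(2)[of "x - t *\<^sub>R e"] quad[of x t] True by simp
      qed
      then show ?thesis using True by simp
    next
      case False
      moreover have "0 \<le> P $ i $ i" using insert.prems(2)[of e] ePe by simp
      ultimately have pos: "0 < P $ i $ i" by simp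
      define t where "t = (x \<bullet> (P *v e)) / P $ i $ i"
      have "0 \<le> x \<bullet> (P *v x) - 2 * t * (x \<bullet> (P *v e)) + t\<^sup>2 * P $ i $ i"
        using insert.prems(2)[of "x - t *\<^sub>R e"] quad[of x t] by simp
      also have "\<dots> = x \<bullet> (P *v x) - (x \<bullet> (P *v e))\<^sup>2 / P $ i $ i"
        using pos by (simp add: t_def power2_eq_square field_simps)
      finally show ?thesis using pos by (simp add: field_simps)
    qed
    \<comment> \<open>For a zero pivot \<open>1 / sqrt 0\<close> is 0, so \<open>u\<close> vanishes;
      column \<open>i\<close> of \<open>P\<close> vanishes too, by \<open>ineq\<close>, and there is
      nothing to remove.\<close>
    define u :: "real^'n" where "u = (1 / sqrt (P $ i $ i)) *\<^sub>R (P *v e)"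
    define P' where "P' = P - outer u u"
    have diag: "0 \<le> P $ i $ i" using insert.prems(2)[of e] ePe by simp
    have uval: "u $ k = P $ k $ i / sqrt (P $ i $ i)" for k
      by (simp add: u_def e_def matrix_vector_mult_basis column_def)
    have uu: "u $ k * u $ l = P $ k $ i * P $ l $ i / P $ i $ i" for k l
      using diag by (simp add: uval)
    have z: "P $ k $ i = 0" if "P $ i $ i = 0" for k
      using ineq[of "axis k 1"] that by (simp add: e_def matrix_vector_mult_basis inner_axis' column_def)
    have "transpose P' = P'"
      using sym by (simp add: P'_def transpose_def outer_def vec_eq_iff mult.commute)
    moreover have "0 \<le> x \<bullet> (P' *v x)" for x
    proof -
      have "outer u u *v x = (u \<bullet> x) *\<^sub>R u"
        by (simp add: vec_eq_iff outer_def matrix_vector_mult_def inner_vec_def sum_distrib_left sum_distrib_right ac_simps)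
      then have "x \<bullet> (P' *v x) = x \<bullet> (P *v x) - (u \<bullet> x)\<^sup>2"
        by (simp add: P'_def matrix_vector_mult_diff_rdistrib inner_diff_right power2_eq_square inner_commute)
      also have "(u \<bullet> x)\<^sup>2 = (x \<bullet> (P *v e))\<^sup>2 / P $ i $ i"
        using diag by (simp add: u_def power_mult_distrib power_divide inner_commute)
      finally have eq: "x \<bullet> (P' *v x) = x \<bullet> (P *v x) - (x \<bullet> (P *v e))\<^sup>2 / P $ i $ i" .
      show ?thesis
        using ineq[of x] diag insert.prems(2)[of x] unfolding eq
        by (cases "P $ i $ i = 0") (auto simp: field_simps)
    qed
    moreover have "P' $ k $ l = 0" if "k \<notin> S" for k l
    proof (cases "k = i")
      case True
      then show ?thesis
        using z sym[of i l] by (simp add: P'_def outer_def uu)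
    next
      case False
      then have "k \<notin> insert i S" using that by simp
      then have "P $ k $ l = 0" "P $ k $ i = 0"
        using insert.prems(3) by blast+
      then show ?thesis by (simp add: P'_def outer_def uu)
    qed
    ultimately obtain r where r: "P' = (\<Sum>k\<in>S. outer (r k) (r k))"
      using insert.IH by blast
    have "P = (\<Sum>k\<in>insert i S. outer ((r(i := u)) k) ((r(i := u)) k))"
    proof -
      have "(\<Sum>k\<in>S. outer ((r(i := u)) k) ((r(i := u)) k)) = P'"
        unfolding r using insert.hyps by (intro sum.cong) auto
      then show ?thesis using insert.hyps by (simp add: P'_def)
    qed
    then show ?case by blast
  qed
  from this[of UNIV P] sym psd obtain r :: "'n \<Rightarrow> real^'n" where r: "P = (\<Sum>i\<in>UNIV. outer (r i) (r i))"
    by auto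
  \<comment> \<open>The vectors \<open>r j\<close> become the columns of the factor.\<close>
  have "P = (\<chi> i j. r j $ i) ** transpose (\<chi> i j. r j $ i)"
    unfolding r by (simp add: vec_eq_iff matrix_matrix_mult_def transpose_def outer_def)
  then show ?thesis unfolding gram_def by blast
qed

section \<open>The normal discrepancy\<close>

lemma pos_def_sym: "pos_def A \<Longrightarrow> transpose A = A"
  by (simp add: pos_def_def)

lemma pos_def_entry_sym:
  assumes "pos_def A" shows "A $ i $ j = A $ j $ i"
proof -
  have "transpose A $ i $ j = A $ i $ j" using pos_def_sym[OF assms] by simp
  then show ?thesis by (simp add: transpose_def)
qed

lemma pos_def_segment:
  fixes X Y :: "real^'n^'n"
  assumes "pos_def X" "pos_def Y" "0 \<le> s" "s \<le> 1"
  shows "pos_def (Y + s *\<^sub>R (X - Y))"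
  unfolding pos_def_def
proof (intro conjI allI impI)
  show "transpose (Y + s *\<^sub>R (X - Y)) = Y + s *\<^sub>R (X - Y)"
    using pos_def_entry_sym[OF assms(1)] pos_def_entry_sym[OF assms(2)]
    by (simp add: transpose_def vec_eq_iff)
next
  fix x :: "real^'n" assume "x \<noteq> 0"
  then have pos: "0 < x \<bullet> (X *v x)" "0 < x \<bullet> (Y *v x)"
    using assms(1,2) by (auto simp: pos_def_def)
  have "x \<bullet> ((Y + s *\<^sub>R (X - Y)) *v x) = (1 - s) * (x \<bullet> (Y *v x)) + s * (x \<bullet> (X *v x))"
    by (simp add: matrix_vector_mult_add_rdistrib matrix_vector_mult_diff_rdistrib inner_add_right
        inner_diff_right scaleR_matrix_vector_assoc[symmetric] algebra_simps)
  also have "\<dots> > 0"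
    using pos assms(3,4) by (cases "s = 0") (auto intro!: add_nonneg_pos)
  finally show "0 < x \<bullet> ((Y + s *\<^sub>R (X - Y)) *v x)" .
qed

text \<open>The identity vec (C D B^T) = \<open>kronecker B C\<close> vec D for the column-first
  ordering of \<open>vec_of\<close>: the first factor acts on columns, the second on rows.\<close>

lemma kronecker_quadratic:
  fixes A D :: "real^'n^'n"
  shows "vec_of A \<bullet> (kronecker B C *v vec_of D) = A \<bullet> (C ** D ** transpose B)"
proof -
  have "vec_of A \<bullet> (kronecker B C *v vec_of D) =
    (\<Sum>i\<in>UNIV. \<Sum>j\<in>UNIV. A $ j $ i * (\<Sum>k\<in>UNIV. \<Sum>l\<in>UNIV. B $ i $ k * C $ j $ l * D $ l $ k))"
    by (simp add: inner_vec_def matrix_vector_mult_def vec_of_def kronecker_def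
      UNIV_Times_UNIV[symmetric] sum.cartesian_product' del: UNIV_Times_UNIV)
  also have "\<dots> = (\<Sum>j\<in>UNIV. \<Sum>i\<in>UNIV. A $ j $ i * (\<Sum>k\<in>UNIV. (\<Sum>l\<in>UNIV. C $ j $ l * D $ l $ k) * B $ i $ k))"
    by (subst sum.swap) (simp add: sum_distrib_left sum_distrib_right ac_simps)
  finally show ?thesis
    by (simp add: inner_matrix matrix_matrix_mult_def transpose_def)
qed

text \<open>The second derivative in \<open>s\<close> of - log det along the segment from
  \<open>Y\<close> to \<open>Q\<close>. The double integral in \<open>V_mat\<close> is the integral
  remainder of a Taylor expansion of - log det, with \<open>s = l1 * l2\<close>.\<close>

definition discrepancy_rate :: "real^'n^'n \<Rightarrow> real^'n^'n \<Rightarrow> real \<Rightarrow> real" where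
  "discrepancy_rate Q Y s = (Q - Y) \<bullet>
     (matrix_inv (Y + s *\<^sub>R (Q - Y)) ** (Q - Y) ** matrix_inv (Y + s *\<^sub>R (Q - Y)))"

lemma continuous_on_discrepancy_rate:
  "continuous_on {z. pos_def (fst z) \<and> pos_def (fst (snd z)) \<and> 0 \<le> snd (snd z) \<and> snd (snd z) \<le> 1}
     (\<lambda>z. discrepancy_rate (fst z) (fst (snd z)) (snd (snd z)))"
  unfolding discrepancy_rate_def
  by (intro continuous_intros) (auto intro!: pos_def_invertible pos_def_segment)

lemma continuous_on_kronecker [continuous_intros]:
  assumes "continuous_on S f" "continuous_on S g"
  shows "continuous_on S (\<lambda>x. kronecker (f x) (g x))"
  unfolding kronecker_def by (intro continuous_intros assms)

lemma mult_unit_interval: "0 \<le> a \<Longrightarrow> a \<le> 1 \<Longrightarrow> 0 \<le> b \<Longrightarrow> b \<le> 1 \<Longrightarrow> 0 \<le> a * b \<and> a * b \<le> (1::real)"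
  by (simp add: mult_le_one)

lemma continuous_on_slice:
  assumes "continuous_on (S \<times> T) (\<lambda>(x, y). f x y)" "x \<in> S"
  shows "continuous_on T (f x)"
proof -
  have "continuous_on T (\<lambda>y. (\<lambda>(x, y). f x y) (x, y))"
    by (rule continuous_on_compose2[OF assms(1)]) (use assms(2) in \<open>auto intro!: continuous_intros\<close>)
  then show ?thesis by simp
qed

lemma inner_transpose_mult: "x \<bullet> (transpose A *v y) = ((A::real^'n^'m) *v x) \<bullet> y"
  by (metis dot_lmul_matrix inner_commute transpose_matrix_vector)

text \<open>The quadratic form of a fixed vector is a bounded linear functional of the matrix, so it
  passes under both integrals; duplication turns the difference of half-vectorizations into
  \<open>vec_of (Q - Y)\<close>. For definite \<open>Q\<close> only the first branch of
  \<open>V_tilde\<close> occurs.\<close>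

lemma contrast_eq_integral:
  fixes Q Y :: "real^'n^'n"
  assumes Q: "pos_def Q" and Y: "pos_def Y"
  shows "contrast Q Y =
    integral {0..1} (\<lambda>l2. integral {0..1} (\<lambda>l1. l2 * discrepancy_rate Q Y (l1 * l2)))"
proof -
  define N where "N s = matrix_inv (Y + s *\<^sub>R (Q - Y))" for s
  define x where "x = vec_of (Q - Y)"
  let ?D = "duplication :: real^('n uprod)^('n \<times> 'n)"
  let ?f = "\<lambda>l2 l1::real. l2 *\<^sub>R kronecker (N (l1 * l2)) (N (l1 * l2))"
  have pd: "pos_def (Y + s *\<^sub>R (Q - Y))" if "0 \<le> s" "s \<le> 1" for s
    using assms that by (intro pos_def_segment)
  have cN: "continuous_on ({0..1} \<times> {0..1}) (\<lambda>z. N (snd z * fst z))"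
    unfolding N_def using mult_unit_interval
    by (intro continuous_intros) (auto intro!: pos_def_invertible pd simp: mem_Times_iff)
  have cf: "continuous_on ({0..1} \<times> cbox 0 1) (\<lambda>(l2, l1). ?f l2 l1)"
    unfolding split_def by (intro continuous_intros) (use cN in auto)
  have int1: "?f l2 integrable_on {0..1}" if "l2 \<in> {0..1}" for l2
    using continuous_on_slice[OF cf that] by (intro integrable_continuous_real) simp
  have int2: "(\<lambda>l2. integral {0..1} (?f l2)) integrable_on {0..1}"
    using integral_continuous_on_param[OF cf] by (intro integrable_continuous_real) auto
  have lin: "bounded_linear (\<lambda>A::real^('n \<times> 'n)^('n \<times> 'n). x \<bullet> (A *v x))"
    unfolding linear_conv_bounded_linear[symmetric]
    by (auto intro!: linearI simp: matrix_vector_mult_add_rdistrib inner_add_right scaleR_matrix_vector_assoc[symmetric])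
  have "?D *v (vech Q - vech Y) = x"
    unfolding matrix_vector_mult_diff_distrib duplication_vech[OF pos_def_sym[OF Q]]
      duplication_vech[OF pos_def_sym[OF Y]]
    by (simp add: x_def vec_of_def vec_eq_iff)
  then have "contrast Q Y = x \<bullet> (integral {0..1} (\<lambda>l2. integral {0..1} (?f l2)) *v x)"
    unfolding contrast_def V_tilde_def V_mat_def N_def[symmetric]
    using pos_def_invertible[OF Q]
    by (simp only: matrix_vector_mul_assoc[symmetric] inner_transpose_mult if_True)
  also have "\<dots> = integral {0..1} (\<lambda>l2. x \<bullet> (integral {0..1} (?f l2) *v x))"
    using integral_linear[OF int2 lin] by (simp add: o_def)
  also have "\<dots> = integral {0..1} (\<lambda>l2. integral {0..1} (\<lambda>l1. x \<bullet> (?f l2 l1 *v x)))"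
    using integral_linear[OF int1 lin] by (intro integral_cong) (simp add: o_def)
  also have "\<dots> = integral {0..1} (\<lambda>l2. integral {0..1} (\<lambda>l1. l2 * discrepancy_rate Q Y (l1 * l2)))"
  proof (intro integral_cong)
    fix l2 l1 :: real assume l: "l2 \<in> {0..1}" "l1 \<in> {0..1}"
    \<comment> \<open>\<open>kronecker_quadratic\<close> produces N D N^T while
      \<open>discrepancy_rate\<close> has N D N; symmetry of \<open>N\<close> on the segment
      reconciles them.\<close>
    have "0 \<le> l1 * l2" "l1 * l2 \<le> 1" using mult_unit_interval[of l1 l2] l by auto
    then have "transpose (N (l1 * l2)) = N (l1 * l2)"
      unfolding N_def using pd pos_def_invertible pos_def_sym transpose_matrix_inv by metis
    then show "x \<bullet> (?f l2 l1 *v x) = l2 * discrepancy_rate Q Y (l1 * l2)"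
      unfolding discrepancy_rate_def N_def[symmetric]
      by (simp add: scaleR_matrix_vector_assoc[symmetric] x_def kronecker_quadratic)
  qed
  finally show ?thesis .
qed

text \<open>The weight \<open>l2\<close> has integral 1/2 over the unit square, so uniform bounds on
  the rate become bounds on the contrast with this factor. The estimates of the contrast below rest
  on this.\<close>

lemma contrast_bounds:
  fixes Q Y :: "real^'n^'n"
  assumes Q: "pos_def Q" and Y: "pos_def Y"
  shows "(\<And>s. 0 \<le> s \<Longrightarrow> s \<le> 1 \<Longrightarrow> a \<le> discrepancy_rate Q Y s) \<Longrightarrow> a / 2 \<le> contrast Q Y"
    and "(\<And>s. 0 \<le> s \<Longrightarrow> s \<le> 1 \<Longrightarrow> discrepancy_rate Q Y s \<le> b) \<Longrightarrow> contrast Q Y \<le> b / 2"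
proof -
  let ?f = "\<lambda>l2 l1::real. l2 * discrepancy_rate Q Y (l1 * l2)"
  have cf: "continuous_on ({0..1} \<times> cbox 0 1) (\<lambda>(l2, l1). ?f l2 l1)"
    unfolding split_def
    by (intro continuous_intros continuous_on_compose2[OF continuous_on_discrepancy_rate,
          of _ "\<lambda>z. (Q, Y, snd z * fst z)", simplified])
      (use Q Y mult_unit_interval in auto)
  have int1: "?f l2 integrable_on {0..1}" if "l2 \<in> {0..1}" for l2
    using continuous_on_slice[OF cf that] by (intro integrable_continuous_real) simp
  have int2: "(\<lambda>l2. integral {0..1} (?f l2)) integrable_on {0..1}"
    using integral_continuous_on_param[OF cf] by (intro integrable_continuous_real) auto
  have const: "integral {0..1} (\<lambda>l2::real. integral {0..1::real} (\<lambda>l1. l2 * c)) = c / 2" for c :: real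
    using integral_mult_left[of "{0..1}" "\<lambda>x::real. x" c] ident_has_integral[of 0 "1::real"]
    by (simp add: integral_unique)
  have cint: "(\<lambda>l2::real. integral {0..1::real} (\<lambda>l1. l2 * c)) integrable_on {0..1}"
    "(\<lambda>l1::real. (l2::real) * c) integrable_on {0..1}" for c l2 :: real
    by (auto intro!: integrable_continuous_real continuous_intros)
  show "a / 2 \<le> contrast Q Y" if "\<And>s. 0 \<le> s \<Longrightarrow> s \<le> 1 \<Longrightarrow> a \<le> discrepancy_rate Q Y s"
    unfolding contrast_eq_integral[OF assms] const[of a, symmetric]
    by (intro integral_le int1 int2 cint mult_left_mono that) (use mult_unit_interval in auto)
  show "contrast Q Y \<le> b / 2" if "\<And>s. 0 \<le> s \<Longrightarrow> s \<le> 1 \<Longrightarrow> discrepancy_rate Q Y s \<le> b"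
    unfolding contrast_eq_integral[OF assms] const[of b, symmetric]
    by (intro integral_le int1 int2 cint mult_left_mono that) (use mult_unit_interval in auto)
qed

text \<open>Needed for measurability of the statistic. Continuity of integrals in a parameter is
  applied twice, the first time with the outer variable \<open>l2\<close> as part of the
  parameter.\<close>

lemma continuous_on_contrast:
  "continuous_on {z::(real^'n^'n) \<times> (real^'n^'n). pos_def (fst z) \<and> pos_def (snd z)} (\<lambda>z. contrast (fst z) (snd z))"
proof -
  let ?U = "{z::(real^'n^'n) \<times> (real^'n^'n). pos_def (fst z) \<and> pos_def (snd z)}"
  let ?f = "\<lambda>z l2 l1::real. l2 * discrepancy_rate (fst z) (snd z) (l1 * l2)"
  have c1: "continuous_on ((?U \<times> cbox 0 1) \<times> cbox 0 1) (\<lambda>(w, l1). ?f (fst w) (snd w) l1)"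
    unfolding split_def
    by (intro continuous_intros continuous_on_compose2[OF continuous_on_discrepancy_rate,
          of _ "\<lambda>w. (fst (fst (fst w)), snd (fst (fst w)), snd w * snd (fst w))", simplified])
      (use mult_unit_interval in auto)
  have c2: "continuous_on (?U \<times> cbox 0 1) (\<lambda>(z, l2). integral (cbox 0 1) (?f z l2))"
    using integral_continuous_on_param[OF c1] by (simp only: split_def)
  have "continuous_on ?U (\<lambda>z. integral {0..1} (\<lambda>l2. integral {0..1} (?f z l2)))"
    using integral_continuous_on_param[OF c2] by (simp only: cbox_interval)
  then show ?thesis
    by (rule continuous_on_eq) (auto simp: contrast_eq_integral)
qed

section \<open>Whitening by a factor of a positive definite matrix\<close>

lemma pos_def_factor:
  fixes S :: "real^'n^'n"
  assumes "pos_def S"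
  obtains R :: "real^'n^'n" where "S = R ** transpose R" "invertible R"
proof -
  have psd: "0 \<le> x \<bullet> (S *v x)" for x
    using assms unfolding pos_def_def by (cases "x = 0") (auto intro: less_imp_le)
  obtain R :: "real^'n^'n" where R: "S = R ** transpose R"
    using psd_gram[OF pos_def_sym[OF assms] psd] unfolding gram_def by blast
  have "R ** (transpose R ** matrix_inv S) = mat 1"
    using matrix_inv_left_right(1)[OF pos_def_invertible[OF assms]] by (simp add: R matrix_mul_assoc)
  then have "invertible R"
    unfolding invertible_right_inverse by blast
  with R that show ?thesis by blast
qed

lemma factor_quadratic:
  fixes R D :: "real^'n^'n"
  assumes S: "S = R ** transpose R" and R: "invertible R"
  defines "T \<equiv> matrix_inv R ** D ** transpose (matrix_inv R)"
  shows "D \<bullet> (matrix_inv S ** D ** matrix_inv S) = (norm T)\<^sup>2"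
    and "D = R ** T ** transpose R" and "(norm R)\<^sup>2 = trace S"
proof -
  let ?N = "matrix_inv R"
  have RN: "R ** ?N = mat 1" "?N ** R = mat 1"
    using matrix_inv_left_right[OF R] by auto
  then have RN': "transpose ?N ** transpose R = mat 1" "transpose R ** transpose ?N = mat 1"
    by (metis matrix_transpose_mul transpose_mat)+
  have inv: "matrix_inv S = transpose ?N ** ?N"
    unfolding S by (rule matrix_inv_unique) (metis RN(1) RN'(2) matrix_mul_assoc matrix_mul_lid)
  have "D \<bullet> (matrix_inv S ** D ** matrix_inv S) = D \<bullet> (transpose ?N ** (T ** ?N))"
    by (simp add: inv T_def matrix_mul_assoc)
  also have "\<dots> = (?N ** D) \<bullet> (T ** ?N)"
    by (simp add: inner_mult_left)
  also have "\<dots> = T \<bullet> T"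
    by (metis T_def inner_commute inner_mult_right)
  finally show "D \<bullet> (matrix_inv S ** D ** matrix_inv S) = (norm T)\<^sup>2"
    by (simp add: power2_norm_eq_inner)
  show "D = R ** T ** transpose R"
    unfolding T_def by (metis RN(1) RN'(1) matrix_mul_assoc matrix_mul_lid matrix_mul_rid)
  show "(norm R)\<^sup>2 = trace S"
    unfolding power2_norm_eq_inner inner_matrix_trace S by (rule trace_mul_sym)
qed

lemma norm_transpose [simp]: "norm (transpose A) = norm (A::real^'n^'m)"
  by (simp add: norm_eq_sqrt_inner inner_transpose)

lemma norm_congruence_le: "norm ((A::real^'n^'m) ** D ** transpose A) \<le> (norm A)\<^sup>2 * norm D"
proof -
  have "norm (A ** D ** transpose A) \<le> norm A * norm D * norm (transpose A)"
    by (meson mult_right_mono norm_ge_zero norm_matrix_mult_le order_trans)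
  then show ?thesis by (simp add: power2_eq_square ac_simps)
qed

text \<open>From D = R T R^T and |R|^2 = trace P. The trace stands in for the largest eigenvalue: it
  is linear in \<open>P\<close>, so a bound at both ends of a segment holds along it.\<close>

lemma trace_inv_quadratic_lower:
  fixes P D :: "real^'n^'n"
  assumes "pos_def P" and "trace P \<le> c"
  shows "(norm D)\<^sup>2 \<le> c\<^sup>2 * (D \<bullet> (matrix_inv P ** D ** matrix_inv P))"
    and "0 \<le> D \<bullet> (matrix_inv P ** D ** matrix_inv P)"
proof -
  obtain R :: "real^'n^'n" where R: "P = R ** transpose R" "invertible R"
    using pos_def_factor[OF assms(1)] .
  define T where "T = matrix_inv R ** D ** transpose (matrix_inv R)"
  note f = factor_quadratic(1,2)[OF R, of D, folded T_def] factor_quadratic(3)[OF R]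
  have "norm D \<le> (norm R)\<^sup>2 * norm T"
    using norm_congruence_le[of R T] f(2) by simp
  also have "\<dots> = trace P * norm T"
    by (simp add: f(3))
  also have "\<dots> \<le> c * norm T"
    using assms(2) by (intro mult_right_mono) auto
  finally have "norm D \<le> c * norm T" .
  then have "(norm D)\<^sup>2 \<le> (c * norm T)\<^sup>2"
    by (simp add: power_mono)
  then show "(norm D)\<^sup>2 \<le> c\<^sup>2 * (D \<bullet> (matrix_inv P ** D ** matrix_inv P))"
    by (simp add: f(1) power_mult_distrib)
  show "0 \<le> D \<bullet> (matrix_inv P ** D ** matrix_inv P)"
    by (simp add: f(1))
qed

text \<open>Identification without probability: a small contrast forces \<open>Q\<close> and
  \<open>Y\<close> together throughout a bounded set, not only near the true covariance.\<close>

lemma contrast_lower: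
  fixes Q Y :: "real^'n^'n"
  assumes "pos_def Q" "pos_def Y" "trace Q \<le> c" "trace Y \<le> c" "0 < c"
  shows "(norm (Q - Y))\<^sup>2 \<le> 2 * c\<^sup>2 * contrast Q Y" and "0 \<le> contrast Q Y"
proof -
  have "(norm (Q - Y))\<^sup>2 / c\<^sup>2 \<le> discrepancy_rate Q Y s" if s: "0 \<le> s" "s \<le> 1" for s
  proof -
    have "trace (Y + s *\<^sub>R (Q - Y)) = (1 - s) * trace Y + s * trace Q"
      by (simp add: trace_def sum.distrib sum_subtractf sum_distrib_left algebra_simps)
    also have "\<dots> \<le> (1 - s) * c + s * c"
      using assms s by (intro add_mono mult_left_mono) auto
    finally have "trace (Y + s *\<^sub>R (Q - Y)) \<le> c" by (simp add: algebra_simps)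
    from trace_inv_quadratic_lower(1)[OF pos_def_segment[OF assms(1,2) s] this, of "Q - Y"] show ?thesis
      using assms(5) by (simp add: discrepancy_rate_def field_simps)
  qed
  then have *: "(norm (Q - Y))\<^sup>2 / c\<^sup>2 / 2 \<le> contrast Q Y"
    by (intro contrast_bounds assms)
  then show "(norm (Q - Y))\<^sup>2 \<le> 2 * c\<^sup>2 * contrast Q Y"
    using assms(5) by (simp add: field_simps)
  show "0 \<le> contrast Q Y"
    by (rule order_trans[OF _ *]) auto
qed

text \<open>The error is relative to |Q - Y|^2, and only such an error survives multiplication by n.
  It comes from continuity of the inverse at \<open>S\<close>, used uniformly on the segment between
  \<open>Y\<close> and \<open>Q\<close>.\<close>

lemma contrast_expansion:
  fixes R :: "real^'n^'n"
  assumes S: "pos_def S" "S = R ** transpose R" "invertible R" and "0 < \<epsilon>"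
  obtains \<delta> where "0 < \<delta>"
    "\<And>Q Y. pos_def Q \<Longrightarrow> pos_def Y \<Longrightarrow> norm (Q - S) < \<delta> \<Longrightarrow> norm (Y - S) < \<delta> \<Longrightarrow>
       \<bar>contrast Q Y - (norm (matrix_inv R ** (Q - Y) ** transpose (matrix_inv R)))\<^sup>2 / 2\<bar> \<le> \<epsilon> * (norm (Q - Y))\<^sup>2"
proof -
  define N0 where "N0 = matrix_inv S"
  \<comment> \<open>Replacing both inverses by \<open>N0\<close> costs at most \<eta> (2 |N0| +
    \<eta>) |D|^2; with \<eta> at most 1 this choice brings the factor below \<epsilon>.\<close>
  define \<eta> where "\<eta> = min 1 (\<epsilon> / (2 * norm N0 + 1))"
  have \<eta>: "0 < \<eta>" "\<eta> \<le> 1" "\<eta> * (2 * norm N0 + 1) \<le> \<epsilon>"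
  proof -
    have p: "0 < 2 * norm N0 + 1" by (simp add: add_nonneg_pos)
    then show "0 < \<eta>" "\<eta> \<le> 1" using assms(4) by (auto simp: \<eta>_def)
    have "\<eta> \<le> \<epsilon> / (2 * norm N0 + 1)" by (simp add: \<eta>_def)
    then show "\<eta> * (2 * norm N0 + 1) \<le> \<epsilon>" using p by (simp add: field_simps)
  qed
  have "isCont matrix_inv S"
    using matrix_inv_differentiable pos_def_invertible S(1) differentiable_imp_continuous_within by blast
  then obtain \<delta> where \<delta>: "0 < \<delta>" "\<And>P. norm (P - S) < \<delta> \<Longrightarrow> norm (matrix_inv P - N0) < \<eta>"
    using \<eta>(1) unfolding continuous_at_eps_delta N0_def dist_norm by metis
  show thesis
  proof (rule that[OF \<delta>(1)])
    fix Q Y :: "real^'n^'n"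
    assume Q: "pos_def Q" "norm (Q - S) < \<delta>" and Y: "pos_def Y" "norm (Y - S) < \<delta>"
    define D where "D = Q - Y"
    define q where "q = (norm (matrix_inv R ** D ** transpose (matrix_inv R)))\<^sup>2"
    have q: "q = D \<bullet> (N0 ** D ** N0)"
      unfolding q_def N0_def using factor_quadratic(1)[OF S(2,3)] by simp
    have "\<bar>discrepancy_rate Q Y s - q\<bar> \<le> \<epsilon> * (norm D)\<^sup>2" if s: "0 \<le> s" "s \<le> 1" for s
    proof -
      define N where "N = matrix_inv (Y + s *\<^sub>R (Q - Y))"
      have "Y + s *\<^sub>R (Q - Y) - S = (1 - s) *\<^sub>R (Y - S) + s *\<^sub>R (Q - S)"
        by (simp add: algebra_simps)
      also have "norm \<dots> \<le> (1 - s) * norm (Y - S) + s * norm (Q - S)"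
        using s by (intro norm_triangle_le) auto
      also have "\<dots> < \<delta>"
        using s Q(2) Y(2) by (intro convex_bound_lt) auto
      finally have N: "norm (N - N0) < \<eta>" unfolding N_def by (rule \<delta>(2))
      have NN: "norm N \<le> norm N0 + \<eta>"
        using N norm_triangle_ineq[of "N - N0" N0] by simp
      \<comment> \<open>N D N - N0 D N0 telescopes into two terms with one factor N - N0
        each.\<close>
      have "discrepancy_rate Q Y s - q = D \<bullet> ((N - N0) ** D ** N + N0 ** D ** (N - N0))"
        unfolding q discrepancy_rate_def N_def[symmetric] unfolding D_def[symmetric]
        by (simp add: bounded_bilinear.diff_left[OF bounded_bilinear_matrix_mult]
            bounded_bilinear.diff_right[OF bounded_bilinear_matrix_mult] inner_diff_right inner_add_right)
      also have "\<bar>\<dots>\<bar> \<le> norm D * norm ((N - N0) ** D ** N + N0 ** D ** (N - N0))"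
        by (rule Cauchy_Schwarz_ineq2)
      also have "\<dots> \<le> norm D * (\<eta> * norm D * (norm N0 + \<eta>) + norm N0 * norm D * \<eta>)"
        using N NN \<eta>(1)
        by (intro mult_left_mono norm_triangle_le add_mono order_trans[OF norm_matrix_mult_le] mult_mono) auto
      also have "\<dots> = (norm D)\<^sup>2 * (\<eta> * (2 * norm N0 + \<eta>))"
        by (simp add: power2_eq_square algebra_simps)
      also have "\<dots> \<le> (norm D)\<^sup>2 * (\<eta> * (2 * norm N0 + 1))"
        using \<eta> by (intro mult_left_mono) auto
      also have "\<dots> \<le> (norm D)\<^sup>2 * \<epsilon>"
        using \<eta> by (intro mult_left_mono) auto
      finally show ?thesis by (simp add: mult.commute)
    qed
    then have "q - \<epsilon> * (norm D)\<^sup>2 \<le> discrepancy_rate Q Y s" "discrepancy_rate Q Y s \<le> q + \<epsilon> * (norm D)\<^sup>2"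
      if "0 \<le> s" "s \<le> 1" for s
      using that by (force simp: abs_le_iff)+
    then have "(q - \<epsilon> * (norm D)\<^sup>2) / 2 \<le> contrast Q Y" "contrast Q Y \<le> (q + \<epsilon> * (norm D)\<^sup>2) / 2"
      using contrast_bounds[OF Q(1) Y(1)] by blast+
    moreover have "0 \<le> \<epsilon> * (norm D)\<^sup>2" using assms(4) by simp
    ultimately have "\<bar>contrast Q Y - q / 2\<bar> \<le> \<epsilon> * (norm D)\<^sup>2"
      by (simp add: abs_le_iff field_simps)
    then show "\<bar>contrast Q Y - (norm (matrix_inv R ** (Q - Y) ** transpose (matrix_inv R)))\<^sup>2 / 2\<bar> \<le> \<epsilon> * (norm (Q - Y))\<^sup>2"
      unfolding q_def D_def .
  qed
qed

section \<open>Quadratic expansion of the minimal discrepancy\<close>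

text \<open>Least squares over the range of \<open>f\<close>. The residual of the best fit is the
  part of \<open>X\<close> orthogonal to the range, and its squared length is read off an
  orthonormal basis of the complement taken inside \<open>T\<close>. The best fit is no longer than
  \<open>X\<close>, which later keeps the competing parameter near the true one.\<close>

lemma orthogonal_residual:
  fixes f :: "'v::euclidean_space \<Rightarrow> 'e::euclidean_space"
  assumes f: "linear f" and T: "subspace T" "\<And>v. f v \<in> T" "X \<in> T"
    and B: "finite B" "pairwise orthogonal B" "\<And>b. b \<in> B \<Longrightarrow> norm b = 1"
      "span B = {X\<in>T. \<forall>v. X \<bullet> f v = 0}"
  shows "\<exists>v. (norm (X - f v))\<^sup>2 = (\<Sum>b\<in>B. (X \<bullet> b)\<^sup>2) \<and> norm (f v) \<le> norm X"
    and "(\<Sum>b\<in>B. (X \<bullet> b)\<^sup>2) \<le> (norm (X - f v))\<^sup>2"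
proof -
  have sub: "subspace (range f)" using f by (simp add: linear_subspace_image)
  obtain y z where y: "y \<in> span (range f)" and z: "\<And>w. w \<in> span (range f) \<Longrightarrow> orthogonal z w" and X: "X = y + z"
    using orthogonal_subspace_decomp_exists[of "range f" X] by blast
  obtain u where u: "y = f u" using y span_eq_iff[THEN iffD2, OF sub] by auto
  have zf: "z \<bullet> f v = 0" for v
    using z[of "f v"] by (simp add: orthogonal_def span_base)
  have "z \<in> T" using X T u by (metis add_diff_cancel_left' subspace_diff)
  then have zB: "z \<in> span B" using B(4) zf by simp
  have bf: "b \<bullet> f v = 0" if "b \<in> B" for b v
    using that B(4) span_base by blast
  have Xb: "X \<bullet> b = z \<bullet> b" if "b \<in> B" for b
    using bf[OF that, of u] by (simp add: X u inner_add_right inner_commute[of _ b])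
  have "z = (\<Sum>b\<in>B. (b \<bullet> z) *\<^sub>R b)"
    using orthonormal_basis_expand[OF B(2,3) zB B(1)] by (simp add: inner_commute)
  then have "z \<bullet> z = z \<bullet> (\<Sum>b\<in>B. (b \<bullet> z) *\<^sub>R b)" by simp
  also have "\<dots> = (\<Sum>b\<in>B. (X \<bullet> b)\<^sup>2)"
    unfolding inner_sum_right
    by (intro sum.cong) (auto simp: Xb power2_eq_square inner_commute[of _ z])
  finally have zz: "(norm z)\<^sup>2 = (\<Sum>b\<in>B. (X \<bullet> b)\<^sup>2)" by (simp add: power2_norm_eq_inner)
  have pyth: "(norm (X - f v))\<^sup>2 = (norm (f u - f v))\<^sup>2 + (norm z)\<^sup>2" for v
    using zf[of u] zf[of v]
    by (simp add: X u power2_norm_eq_inner inner_add inner_diff inner_commute algebra_simps)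
  show "(\<Sum>b\<in>B. (X \<bullet> b)\<^sup>2) \<le> (norm (X - f v))\<^sup>2"
    using pyth[of v] zz by simp
  have "(norm (f u))\<^sup>2 \<le> (norm X)\<^sup>2"
    using pyth[of 0] linear_0[OF f] by simp
  then have "norm (f u) \<le> norm X" by simp
  then show "\<exists>v. (norm (X - f v))\<^sup>2 = (\<Sum>b\<in>B. (X \<bullet> b)\<^sup>2) \<and> norm (f v) \<le> norm X"
    using pyth[of u] zz by auto
qed

section \<open>Symmetric matrices and their dimension\<close>

lemma subspace_symmetric: "subspace {X::real^'n^'n. transpose X = X}"
  unfolding subspace_def by (auto simp: transpose_def vec_eq_iff)

lemma dim_symmetric: "dim {X::real^'n^'n. transpose X = X} = CARD('n) * (CARD('n) + 1) div 2"
proof -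
  define f :: "real^('n uprod) \<Rightarrow> real^'n^'n" where "f u = (\<chi> i j. u $ Upair i j)" for u
  have lin: "linear f" by (rule linearI) (simp_all add: f_def vec_eq_iff)
  have "inj f"
  proof (rule injI)
    fix u v assume "f u = f v"
    then have "u $ Upair i j = v $ Upair i j" for i j by (simp add: f_def vec_eq_iff)
    then show "u = v" by (metis uprod_exhaust vec_eq_iff)
  qed
  then have "dim (range f) = dim (UNIV :: (real^('n uprod)) set)"
    using lin by (intro dim_image_eq) (auto intro: inj_on_subset)
  moreover have "range f = {X. transpose X = X}"
  proof (intro equalityI subsetI)
    fix X :: "real^'n^'n" assume X: "X \<in> {X. transpose X = X}"
    then have "X = f (vech X)"
      using vech_Upair[of X] unfolding f_def by (subst vec_eq_iff)+ simp
    then show "X \<in> range f" by blast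
  next
    fix X assume "X \<in> range f"
    then show "X \<in> {X. transpose X = X}"
      unfolding f_def image_iff mem_Collect_eq
      by (elim bexE) (simp add: transpose_def vec_eq_iff, intro allI arg_cong2[of _ _ _ _ "($)"], auto)
  qed
  ultimately show ?thesis by (simp add: card_UNIV_uprod)
qed

lemma abs_trace_le: "\<bar>trace (X::real^'n^'n)\<bar> \<le> real CARD('n) * norm X"
proof -
  have "\<bar>X $ i $ i\<bar> \<le> norm X" for i
    by (rule order_trans[OF component_le_norm_cart Finite_Cartesian_Product.norm_nth_le])
  then have "(\<Sum>i\<in>UNIV. \<bar>X $ i $ i\<bar>) \<le> (\<Sum>i\<in>(UNIV::'n set). norm X)"
    by (intro sum_mono)
  then show ?thesis
    unfolding trace_def using order_trans[OF sum_abs[of "\<lambda>i. X $ i $ i" UNIV]] by simp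
qed

lemma transpose_congruence:
  "transpose (A ** (D::real^'n^'n) ** transpose A) = A ** transpose D ** transpose A"
  by (simp add: matrix_transpose_mul matrix_mul_assoc)

text \<open>Replaces G (\<theta>0 + v) by its linearization inside the contrast. The perturbations
  \<open>v\<close> stay in a ball of radius proportional to |Q - G \<theta>0|, so the o(|v|) of the
  derivative is o(|Q - G \<theta>0|), and after squaring the error is relative to |Q - G
  \<theta>0|^2.\<close>

lemma contrast_expansion_along:
  fixes G :: "real^'q \<Rightarrow> real^'n^'n" and R :: "real^'n^'n"
  assumes pd: "\<And>\<theta>. \<theta> \<in> \<Theta> \<Longrightarrow> pos_def (G \<theta>)" and \<theta>0: "\<theta>0 \<in> interior \<Theta>"
    and deriv: "(G has_derivative G') (at \<theta>0)"
    and R: "G \<theta>0 = R ** transpose R" "invertible R" and \<epsilon>: "0 < \<epsilon>" and K: "0 \<le> K"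
  obtains \<delta> where "0 < \<delta>"
    "\<And>Q v. pos_def Q \<Longrightarrow> norm (Q - G \<theta>0) < \<delta> \<Longrightarrow> norm v \<le> K * norm (Q - G \<theta>0) \<Longrightarrow>
      \<theta>0 + v \<in> \<Theta> \<and> \<bar>contrast Q (G (\<theta>0 + v)) -
        (norm (matrix_inv R ** (Q - G \<theta>0 - G' v) ** transpose (matrix_inv R)))\<^sup>2 / 2\<bar> \<le> \<epsilon> * (norm (Q - G \<theta>0))\<^sup>2"
proof -
  define S where "S = G \<theta>0"
  define J where "J D = matrix_inv R ** D ** transpose (matrix_inv R)" for D
  define \<kappa> where "\<kappa> = (norm (matrix_inv R))\<^sup>2"
  have linJ: "linear J" unfolding J_def by (rule linear_congruence)
  have J: "norm (J D) \<le> \<kappa> * norm D" for D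
    unfolding J_def \<kappa>_def by (rule norm_congruence_le)
  have \<kappa>0: "0 \<le> \<kappa>" by (simp add: \<kappa>_def)
  have \<theta>0': "\<theta>0 \<in> \<Theta>" using \<theta>0 interior_subset by blast
  have linG: "bounded_linear G'" using deriv by (rule has_derivative_bounded_linear)
  obtain g where g: "0 \<le> g" "\<And>v. norm (G' v) \<le> g * norm v"
    using bounded_linear.nonneg_bounded[OF linG] by (auto simp: mult.commute)
  \<comment> \<open>One multiple of |d| that bounds \<open>v\<close>, \<open>D0\<close>,
    \<open>D\<close> and the displacement G (\<theta>0 + v) - S at once.\<close>
  define m where "m = 1 + g * K + K"
  have m: "1 \<le> m" using g K by (simp add: m_def)
  \<comment> \<open>Half of \<epsilon> goes to the expansion of the contrast and half to the
    linearization, whose error is at most \<open>\<kappa>\<^sup>2 * K * m * \<tau>\<close> times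
    |d|^2.\<close>
  define \<tau> where "\<tau> = min 1 (\<epsilon> / (2 * (\<kappa>\<^sup>2 * K * m + 1)))"
  have den: "0 < \<kappa>\<^sup>2 * K * m + 1" using K m by (simp add: add_nonneg_pos)
  have \<tau>: "0 < \<tau>" "\<tau> \<le> 1" "\<kappa>\<^sup>2 * K * m * \<tau> \<le> \<epsilon> / 2"
  proof -
    show \<tau>0: "0 < \<tau>" "\<tau> \<le> 1" using den \<epsilon> by (auto simp: \<tau>_def)
    have "\<tau> \<le> \<epsilon> / (2 * (\<kappa>\<^sup>2 * K * m + 1))" by (simp add: \<tau>_def)
    then have "(\<kappa>\<^sup>2 * K * m + 1) * \<tau> \<le> \<epsilon> / 2" using den by (simp add: field_simps)
    then show "\<kappa>\<^sup>2 * K * m * \<tau> \<le> \<epsilon> / 2" using \<tau>0 by (simp add: algebra_simps)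
  qed
  obtain \<rho> where \<rho>: "0 < \<rho>" "\<And>v. norm v < \<rho> \<Longrightarrow> norm (G (\<theta>0 + v) - S - G' v) \<le> \<tau> * norm v"
  proof -
    from deriv[unfolded has_derivative_at_alt] \<tau>(1) obtain \<rho> where
      "0 < \<rho>" "\<And>y. norm (y - \<theta>0) < \<rho> \<Longrightarrow> norm (G y - G \<theta>0 - G' (y - \<theta>0)) \<le> \<tau> * norm (y - \<theta>0)"
      by blast
    from that[OF this(1)] this(2)[of "\<theta>0 + _"] show ?thesis by (simp add: S_def)
  qed
  obtain \<rho>' where \<rho>': "0 < \<rho>'" "\<And>v. norm v < \<rho>' \<Longrightarrow> \<theta>0 + v \<in> \<Theta>"
  proof -
    obtain e where "0 < e" "ball \<theta>0 e \<subseteq> \<Theta>" using \<theta>0 mem_interior by blast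
    with that[of e] show ?thesis by (auto simp: subset_eq dist_norm)
  qed
  have "0 < \<epsilon> / (2 * m\<^sup>2)" using \<epsilon> m by simp
  then obtain \<delta>1 where \<delta>1: "0 < \<delta>1"
    "\<And>Q Y. pos_def Q \<Longrightarrow> pos_def Y \<Longrightarrow> norm (Q - S) < \<delta>1 \<Longrightarrow> norm (Y - S) < \<delta>1 \<Longrightarrow>
       \<bar>contrast Q Y - (norm (J (Q - Y)))\<^sup>2 / 2\<bar> \<le> \<epsilon> / (2 * m\<^sup>2) * (norm (Q - Y))\<^sup>2"
    unfolding J_def S_def using contrast_expansion[OF pd[OF \<theta>0'] R] by metis
  define \<delta> where "\<delta> = min \<rho> (min \<rho>' \<delta>1) / m"
  have \<delta>: "0 < \<delta>" "\<delta> * m \<le> \<rho>" "\<delta> * m \<le> \<rho>'" "\<delta> * m \<le> \<delta>1"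
    using \<rho> \<rho>' \<delta>1 m by (auto simp: \<delta>_def)
  show thesis
  proof (rule that[OF \<delta>(1)])
    fix Q :: "real^'n^'n" and v :: "real^'q"
    assume Q: "pos_def Q" and d: "norm (Q - G \<theta>0) < \<delta>" and v: "norm v \<le> K * norm (Q - G \<theta>0)"
    define d where "d = Q - S"
    have md: "m * norm d < \<delta> * m"
      using d m by (simp add: d_def S_def mult.commute)
    have vd: "norm v \<le> K * norm d" using v by (simp add: d_def S_def)
    also have "\<dots> \<le> m * norm d" using g K by (intro mult_right_mono) (auto simp: m_def)
    finally have vm: "norm v \<le> m * norm d" .
    have v1: "norm v < \<rho>" "norm v < \<rho>'" using vm md \<delta> by linarith+
    have in\<Theta>: "\<theta>0 + v \<in> \<Theta>" using \<rho>'(2) v1 by blast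
    define w where "w = G (\<theta>0 + v) - S - G' v"
    have w: "norm w \<le> \<tau> * norm v" using \<rho>(2)[OF v1(1)] by (simp add: w_def)
    also have "\<dots> \<le> \<tau> * (K * norm d)" using \<tau> vd by (intro mult_left_mono) auto
    finally have w\<tau>: "norm w \<le> \<tau> * K * norm d" by simp
    have wK: "norm w \<le> K * norm d"
      using w\<tau> \<tau> K mult_right_mono[of \<tau> 1 "K * norm d"] by (simp add: mult.assoc)
    have gv: "norm (G' v) \<le> g * K * norm d"
      using g(2)[of v] mult_left_mono[OF vd g(1)] by (simp add: mult.assoc)
    define D0 where "D0 = d - G' v"
    define D where "D = Q - G (\<theta>0 + v)"
    have D: "D = D0 - w" by (simp add: D_def D0_def d_def w_def)
    have D0n: "norm D0 \<le> m * norm d"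
    proof -
      have "norm D0 \<le> norm d + g * K * norm d"
        using norm_triangle_ineq4[of d "G' v"] gv by (simp add: D0_def)
      also have "\<dots> \<le> m * norm d" using K by (simp add: m_def algebra_simps)
      finally show ?thesis .
    qed
    have Dn: "norm D \<le> m * norm d"
    proof -
      have "norm D0 \<le> norm d + g * K * norm d"
        using norm_triangle_ineq4[of d "G' v"] gv by (simp add: D0_def)
      then have "norm D \<le> norm d + g * K * norm d + K * norm d"
        using norm_triangle_ineq4[of D0 w] wK by (simp add: D)
      also have "\<dots> = m * norm d" by (simp add: m_def algebra_simps)
      finally show ?thesis .
    qed
    have "norm (G (\<theta>0 + v) - S) \<le> norm (G' v) + norm w"
      using norm_triangle_ineq[of "G' v" w] by (simp add: w_def)
    also have "\<dots> \<le> g * K * norm d + K * norm d" using gv wK by simp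
    also have "\<dots> \<le> m * norm d" by (simp add: m_def algebra_simps)
    also have "\<dots> < \<delta>1" using md \<delta> by simp
    finally have G1: "norm (G (\<theta>0 + v) - S) < \<delta>1" .
    have "1 * norm d \<le> m * norm d" using m by (intro mult_right_mono) auto
    then have Q1: "norm (Q - S) < \<delta>1" using md \<delta> by (simp add: d_def)
    have e1: "\<bar>contrast Q (G (\<theta>0 + v)) - (norm (J D))\<^sup>2 / 2\<bar> \<le> \<epsilon> / (2 * m\<^sup>2) * (norm D)\<^sup>2"
      unfolding D_def by (rule \<delta>1(2)[OF Q pd[OF in\<Theta>] Q1 G1])
    also have "\<dots> \<le> \<epsilon> / (2 * m\<^sup>2) * (m * norm d)\<^sup>2"
      using \<epsilon> Dn by (intro mult_left_mono power_mono) auto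
    also have "\<dots> = \<epsilon> / 2 * (norm d)\<^sup>2"
      using m by (simp add: power_mult_distrib)
    finally have e1: "\<bar>contrast Q (G (\<theta>0 + v)) - (norm (J D))\<^sup>2 / 2\<bar> \<le> \<epsilon> / 2 * (norm d)\<^sup>2" .
    have "\<bar>norm (J D) - norm (J D0)\<bar> \<le> norm (J w)"
      using norm_triangle_ineq3[of "J D" "J D0"] linear_diff[OF linJ, of D D0] linear_diff[OF linJ, of D0 w]
      by (simp add: D)
    also have "\<dots> \<le> \<kappa> * (\<tau> * K * norm d)"
      using J[of w] mult_left_mono[OF w\<tau> \<kappa>0] by linarith
    finally have a: "\<bar>norm (J D) - norm (J D0)\<bar> \<le> \<kappa> * (\<tau> * K * norm d)" .
    have b: "norm (J D) + norm (J D0) \<le> 2 * \<kappa> * (m * norm d)"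
      using J[of D] J[of D0] mult_left_mono[OF Dn \<kappa>0] mult_left_mono[OF D0n \<kappa>0] by simp
    have "\<bar>(norm (J D))\<^sup>2 - (norm (J D0))\<^sup>2\<bar> = \<bar>norm (J D) - norm (J D0)\<bar> * (norm (J D) + norm (J D0))"
      by (simp add: square_diff_square_factored power2_eq_square abs_mult mult.commute)
    also have "\<dots> \<le> \<kappa> * (\<tau> * K * norm d) * (2 * \<kappa> * (m * norm d))"
      using \<kappa>0 \<tau> K by (intro mult_mono a b) auto
    also have "\<dots> = 2 * (\<kappa>\<^sup>2 * K * m * \<tau>) * (norm d)\<^sup>2"
      by (simp add: power2_eq_square)
    also have "\<dots> \<le> 2 * (\<epsilon> / 2) * (norm d)\<^sup>2"
      using \<tau>(3) by (intro mult_right_mono mult_left_mono) auto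
    finally have "\<bar>(norm (J D))\<^sup>2 / 2 - (norm (J D0))\<^sup>2 / 2\<bar> \<le> \<epsilon> / 2 * (norm d)\<^sup>2"
      by (simp add: diff_divide_distrib[symmetric])
    with e1 have "\<bar>contrast Q (G (\<theta>0 + v)) - (norm (J D0))\<^sup>2 / 2\<bar> \<le> \<epsilon> * (norm d)\<^sup>2"
      by linarith
    then show "\<theta>0 + v \<in> \<Theta> \<and> \<bar>contrast Q (G (\<theta>0 + v)) -
        (norm (matrix_inv R ** (Q - G \<theta>0 - G' v) ** transpose (matrix_inv R)))\<^sup>2 / 2\<bar> \<le> \<epsilon> * (norm (Q - G \<theta>0))\<^sup>2"
      using in\<Theta> by (simp add: D0_def d_def S_def J_def)
  qed
qed

text \<open>Symmetry is known on \<Theta> only; around an interior point \<open>G\<close> agrees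
  with its transpose on a neighbourhood, and derivatives are unique.\<close>

lemma derivative_symmetric:
  fixes G :: "real^'q \<Rightarrow> real^'n^'n"
  assumes sym: "\<And>\<theta>. \<theta> \<in> \<Theta> \<Longrightarrow> transpose (G \<theta>) = G \<theta>" and \<theta>0: "\<theta>0 \<in> interior \<Theta>"
    and deriv: "(G has_derivative G') (at \<theta>0)"
  shows "transpose (G' v) = G' v"
proof -
  have bl: "bounded_linear (transpose :: real^'n^'n \<Rightarrow> real^'n^'n)"
    unfolding linear_conv_bounded_linear[symmetric]
    by (rule linearI) (simp_all add: transpose_def vec_eq_iff)
  have d: "((\<lambda>\<theta>. transpose (G \<theta>)) has_derivative (\<lambda>v. transpose (G' v))) (at \<theta>0)"
    by (rule bounded_linear.has_derivative[OF bl deriv])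
  have "(G has_derivative (\<lambda>v. transpose (G' v))) (at \<theta>0)"
  proof (rule has_derivative_transform_within_open[OF d open_interior \<theta>0])
    show "transpose (G x) = G x" if "x \<in> interior \<Theta>" for x
      using that interior_subset sym by blast
  qed
  from has_derivative_unique[OF this deriv] show ?thesis by (simp add: fun_eq_iff)
qed

text \<open>Consistency, rate and expansion in one deterministic statement. Comparison with
  \<theta>0 bounds the minimum by a multiple of |d|^2, so \<open>contrast_lower\<close> puts G
  \<theta> within a multiple of |d| of \<open>Q\<close>. Compactness and injectivity bring \<theta>
  near \<theta>0, where injectivity of \<open>G'\<close> turns the distance of the images into a
  distance of the parameters. The expansion then applies at the minimizer, which gives the lower
  bound, and at the least-squares solution, which gives the upper one.\<close>

lemma contrast_min_expansion:
  fixes G :: "real^'q \<Rightarrow> real^'n^'n" and R :: "real^'n^'n"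
  assumes \<Theta>: "compact \<Theta>" and \<theta>0: "\<theta>0 \<in> interior \<Theta>"
    and pd: "\<And>\<theta>. \<theta> \<in> \<Theta> \<Longrightarrow> pos_def (G \<theta>)" and cont: "continuous_on \<Theta> G" and inj: "inj_on G \<Theta>"
    and deriv: "(G has_derivative G') (at \<theta>0)" and injG': "inj G'"
    and R: "G \<theta>0 = R ** transpose R" "invertible R"
    and B: "finite B" "pairwise orthogonal B" "\<And>b. b \<in> B \<Longrightarrow> norm b = 1"
      "span B = {X. transpose X = X \<and> (\<forall>v. X \<bullet> (matrix_inv R ** G' v ** transpose (matrix_inv R)) = 0)}"
    and \<epsilon>: "0 < \<epsilon>"
  obtains \<delta> where "0 < \<delta>"
    "\<And>Q \<theta>. pos_def Q \<Longrightarrow> norm (Q - G \<theta>0) < \<delta> \<Longrightarrow> \<theta> \<in> \<Theta> \<Longrightarrow>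
      contrast Q (G \<theta>) = (INF \<theta>\<in>\<Theta>. contrast Q (G \<theta>)) \<Longrightarrow>
      \<bar>contrast Q (G \<theta>) - (\<Sum>b\<in>B. ((matrix_inv R ** (Q - G \<theta>0) ** transpose (matrix_inv R)) \<bullet> b)\<^sup>2) / 2\<bar>
        \<le> \<epsilon> * (norm (Q - G \<theta>0))\<^sup>2"
proof -
  define S where "S = G \<theta>0"
  define J where "J D = matrix_inv R ** D ** transpose (matrix_inv R)" for D
  define \<kappa> where "\<kappa> = (norm (matrix_inv R))\<^sup>2"
  have linJ: "linear J" unfolding J_def by (rule linear_congruence)
  have J: "norm (J D) \<le> \<kappa> * norm D" for D
    unfolding J_def \<kappa>_def by (rule norm_congruence_le)
  have \<kappa>0: "0 \<le> \<kappa>" by (simp add: \<kappa>_def)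
  have \<theta>0': "\<theta>0 \<in> \<Theta>" using \<theta>0 interior_subset by blast
  have linG: "linear G'" using has_derivative_bounded_linear[OF deriv] by (rule bounded_linear.linear)
  have injJ: "inj J"
  proof (rule injI)
    fix X Y assume "J X = J Y"
    then have "J (X - Y) = 0" using linear_diff[OF linJ] by simp
    then show "X = Y" using factor_quadratic(2)[OF R, of "X - Y"] by (simp add: J_def)
  qed
  have linJG: "linear (\<lambda>v. J (G' v))" using linear_compose[OF linG linJ] by (simp add: o_def)
  have injJG: "inj (\<lambda>v. J (G' v))" using inj_compose[OF injJ injG'] by (simp add: o_def)
  obtain b0 where b0: "0 < b0" "\<And>v. b0 * norm v \<le> norm (G' v)"
    using linear_inj_bounded_below_pos[OF linG injG'] by blast
  obtain b1 where b1: "0 < b1" "\<And>v. b1 * norm v \<le> norm (J (G' v))"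
    using linear_inj_bounded_below_pos[OF linJG injJG] by blast
  obtain b where b: "\<And>\<theta>. \<theta> \<in> \<Theta> \<Longrightarrow> norm (G \<theta>) \<le> b"
    using compact_imp_bounded[OF compact_continuous_image[OF cont \<Theta>]] unfolding bounded_iff by blast
  \<comment> \<open>\<open>Q\<close> may exceed the bound \<open>b\<close> for the image of \<Theta>
    by at most 1, since \<delta> is at most 1.\<close>
  define c where "c = real CARD('n) * (b + 1)"
  have cb: "norm X \<le> b + 1 \<Longrightarrow> trace X \<le> c" for X :: "real^'n^'n"
    using abs_trace_le[of X] mult_left_mono[of "norm X" "b + 1" "real CARD('n)"]
    unfolding c_def by linarith
  have b_nonneg: "0 \<le> b" using b[OF \<theta>0'] norm_ge_zero order_trans by blast
  have c0: "0 < c" using b_nonneg by (simp add: c_def)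
  obtain \<delta>1 where \<delta>1: "0 < \<delta>1"
    "\<And>Q Y. pos_def Q \<Longrightarrow> pos_def Y \<Longrightarrow> norm (Q - S) < \<delta>1 \<Longrightarrow> norm (Y - S) < \<delta>1 \<Longrightarrow>
       \<bar>contrast Q Y - (norm (J (Q - Y)))\<^sup>2 / 2\<bar> \<le> 1 * (norm (Q - Y))\<^sup>2"
    unfolding J_def S_def using contrast_expansion[OF pd[OF \<theta>0'] R zero_less_one] by metis
  \<comment> \<open>The contrast at \<theta>0 is at most (\<kappa>^2 / 2 + 1) |d|^2; the factor 2
    c^2 is the one of \<open>contrast_lower\<close>.\<close>
  define K1 where "K1 = sqrt (2 * c\<^sup>2 * (\<kappa>\<^sup>2 / 2 + 1))"
  have K1: "0 \<le> K1" "K1\<^sup>2 = 2 * c\<^sup>2 * (\<kappa>\<^sup>2 / 2 + 1)" by (simp_all add: K1_def)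
  \<comment> \<open>Within \<open>r\<close> the linearization error uses up at most half of the
    lower bound \<open>b0 * norm v\<close> for \<open>G' v\<close>.\<close>
  obtain r where r: "0 < r" "\<And>v. norm v < r \<Longrightarrow> norm (G (\<theta>0 + v) - S - G' v) \<le> b0 / 2 * norm v"
  proof -
    have "0 < b0 / 2" using b0 by simp
    with deriv[unfolded has_derivative_at_alt] obtain r where
      "0 < r" "\<And>y. norm (y - \<theta>0) < r \<Longrightarrow> norm (G y - G \<theta>0 - G' (y - \<theta>0)) \<le> b0 / 2 * norm (y - \<theta>0)"
      by blast
    from that[OF this(1)] this(2)[of "\<theta>0 + _"] show ?thesis by (simp add: S_def)
  qed
  \<comment> \<open>A continuous injection of a compact set has a continuous inverse on its image;
    in this way identifiability on all of \<Theta> excludes minimizers far from \<theta>0.\<close>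
  have "continuous_on (G ` \<Theta>) (inv_into \<Theta> G)"
    by (rule continuous_on_inv[OF cont \<Theta>]) (simp add: inj)
  then obtain \<eta> where \<eta>: "0 < \<eta>" "\<And>\<theta>. \<theta> \<in> \<Theta> \<Longrightarrow> norm (G \<theta> - S) < \<eta> \<Longrightarrow> norm (\<theta> - \<theta>0) < r"
    unfolding continuous_on_iff dist_norm S_def
    using r(1) \<theta>0' inj by (metis (no_types, lifting) imageI inv_into_f_f)
  \<comment> \<open>The first entry covers the minimizer, the second the least-squares
    solution.\<close>
  define K where "K = max (2 / b0 * (K1 + 1)) (\<kappa> / b1)"
  have K0: "0 \<le> K" using \<kappa>0 b1 by (simp add: K_def le_max_iff_disj)
  obtain \<delta>2 where \<delta>2: "0 < \<delta>2"
    "\<And>Q v. pos_def Q \<Longrightarrow> norm (Q - S) < \<delta>2 \<Longrightarrow> norm v \<le> K * norm (Q - S) \<Longrightarrow>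
      \<theta>0 + v \<in> \<Theta> \<and> \<bar>contrast Q (G (\<theta>0 + v)) - (norm (J (Q - S - G' v)))\<^sup>2 / 2\<bar> \<le> \<epsilon> * (norm (Q - S))\<^sup>2"
    unfolding J_def S_def using contrast_expansion_along[OF pd \<theta>0 deriv R \<epsilon> K0] by metis
  define \<delta> where "\<delta> = Min {1, \<delta>1, \<delta>2, \<eta> / (K1 + 1)}"
  have K11: "0 < K1 + 1" using K1 by simp
  have \<delta>: "0 < \<delta>" "\<delta> \<le> 1" "\<delta> \<le> \<delta>1" "\<delta> \<le> \<delta>2" "\<delta> \<le> \<eta> / (K1 + 1)"
    using \<delta>1 \<delta>2 \<eta> K11 by (auto simp: \<delta>_def)
  show thesis
  proof (rule that[OF \<delta>(1)])
    fix Q :: "real^'n^'n" and \<theta> :: "real^'q"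
    assume Q: "pos_def Q" and d: "norm (Q - G \<theta>0) < \<delta>" and \<theta>: "\<theta> \<in> \<Theta>"
      and inf: "contrast Q (G \<theta>) = (INF \<theta>\<in>\<Theta>. contrast Q (G \<theta>))"
    define d where "d = Q - S"
    have dn: "norm d < \<delta>" using \<open>norm (Q - G \<theta>0) < \<delta>\<close> by (simp add: d_def S_def)
    have trQ: "trace Q \<le> c"
    proof (rule cb)
      have "norm Q \<le> norm S + norm d" using norm_triangle_ineq[of S d] by (simp add: d_def)
      also have "\<dots> \<le> b + 1" using b[OF \<theta>0'] dn \<delta> by (simp add: S_def)
      finally show "norm Q \<le> b + 1" .
    qed
    have trG: "trace (G \<theta>) \<le> c" if "\<theta> \<in> \<Theta>" for \<theta>
      by (rule cb) (use b[OF that] in simp)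
    \<comment> \<open>An infimum of reals is a lower bound only if the set is bounded below; here 0
      bounds the contrast on \<Theta>.\<close>
    have min: "contrast Q (G \<theta>) \<le> contrast Q (G \<theta>')" if "\<theta>' \<in> \<Theta>" for \<theta>'
      unfolding inf
      by (rule cINF_lower[OF _ that]) (auto intro!: bdd_belowI2[of _ 0] contrast_lower(2)[OF Q pd trQ trG c0])
    have "contrast Q (G \<theta>) \<le> contrast Q S" unfolding S_def by (rule min[OF \<theta>0'])
    also have "\<dots> \<le> (norm (J d))\<^sup>2 / 2 + (norm d)\<^sup>2"
      using \<delta>1(2)[OF Q pd[OF \<theta>0']] dn \<delta> \<delta>1(1) by (auto simp: d_def S_def abs_le_iff)
    also have "\<dots> \<le> (\<kappa> * norm d)\<^sup>2 / 2 + (norm d)\<^sup>2"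
      using J[of d] by (intro add_mono divide_right_mono power_mono) auto
    finally have "contrast Q (G \<theta>) \<le> (\<kappa>\<^sup>2 / 2 + 1) * (norm d)\<^sup>2"
      by (simp add: power_mult_distrib algebra_simps)
    then have "(norm (Q - G \<theta>))\<^sup>2 \<le> 2 * c\<^sup>2 * ((\<kappa>\<^sup>2 / 2 + 1) * (norm d)\<^sup>2)"
      using contrast_lower(1)[OF Q pd[OF \<theta>] trQ trG[OF \<theta>] c0] mult_left_mono[of "contrast Q (G \<theta>)" _ "2 * c\<^sup>2"]
      by (meson mult_nonneg_nonneg order_trans zero_le_numeral zero_le_power2)
    also have "\<dots> = (K1 * norm d)\<^sup>2" by (simp add: power_mult_distrib K1(2))
    finally have QG: "norm (Q - G \<theta>) \<le> K1 * norm d"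
      by (rule power2_le_imp_le) (simp add: K1)
    have "G \<theta> - S = d - (Q - G \<theta>)" by (simp add: d_def)
    then have GS: "norm (G \<theta> - S) \<le> (K1 + 1) * norm d"
      using norm_triangle_ineq4[of d "Q - G \<theta>"] QG by (simp add: algebra_simps)
    also have "\<dots> < (K1 + 1) * (\<eta> / (K1 + 1))"
      using dn \<delta> K11 by (intro mult_strict_left_mono) auto
    also have "\<dots> = \<eta>" using K11 by simp
    finally have "norm (\<theta> - \<theta>0) < r" using \<eta>(2)[OF \<theta>] by simp
    define v where "v = \<theta> - \<theta>0"
    have "norm (G \<theta> - S - G' v) \<le> b0 / 2 * norm v"
      using r(2)[of v] \<open>norm (\<theta> - \<theta>0) < r\<close> by (simp add: v_def)
    then have "b0 / 2 * norm v \<le> norm (G \<theta> - S)"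
      using b0(2)[of v] norm_triangle_ineq2[of "G' v" "G' v - (G \<theta> - S)"]
      by (simp add: norm_minus_commute)
    then have "norm v \<le> 2 / b0 * ((K1 + 1) * norm d)"
      using GS b0(1) by (simp add: field_simps)
    also have "\<dots> \<le> K * norm d"
      unfolding mult.assoc[symmetric] by (intro mult_right_mono) (auto simp: K_def)
    finally have vK: "norm v \<le> K * norm (Q - S)" by (simp add: d_def)
    have Jd: "transpose (J d) = J d" and JG': "transpose (J (G' v)) = J (G' v)" for v
    proof -
      have "transpose d = d"
        using pos_def_entry_sym[OF Q] pos_def_entry_sym[OF pd[OF \<theta>0']]
        by (simp add: d_def S_def transpose_def vec_eq_iff)
      then show "transpose (J d) = J d"
        unfolding J_def transpose_congruence by simp
      show "transpose (J (G' v)) = J (G' v)"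
        unfolding J_def transpose_congruence
        by (subst derivative_symmetric[OF pos_def_sym[OF pd] \<theta>0 deriv]) auto
    qed
    define q where "q = (\<Sum>b\<in>B. (J d \<bullet> b)\<^sup>2)"
    have "span B = {X \<in> {X. transpose X = X}. \<forall>v. X \<bullet> J (G' v) = 0}"
      using B(4) by (simp add: J_def)
    note res = orthogonal_residual[OF linJG subspace_symmetric _ _ B(1-3) this, of "J d", folded q_def]
    obtain u where u: "(norm (J d - J (G' u)))\<^sup>2 = q" "norm (J (G' u)) \<le> norm (J d)"
      using res(1) Jd JG' by auto
    have low: "q \<le> (norm (J d - J (G' v)))\<^sup>2"
      using res(2) Jd JG' by auto
    have "b1 * norm u \<le> \<kappa> * norm d" using b1(2)[of u] u(2) J[of d] by linarith
    then have "norm u \<le> \<kappa> / b1 * norm d" using b1(1) by (simp add: field_simps)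
    also have "\<dots> \<le> K * norm d" by (intro mult_right_mono) (auto simp: K_def)
    finally have uK: "norm u \<le> K * norm (Q - S)" by (simp add: d_def)
    have Q2: "norm (Q - S) < \<delta>2" using dn \<delta> by (simp add: d_def)
    have Jdiff: "J (Q - S - G' w) = J d - J (G' w)" for w
      using linear_diff[OF linJ] by (simp add: d_def)
    have "\<bar>contrast Q (G \<theta>) - (norm (J d - J (G' v)))\<^sup>2 / 2\<bar> \<le> \<epsilon> * (norm d)\<^sup>2"
      using \<delta>2(2)[OF Q Q2 vK] by (simp add: v_def Jdiff d_def)
    then have lower: "q / 2 - \<epsilon> * (norm d)\<^sup>2 \<le> contrast Q (G \<theta>)" using low by (simp add: abs_le_iff)
    have "\<theta>0 + u \<in> \<Theta>" "\<bar>contrast Q (G (\<theta>0 + u)) - q / 2\<bar> \<le> \<epsilon> * (norm d)\<^sup>2"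
      using \<delta>2(2)[OF Q Q2 uK] by (simp_all add: Jdiff u(1)[symmetric] d_def)
    then have "contrast Q (G \<theta>) \<le> q / 2 + \<epsilon> * (norm d)\<^sup>2"
      using min by (fastforce simp: abs_le_iff)
    with lower show "\<bar>contrast Q (G \<theta>) - (\<Sum>b\<in>B. ((matrix_inv R ** (Q - G \<theta>0) ** transpose (matrix_inv R)) \<bullet> b)\<^sup>2) / 2\<bar>
        \<le> \<epsilon> * (norm (Q - G \<theta>0))\<^sup>2"
      by (simp add: q_def d_def S_def J_def abs_le_iff)
  qed
qed

text \<open>The complement is taken among symmetric matrices, so its dimension is the number of free
  entries minus the number of parameters: the degrees of freedom. The two dimensions add up, hence
  the subtraction of naturals does not truncate.\<close>

lemma exists_residual_basis:
  fixes f :: "real^'q \<Rightarrow> real^'n^'n"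
  assumes "linear f" "inj f" "\<And>v. transpose (f v) = f v"
  obtains B :: "(real^'n^'n) set" where "finite B" "pairwise orthogonal B" "\<And>b. b \<in> B \<Longrightarrow> norm b = 1"
    "span B = {X. transpose X = X \<and> (\<forall>v::real^'q. X \<bullet> f v = 0)}"
    "card B = CARD('n) * (CARD('n) + 1) div 2 - CARD('q)"
proof -
  let ?T = "{X::real^'n^'n. transpose X = X}"
  let ?V = "{X. transpose X = X \<and> (\<forall>v. X \<bullet> f v = 0)}"
  have sub: "subspace (range f)" using assms(1) by (simp add: linear_subspace_image)
  have "dim {y \<in> ?T. \<forall>x\<in>range f. orthogonal x y} + dim (range f) = dim ?T"
    by (rule dim_subspace_orthogonal_to_vectors[OF sub subspace_symmetric]) (use assms(3) in auto)
  moreover have "{y \<in> ?T. \<forall>x\<in>range f. orthogonal x y} = ?V"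
    by (auto simp: orthogonal_def inner_commute)
  moreover have "dim (range f) = CARD('q)"
    using dim_image_eq[OF assms(1), of UNIV] assms(2) by (simp add: dim_UNIV)
  ultimately have dim: "dim ?V = CARD('n) * (CARD('n) + 1) div 2 - CARD('q)"
    by (simp add: dim_symmetric)
  have "subspace ?V"
    using subspace_symmetric by (auto simp: subspace_def inner_add_left)
  then obtain B where "B \<subseteq> ?V" "pairwise orthogonal B" "\<And>x. x \<in> B \<Longrightarrow> norm x = 1"
    "independent B" "card B = dim ?V" "span B = ?V"
    by (rule orthonormal_basis_subspace) blast
  then show ?thesis
    by (intro that[of B]) (simp_all add: dim independent_imp_finite)
qed

section \<open>Convergence to the chi-squared distribution\<close>

lemma cts_step_props:
  assumes "x < y"
  shows "0 \<le> cts_step x y t" "cts_step x y t \<le> 1"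
    "\<bar>cts_step x y s - cts_step x y t\<bar> \<le> 1" "\<bar>cts_step x y s - cts_step x y t\<bar> \<le> \<bar>s - t\<bar> / (y - x)"
  using assms by (auto simp: cts_step_def divide_simps)

lemma continuous_cts_step: "x < y \<Longrightarrow> continuous_on UNIV (cts_step x y)"
  by (rule uniformly_continuous_imp_continuous[OF cts_step_uniformly_continuous])

lemma borel_measurable_cts_step [measurable]: "cts_step x y \<in> borel_measurable borel"
  unfolding cts_step_def by measurable

text \<open>By Weierstrass, \<open>g\<close> is within r / 3 of a polynomial uniformly on the unit
  interval, and expectations of polynomials converge with the moments.\<close>

lemma moments_imp_continuous_expectation:
  fixes U :: "nat \<Rightarrow> 'a \<Rightarrow> real" and U' :: "'b \<Rightarrow> real"
  assumes "prob_space M" "prob_space N"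
    and [measurable]: "\<And>n. U n \<in> borel_measurable M" "U' \<in> borel_measurable N"
    and U: "\<And>n \<omega>. \<omega> \<in> space M \<Longrightarrow> U n \<omega> \<in> {0..1}" and U': "\<And>\<omega>. \<omega> \<in> space N \<Longrightarrow> U' \<omega> \<in> {0..1}"
    and moments: "\<And>k::nat. (\<lambda>n. \<integral>\<omega>. U n \<omega> ^ k \<partial>M) \<longlonglongrightarrow> (\<integral>\<omega>. U' \<omega> ^ k \<partial>N)"
    and g: "continuous_on UNIV (g :: real \<Rightarrow> real)"
  shows "(\<lambda>n. \<integral>\<omega>. g (U n \<omega>) \<partial>M) \<longlonglongrightarrow> (\<integral>\<omega>. g (U' \<omega>) \<partial>N)"
proof (rule LIMSEQ_I)
  interpret M: prob_space M by fact
  interpret N: prob_space N by fact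
  fix r :: real assume "0 < r"
  then have r3: "0 < r / 3" by simp
  obtain p where p: "real_polynomial_function p" and gp: "\<And>x. x \<in> {0..1} \<Longrightarrow> \<bar>g x - p x\<bar> < r / 3"
    using Stone_Weierstrass_real_polynomial_function[of "{0..1}" g "r / 3"] r3 g
    by (metis compact_Icc continuous_on_subset subset_UNIV)
  obtain a m where pa: "p = (\<lambda>x. \<Sum>i\<le>m. a i * x ^ i)"
    using p real_polynomial_function_iff_sum by blast
  have [measurable]: "g \<in> borel_measurable borel" "p \<in> borel_measurable borel"
    using g by (auto intro: borel_measurable_continuous_onI simp: pa)
  have pow: "integrable M (\<lambda>\<omega>. U n \<omega> ^ k)" "integrable N (\<lambda>\<omega>. U' \<omega> ^ k)" for n k
    using U U' by (auto intro!: M.integrable_const_bound[where B=1] N.integrable_const_bound[where B=1] AE_I2 power_le_one)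
  obtain b where "\<And>x. x \<in> {0..1} \<Longrightarrow> norm (g x) \<le> b"
    using compact_imp_bounded[OF compact_continuous_image[OF continuous_on_subset[OF g] compact_Icc]]
    unfolding bounded_iff by (metis imageI subset_UNIV)
  then have gint: "integrable M (\<lambda>\<omega>. g (U n \<omega>))" "integrable N (\<lambda>\<omega>. g (U' \<omega>))" for n
    using U U' by (auto intro!: M.integrable_const_bound[where B=b] N.integrable_const_bound[where B=b] AE_I2)
  have pint: "integrable M (\<lambda>\<omega>. p (U n \<omega>))" "integrable N (\<lambda>\<omega>. p (U' \<omega>))" for n
    unfolding pa using pow by auto
  have "(\<lambda>n. \<integral>\<omega>. p (U n \<omega>) \<partial>M) \<longlonglongrightarrow> (\<integral>\<omega>. p (U' \<omega>) \<partial>N)"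
    unfolding pa using pow moments by (auto simp: Bochner_Integration.integral_sum intro!: tendsto_intros)
  from LIMSEQ_D[OF this r3] obtain n0 where
    n0: "\<And>n. n \<ge> n0 \<Longrightarrow> \<bar>(\<integral>\<omega>. p (U n \<omega>) \<partial>M) - (\<integral>\<omega>. p (U' \<omega>) \<partial>N)\<bar> < r / 3" by auto
  have M: "\<bar>(\<integral>\<omega>. g (U n \<omega>) \<partial>M) - (\<integral>\<omega>. p (U n \<omega>) \<partial>M)\<bar> \<le> r / 3" for n
  proof -
    have "\<bar>\<integral>\<omega>. g (U n \<omega>) - p (U n \<omega>) \<partial>M\<bar> \<le> (\<integral>\<omega>. r / 3 \<partial>M)"
      using gint pint gp U by (intro order_trans[OF integral_abs_bound] integral_mono) (auto intro!: less_imp_le)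
    then show ?thesis using gint pint by (simp add: M.prob_space)
  qed
  have N: "\<bar>(\<integral>\<omega>. g (U' \<omega>) \<partial>N) - (\<integral>\<omega>. p (U' \<omega>) \<partial>N)\<bar> \<le> r / 3"
  proof -
    have "\<bar>\<integral>\<omega>. g (U' \<omega>) - p (U' \<omega>) \<partial>N\<bar> \<le> (\<integral>\<omega>. r / 3 \<partial>N)"
      using gint pint gp U' by (intro order_trans[OF integral_abs_bound] integral_mono) (auto intro!: less_imp_le)
    then show ?thesis using gint pint by (simp add: N.prob_space)
  qed
  show "\<exists>no. \<forall>n\<ge>no. norm ((\<integral>\<omega>. g (U n \<omega>) \<partial>M) - (\<integral>\<omega>. g (U' \<omega>) \<partial>N)) < r"
  proof (intro exI allI impI)
    fix n assume "n \<ge> n0"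
    from n0[OF this] M[of n] N show "norm ((\<integral>\<omega>. g (U n \<omega>) \<partial>M) - (\<integral>\<omega>. g (U' \<omega>) \<partial>N)) < r"
      unfolding real_norm_def by linarith
  qed
qed

text \<open>The substitution U = exp (- T) maps non-negative variables into the unit interval and
  turns the Laplace transform at the integer \<open>k\<close> into the k-th moment of U.\<close>

lemma laplace_imp_cts_step_expectation:
  fixes T :: "nat \<Rightarrow> 'a \<Rightarrow> real" and T' :: "'b \<Rightarrow> real"
  assumes "prob_space M" "prob_space N"
    and [measurable]: "\<And>n. T n \<in> borel_measurable M" "T' \<in> borel_measurable N"
    and T: "\<And>n \<omega>. \<omega> \<in> space M \<Longrightarrow> 0 \<le> T n \<omega>" and T': "\<And>\<omega>. \<omega> \<in> space N \<Longrightarrow> 0 \<le> T' \<omega>"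
    and laplace: "\<And>k::nat. (\<lambda>n. \<integral>\<omega>. exp (- (real k * T n \<omega>)) \<partial>M) \<longlonglongrightarrow> (\<integral>\<omega>. exp (- (real k * T' \<omega>)) \<partial>N)"
    and "x < y"
  shows "(\<lambda>n. \<integral>\<omega>. cts_step x y (T n \<omega>) \<partial>M) \<longlonglongrightarrow> (\<integral>\<omega>. cts_step x y (T' \<omega>) \<partial>N)"
proof -
  \<comment> \<open>\<open>cts_step\<close> after - ln, extended continuously to 0 and below: for
    arguments under exp (- y) the value of - ln exceeds \<open>y\<close>, where
    \<open>cts_step\<close> is 0 already, so the cut-off at exp (- y) changes nothing.\<close>
  define g where "g t = cts_step x y (- ln (max t (exp (- y))))" for t :: real
  have g: "continuous_on UNIV g"
    unfolding g_def
    by (intro continuous_on_compose2[OF continuous_cts_step[OF \<open>x < y\<close>]] continuous_intros)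
      (auto simp: max_def dest: sym)
  have ge: "g (exp (- t)) = cts_step x y t" for t
  proof (cases "t \<le> y")
    case True
    then show ?thesis by (simp add: g_def max_def)
  next
    case False
    then have "max (exp (- t)) (exp (- y)) = exp (- y)" by (simp add: max_def)
    with False \<open>x < y\<close> show ?thesis by (simp add: g_def cts_step_def)
  qed
  have pw: "exp (- t) ^ k = exp (- (real k * t))" for t :: real and k
    by (simp add: exp_of_nat_mult[symmetric])
  have "(\<lambda>n. \<integral>\<omega>. g (exp (- T n \<omega>)) \<partial>M) \<longlonglongrightarrow> (\<integral>\<omega>. g (exp (- T' \<omega>)) \<partial>N)"
    by (rule moments_imp_continuous_expectation[OF assms(1,2) _ _ _ _ _ g])
      (use T T' laplace in \<open>auto simp: pw\<close>)
  then show ?thesis by (simp add: ge)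
qed

section \<open>Gaussian vectors and their sums of squares\<close>

lemma prob_space_std_normal_PiM: "prob_space (PiM I (\<lambda>_. std_normal_distribution))"
  by (intro prob_space_PiM prob_space_normal_density) simp

lemma char_std_normal_PiM:
  fixes y :: "nat \<Rightarrow> real"
  shows "(\<integral>g. iexp (\<Sum>j<k. g j * y j) \<partial>PiM {..<k} (\<lambda>_. std_normal_distribution)) =
    complex_of_real (exp (- (\<Sum>j<k. (y j)\<^sup>2) / 2))"
proof -
  interpret std: prob_space std_normal_distribution by (rule prob_space_normal_density) simp
  interpret product_sigma_finite "\<lambda>_::nat. std_normal_distribution" ..
  have "(\<integral>g. iexp (\<Sum>j<k. g j * y j) \<partial>PiM {..<k} (\<lambda>_. std_normal_distribution)) =
      (\<integral>g. (\<Prod>j<k. iexp (y j * g j)) \<partial>PiM {..<k} (\<lambda>_. std_normal_distribution))"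
    by (simp add: exp_sum[symmetric] sum_distrib_left mult.commute)
  also have "\<dots> = (\<Prod>j<k. \<integral>x. iexp (y j * x) \<partial>std_normal_distribution)"
    by (rule product_integral_prod) (auto intro: std.integrable_iexp)
  also have "\<dots> = (\<Prod>j<k. complex_of_real (exp (- (y j)\<^sup>2 / 2)))"
    using char_std_normal_distribution by (simp add: char_def fun_eq_iff)
  also have "\<dots> = complex_of_real (exp (\<Sum>j<k. - (y j)\<^sup>2 / 2))"
    by (simp add: exp_sum)
  finally show ?thesis by (simp add: sum_divide_distrib sum_negf)
qed

text \<open>The Gaussian average of \<open>iexp (sqrt (2 s) (g . Y))\<close> over \<open>g\<close> is \<open>exp (- s |Y|\<^sup>2)\<close>. Thus the
  Laplace transform of \<open>|Y|\<^sup>2\<close> is a mixture of characteristic functions of \<open>Y\<close>, and no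
  multivariate continuity theorem is needed.\<close>

lemma laplace_sum_squares_tendsto:
  fixes Y :: "nat \<Rightarrow> nat \<Rightarrow> 'a \<Rightarrow> real"
  assumes "prob_space M" and [measurable]: "\<And>n j. Y n j \<in> borel_measurable M"
    and char: "\<And>g. (\<lambda>n. \<integral>\<omega>. iexp (\<Sum>j<k. g j * Y n j \<omega>) \<partial>M) \<longlonglongrightarrow> complex_of_real (exp (- (\<Sum>j<k. (g j)\<^sup>2) / 2))"
    and s: "0 \<le> s"
  shows "(\<lambda>n. \<integral>\<omega>. exp (- (s * (\<Sum>j<k. (Y n j \<omega>)\<^sup>2))) \<partial>M) \<longlonglongrightarrow>
    (\<integral>g. exp (- (s * (\<Sum>j<k. (g j)\<^sup>2))) \<partial>PiM {..<k} (\<lambda>_. std_normal_distribution))"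
proof -
  let ?P = "PiM {..<k} (\<lambda>_. std_normal_distribution)"
  define c where "c = sqrt (2 * s)"
  have c: "c\<^sup>2 = 2 * s" using s by (simp add: c_def)
  interpret M: prob_space M by fact
  interpret G: prob_space ?P by (rule prob_space_std_normal_PiM)
  interpret Q: pair_prob_space M ?P ..
  have cs: "(\<Sum>j<k. (c * a j)\<^sup>2) / 2 = s * (\<Sum>j<k. (a j)\<^sup>2)" for a :: "nat \<Rightarrow> real"
    by (simp add: power_mult_distrib c sum_distrib_left[symmetric])
  define \<phi> where "\<phi> n g = (\<integral>\<omega>. iexp (\<Sum>j<k. (c * g j) * Y n j \<omega>) \<partial>M)" for n and g :: "nat \<Rightarrow> real"
  have meas: "(\<lambda>(\<omega>, g). iexp (\<Sum>j<k. (c * g j) * Y n j \<omega>)) \<in> borel_measurable (M \<Otimes>\<^sub>M ?P)" for n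
    by measurable
  have int: "integrable (M \<Otimes>\<^sub>M ?P) (\<lambda>(\<omega>, g). iexp (\<Sum>j<k. (c * g j) * Y n j \<omega>))" for n
    using meas by (rule Q.P.integrable_const_bound[where B=1, rotated]) (auto simp: split_def)
  have eq: "complex_of_real (\<integral>\<omega>. exp (- (s * (\<Sum>j<k. (Y n j \<omega>)\<^sup>2))) \<partial>M) = (\<integral>g. \<phi> n g \<partial>?P)" for n
  proof -
    have "(\<integral>g. \<phi> n g \<partial>?P) = (\<integral>\<omega>. (\<integral>g. iexp (\<Sum>j<k. (c * g j) * Y n j \<omega>) \<partial>?P) \<partial>M)"
      unfolding \<phi>_def by (rule Q.Fubini_integral[OF int])
    also have "\<dots> = (\<integral>\<omega>. complex_of_real (exp (- (s * (\<Sum>j<k. (Y n j \<omega>)\<^sup>2)))) \<partial>M)"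
      using char_std_normal_PiM[of k "\<lambda>j. c * Y n j \<omega>" for \<omega>]
      by (intro Bochner_Integration.integral_cong) (simp_all add: ac_simps cs[symmetric])
    finally show ?thesis by simp
  qed
  have "(\<lambda>n. \<integral>g. \<phi> n g \<partial>?P) \<longlonglongrightarrow> (\<integral>g. complex_of_real (exp (- (s * (\<Sum>j<k. (g j)\<^sup>2)))) \<partial>?P)"
  proof (rule integral_dominated_convergence[where w="\<lambda>_. 1"])
    show "\<phi> n \<in> borel_measurable ?P" for n
      unfolding \<phi>_def by measurable
    have "(\<lambda>n. \<phi> n g) \<longlonglongrightarrow> complex_of_real (exp (- (s * (\<Sum>j<k. (g j)\<^sup>2))))" for g
      using char[of "\<lambda>j. c * g j"] unfolding \<phi>_def cs[symmetric] by simp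
    then show "AE g in ?P. (\<lambda>n. \<phi> n g) \<longlonglongrightarrow> complex_of_real (exp (- (s * (\<Sum>j<k. (g j)\<^sup>2))))"
      by simp
    show "AE g in ?P. norm (\<phi> n g) \<le> 1" for n
    proof (rule AE_I2)
      fix g :: "nat \<Rightarrow> real"
      have "norm (\<phi> n g) \<le> (\<integral>\<omega>. norm (iexp (\<Sum>j<k. (c * g j) * Y n j \<omega>)) \<partial>M)"
        unfolding \<phi>_def by (rule integral_norm_bound)
      then show "norm (\<phi> n g) \<le> 1" by (simp add: M.prob_space)
    qed
  qed auto
  then have "(\<lambda>n. complex_of_real (\<integral>\<omega>. exp (- (s * (\<Sum>j<k. (Y n j \<omega>)\<^sup>2))) \<partial>M)) \<longlonglongrightarrow>
      complex_of_real (\<integral>g. exp (- (s * (\<Sum>j<k. (g j)\<^sup>2))) \<partial>?P)"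
    unfolding eq by simp
  then show ?thesis by (simp only: tendsto_of_real_iff)
qed

lemma sets_chi_squared [simp]: "sets (chi_squared k) = sets borel" "space (chi_squared k) = UNIV"
  by (simp_all add: chi_squared_def)

lemma real_distribution_chi_squared: "real_distribution (chi_squared k)"
proof -
  interpret prob_space "PiM {..<k} (\<lambda>_. std_normal_distribution)" by (rule prob_space_std_normal_PiM)
  show ?thesis
    unfolding chi_squared_def by (intro real_distribution_distr) measurable
qed

lemma cts_step_sum_squares_tendsto:
  fixes Y :: "nat \<Rightarrow> nat \<Rightarrow> 'a \<Rightarrow> real"
  assumes "prob_space M" and [measurable]: "\<And>n j. Y n j \<in> borel_measurable M"
    and char: "\<And>g. (\<lambda>n. \<integral>\<omega>. iexp (\<Sum>j<k. g j * Y n j \<omega>) \<partial>M) \<longlonglongrightarrow> complex_of_real (exp (- (\<Sum>j<k. (g j)\<^sup>2) / 2))"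
    and "x < y"
  shows "(\<lambda>n. \<integral>\<omega>. cts_step x y (\<Sum>j<k. (Y n j \<omega>)\<^sup>2) \<partial>M) \<longlonglongrightarrow> (\<integral>t. cts_step x y t \<partial>chi_squared k)"
proof -
  let ?P = "PiM {..<k} (\<lambda>_. std_normal_distribution)"
  have "(\<lambda>n. \<integral>\<omega>. cts_step x y (\<Sum>j<k. (Y n j \<omega>)\<^sup>2) \<partial>M) \<longlonglongrightarrow> (\<integral>g. cts_step x y (\<Sum>j<k. (g j)\<^sup>2) \<partial>?P)"
    by (rule laplace_imp_cts_step_expectation[OF assms(1) prob_space_std_normal_PiM])
      (auto intro!: sum_nonneg laplace_sum_squares_tendsto[OF assms(1)] char \<open>x < y\<close>)
  also have "(\<integral>g. cts_step x y (\<Sum>j<k. (g j)\<^sup>2) \<partial>?P) = (\<integral>t. cts_step x y t \<partial>chi_squared k)"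
    unfolding chi_squared_def by (subst integral_distr) auto
  finally show ?thesis .
qed

text \<open>Slutsky's argument. \<open>cts_step\<close> is Lipschitz with constant 1 / (y - x) and
  its values differ by at most 1, so the exceptional set costs its measure and the rest costs \<eta>
  / (y - x). Convergence for these test functions implies weak convergence.\<close>

lemma weak_conv_m_perturb:
  fixes V T :: "nat \<Rightarrow> 'a \<Rightarrow> real"
  assumes "prob_space M" and [measurable]: "\<And>n. V n \<in> borel_measurable M" "\<And>n. T n \<in> borel_measurable M"
    and \<mu>: "real_distribution \<mu>"
    and close: "\<And>\<eta>. 0 < \<eta> \<Longrightarrow> \<forall>\<^sub>F n in sequentially. \<exists>A\<in>sets M. measure M A \<le> \<eta> \<and> (\<forall>\<omega>\<in>space M - A. \<bar>V n \<omega> - T n \<omega>\<bar> \<le> \<eta>)"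
    and lim: "\<And>x y. x < y \<Longrightarrow> (\<lambda>n. \<integral>\<omega>. cts_step x y (T n \<omega>) \<partial>M) \<longlonglongrightarrow> (\<integral>t. cts_step x y t \<partial>\<mu>)"
  shows "weak_conv_m (\<lambda>n. distr M borel (V n)) \<mu>"
proof (rule integral_cts_step_conv_imp_weak_conv)
  interpret prob_space M by fact
  show "real_distribution (distr M borel (V n))" for n by (intro real_distribution_distr) measurable
  show "real_distribution \<mu>" by fact
  fix x y :: real assume xy: "x < y"
  note cs = cts_step_props[OF xy]
  have int: "integrable M (\<lambda>\<omega>. cts_step x y (f \<omega>))" if [measurable]: "f \<in> borel_measurable M" for f
    using cs by (intro integrable_const_bound[where B=1]) (auto simp: abs_le_iff intro: order_trans)
  have "(\<lambda>n. (\<integral>\<omega>. cts_step x y (V n \<omega>) \<partial>M) - (\<integral>\<omega>. cts_step x y (T n \<omega>) \<partial>M)) \<longlonglongrightarrow> 0"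
  proof (rule LIMSEQ_I)
    fix r :: real assume r: "0 < r"
    \<comment> \<open>The two costs \<eta> / (y - x) and \<eta> then add up to r / 2.\<close>
    define \<eta> where "\<eta> = r / (2 * (1 / (y - x) + 1))"
    have p: "0 < 1 / (y - x) + 1" using xy by (simp add: add_pos_pos)
    have \<eta>: "0 < \<eta>" "\<eta> / (y - x) + \<eta> < r"
    proof -
      show "0 < \<eta>" using r p by (simp add: \<eta>_def)
      define q where "q = 1 / (y - x) + 1"
      have q: "0 < q" "\<eta> = r / (2 * q)" using p by (simp_all add: q_def \<eta>_def)
      have "\<eta> / (y - x) + \<eta> = \<eta> * q" by (simp add: q_def algebra_simps)
      also have "\<dots> = r / 2" using q by simp
      finally show "\<eta> / (y - x) + \<eta> < r" using r by simp
    qed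
    from close[OF \<eta>(1)] obtain n0 where n0: "\<And>n. n \<ge> n0 \<Longrightarrow>
       \<exists>A\<in>sets M. measure M A \<le> \<eta> \<and> (\<forall>\<omega>\<in>space M - A. \<bar>V n \<omega> - T n \<omega>\<bar> \<le> \<eta>)"
      unfolding eventually_sequentially by blast
    show "\<exists>no. \<forall>n\<ge>no. norm ((\<integral>\<omega>. cts_step x y (V n \<omega>) \<partial>M) - (\<integral>\<omega>. cts_step x y (T n \<omega>) \<partial>M) - 0) < r"
    proof (intro exI allI impI)
      fix n assume "n \<ge> n0"
      then obtain A where A[measurable]: "A \<in> sets M" and mA: "measure M A \<le> \<eta>"
        and VT: "\<And>\<omega>. \<omega> \<in> space M - A \<Longrightarrow> \<bar>V n \<omega> - T n \<omega>\<bar> \<le> \<eta>"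
        using n0 by blast
      have "\<bar>\<integral>\<omega>. cts_step x y (V n \<omega>) - cts_step x y (T n \<omega>) \<partial>M\<bar>
          \<le> (\<integral>\<omega>. \<eta> / (y - x) + indicator A \<omega> \<partial>M)"
      proof (intro order_trans[OF integral_abs_bound] integral_mono)
        fix \<omega> assume \<omega>: "\<omega> \<in> space M"
        show "\<bar>cts_step x y (V n \<omega>) - cts_step x y (T n \<omega>)\<bar> \<le> \<eta> / (y - x) + indicator A \<omega>"
        proof (cases "\<omega> \<in> A")
          case True
          then show ?thesis using cs(3)[of "V n \<omega>" "T n \<omega>"] \<eta> xy by (simp add: add_increasing)
        next
          case False
          then have "\<bar>V n \<omega> - T n \<omega>\<bar> / (y - x) \<le> \<eta> / (y - x)"
            using VT \<omega> xy by (intro divide_right_mono) auto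
          then show ?thesis using cs(4)[of "V n \<omega>" "T n \<omega>"] False by simp
        qed
      qed (use int in \<open>auto simp: less_top[symmetric] intro!: Bochner_Integration.integrable_add integrable_real_indicator\<close>)
      also have "\<dots> = \<eta> / (y - x) + measure M A"
        by (subst Bochner_Integration.integral_add)
          (auto simp: prob_space less_top[symmetric] intro!: integrable_real_indicator)
      also have "\<dots> < r" using mA \<eta> by simp
      finally show "norm ((\<integral>\<omega>. cts_step x y (V n \<omega>) \<partial>M) - (\<integral>\<omega>. cts_step x y (T n \<omega>) \<partial>M) - 0) < r"
        using int by simp
    qed
  qed
  from tendsto_add[OF this lim[OF xy]]
  have "(\<lambda>n. \<integral>\<omega>. cts_step x y (V n \<omega>) \<partial>M) \<longlonglongrightarrow> (\<integral>t. cts_step x y t \<partial>\<mu>)" by simp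
  then show "(\<lambda>n. integral\<^sup>L (distr M borel (V n)) (cts_step x y)) \<longlonglongrightarrow> integral\<^sup>L \<mu> (cts_step x y)"
    by (simp add: integral_distr)
qed

section \<open>Euler schemes and path integrals\<close>

lemma partition_oscillation:
  fixes f :: "real \<Rightarrow> 'b::metric_space"
  assumes "continuous_on {a..a + t} f" "0 \<le> t" "0 < e"
  shows "\<forall>\<^sub>F N in sequentially. 0 < N \<and> (\<forall>j<N. \<forall>s\<in>{a + real j * (t / real N)..a + real (Suc j) * (t / real N)}.
           dist (f s) (f (a + real j * (t / real N))) \<le> e)"
proof -
  obtain d where d: "0 < d" "\<And>s u. s \<in> {a..a + t} \<Longrightarrow> u \<in> {a..a + t} \<Longrightarrow> dist s u < d \<Longrightarrow> dist (f s) (f u) < e"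
    using compact_uniformly_continuous[OF assms(1) compact_Icc] assms(3)
    unfolding uniformly_continuous_on_def by metis
  have "(\<lambda>N. t / real N) \<longlonglongrightarrow> 0" by (rule lim_const_over_n)
  then have "\<forall>\<^sub>F N in sequentially. t / real N < d" using d(1) by (rule order_tendstoD)
  then show ?thesis
    using eventually_gt_at_top[of 0]
  proof eventually_elim
    case (elim N)
    have "dist (f s) (f (a + real j * (t / real N))) \<le> e"
      if j: "j < N" and s: "s \<in> {a + real j * (t / real N)..a + real (Suc j) * (t / real N)}" for j s
    proof -
      have "real (Suc j) * (t / real N) \<le> real N * (t / real N)"
        using j assms(2) by (intro mult_right_mono) auto
      then have "real (Suc j) * (t / real N) \<le> t" using elim by simp
      moreover have "0 \<le> real j * (t / real N)" "real j * (t / real N) \<le> real (Suc j) * (t / real N)"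
        using assms(2) by (auto intro!: mult_right_mono simp del: times_divide_eq_right)
      ultimately have "s \<in> {a..a + t}" "a + real j * (t / real N) \<in> {a..a + t}"
        using s unfolding atLeastAtMost_iff by linarith+
      moreover have "dist s (a + real j * (t / real N)) < d"
      proof -
        have "real (Suc j) * (t / real N) = real j * (t / real N) + t / real N"
          by (simp add: algebra_simps add_divide_distrib)
        then show ?thesis using s elim unfolding dist_real_def atLeastAtMost_iff by linarith
      qed
      ultimately show ?thesis using d(2) less_imp_le by blast
    qed
    then show ?case using elim by blast
  qed
qed

lemma integral_near_const:
  fixes f :: "real \<Rightarrow> 'b::euclidean_space"
  assumes "continuous_on {u..v} f" "u \<le> v" "\<And>s. s \<in> {u..v} \<Longrightarrow> norm (f s - c) \<le> e"
  shows "norm (integral {u..v} f - (v - u) *\<^sub>R c) \<le> e * (v - u)"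
proof -
  have "integral {u..v} (\<lambda>s. f s - c) = integral {u..v} f - (v - u) *\<^sub>R c"
    using assms by (subst integral_diff) (auto intro: integrable_continuous_real)
  moreover have "norm (integral {u..v} (\<lambda>s. f s - c)) \<le> e * (v - u)"
    using assms by (intro integral_bound continuous_intros)
  ultimately show ?thesis by simp
qed

lemma riemann_sums_tendsto:
  fixes f :: "real \<Rightarrow> 'b::euclidean_space"
  assumes f: "continuous_on {a..a + t} f" and t: "0 \<le> t"
  shows "(\<lambda>N. (t / real N) *\<^sub>R (\<Sum>j<N. f (a + real j * (t / real N)))) \<longlonglongrightarrow> integral {a..a + t} f"
proof (rule LIMSEQ_I)
  fix r :: real assume r: "0 < r"
  define e where "e = r / (t + 1)"
  have e: "0 < e" "e * t < r" using r t by (simp_all add: e_def field_simps)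
  from partition_oscillation[OF f t e(1)] obtain N0 where N0: "\<And>N. N \<ge> N0 \<Longrightarrow>
     0 < N \<and> (\<forall>j<N. \<forall>s\<in>{a + real j * (t / real N)..a + real (Suc j) * (t / real N)}.
           dist (f s) (f (a + real j * (t / real N))) \<le> e)"
    unfolding eventually_sequentially by blast
  show "\<exists>no. \<forall>n\<ge>no. norm ((t / real n) *\<^sub>R (\<Sum>j<n. f (a + real j * (t / real n))) - integral {a..a + t} f) < r"
  proof (intro exI allI impI)
    fix N assume "N \<ge> N0"
    note N = N0[OF this]
    define \<delta> where "\<delta> = t / real N"
    have \<delta>: "0 \<le> \<delta>" "real N * \<delta> = t" using N t by (auto simp: \<delta>_def)
    have "norm (\<delta> *\<^sub>R (\<Sum>j<k. f (a + real j * \<delta>)) - integral {a..a + real k * \<delta>} f) \<le> e * (real k * \<delta>)"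
      if "k \<le> N" for k
      using that
    proof (induction k)
      case 0
      then show ?case by simp
    next
      case (Suc k)
      let ?u = "a + real k * \<delta>" and ?v = "a + real (Suc k) * \<delta>"
      have "real (Suc k) * \<delta> \<le> real N * \<delta>" using Suc.prems \<delta> by (intro mult_right_mono) auto
      then have kt: "?v \<le> a + t" using \<delta> by simp
      have uv: "a \<le> ?u" "?u \<le> ?v" using \<delta> by (simp_all add: algebra_simps)
      have c: "continuous_on {a..?v} f" "continuous_on {?u..?v} f"
        using kt uv by (auto intro: continuous_on_subset[OF f])
      have "integral {a..?v} f = integral {a..?u} f + integral {?u..?v} f"
        using Henstock_Kurzweil_Integration.integral_combine[OF uv integrable_continuous_real[OF c(1)]] by simp
      then have "\<delta> *\<^sub>R (\<Sum>j<Suc k. f (a + real j * \<delta>)) - integral {a..?v} f =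
          (\<delta> *\<^sub>R (\<Sum>j<k. f (a + real j * \<delta>)) - integral {a..?u} f) - (integral {?u..?v} f - (?v - ?u) *\<^sub>R f ?u)"
        by (simp add: algebra_simps)
      also have "norm \<dots> \<le> e * (real k * \<delta>) + e * (?v - ?u)"
      proof (rule order_trans[OF norm_triangle_ineq4 add_mono])
        show "norm (integral {?u..?v} f - (?v - ?u) *\<^sub>R f ?u) \<le> e * (?v - ?u)"
          using N Suc.prems by (intro integral_near_const[OF c(2) uv(2)]) (auto simp: dist_norm \<delta>_def)
      qed (use Suc in simp)
      also have "\<dots> = e * (real (Suc k) * \<delta>)" by (simp add: algebra_simps)
      finally show ?case .
    qed
    from this[of N] have "norm (\<delta> *\<^sub>R (\<Sum>j<N. f (a + real j * \<delta>)) - integral {a..a + t} f) \<le> e * t"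
      by (simp add: \<delta>)
    with e show "norm ((t / real N) *\<^sub>R (\<Sum>j<N. f (a + real j * (t / real N))) - integral {a..a + t} f) < r"
      by (simp add: \<delta>_def)
  qed
qed

text \<open>\<open>x\<close> is the driving path sampled on the grid, initial value included. With
  additive noise a step needs only its increments and the values of \<open>B\<close>.\<close>

primrec euler :: "('b \<Rightarrow> 'b::real_vector) \<Rightarrow> (nat \<Rightarrow> 'b) \<Rightarrow> real \<Rightarrow> nat \<Rightarrow> 'b" where
  "euler B x \<delta> 0 = x 0"
| "euler B x \<delta> (Suc j) = euler B x \<delta> j + \<delta> *\<^sub>R B (euler B x \<delta> j) + (x (Suc j) - x j)"

text \<open>Convergence path by path. Its purpose is measurability: the solution at time
  \<open>t\<close> appears as a limit of functions of finitely many values of the driving path up to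
  \<open>t\<close>.\<close>

lemma euler_tendsto:
  fixes Y :: "real \<Rightarrow> 'b::euclidean_space"
  assumes B: "L-lipschitz_on UNIV B" and Y: "continuous_on {0..t} Y" and t: "0 \<le> t"
    and eq: "\<And>s. s \<in> {0..t} \<Longrightarrow> Y s = x s + integral {0..s} (\<lambda>u. B (Y u))"
  shows "(\<lambda>N. euler B (\<lambda>j. x (real j * (t / real N))) (t / real N) N) \<longlonglongrightarrow> Y t"
proof (rule LIMSEQ_I)
  fix r :: real assume r: "0 < r"
  have L: "0 \<le> L" using B lipschitz_on_nonneg by blast
  define e where "e = r / (exp (L * t) + 1)"
  have p: "0 < exp (L * t) + 1" by (simp add: add_pos_pos)
  have e: "0 < e" "e * exp (L * t) < r"
    using r p by (simp_all add: e_def field_simps)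
  have Y': "continuous_on {0..0 + t} Y" using Y by simp
  from partition_oscillation[OF Y' t e(1)] obtain N0 where N0: "\<And>N. N \<ge> N0 \<Longrightarrow>
     0 < N \<and> (\<forall>j<N. \<forall>s\<in>{0 + real j * (t / real N)..0 + real (Suc j) * (t / real N)}.
           dist (Y s) (Y (0 + real j * (t / real N))) \<le> e)"
    unfolding eventually_sequentially by blast
  have cB: "continuous_on {0..t} (\<lambda>u. B (Y u))"
    by (intro continuous_on_compose2[OF lipschitz_on_continuous_on[OF B]] Y) auto
  show "\<exists>no. \<forall>n\<ge>no. norm (euler B (\<lambda>j. x (real j * (t / real n))) (t / real n) n - Y t) < r"
  proof (intro exI allI impI)
    fix N assume "N \<ge> N0"
    note N = N0[OF this]
    define \<delta> where "\<delta> = t / real N"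
    define y where "y = euler B (\<lambda>j. x (real j * \<delta>)) \<delta>"
    have \<delta>: "0 \<le> \<delta>" "real N * \<delta> = t" using N t by (auto simp: \<delta>_def)
    \<comment> \<open>Adding \<open>e\<close> to the error absorbs the oscillation of
      \<open>Y\<close> over one step, and the Gronwall recursion becomes purely
      multiplicative.\<close>
    have "norm (y k - Y (real k * \<delta>)) + e \<le> e * (1 + L * \<delta>) ^ k" if "k \<le> N" for k
      using that
    proof (induction k)
      case 0
      then show ?case using eq[of 0] t by (simp add: y_def)
    next
      case (Suc k)
      let ?u = "real k * \<delta>" and ?v = "real (Suc k) * \<delta>"
      have "real (Suc k) * \<delta> \<le> real N * \<delta>" using Suc.prems \<delta> by (intro mult_right_mono) auto
      then have kt: "?v \<le> t" using \<delta> by simp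
      have uv: "0 \<le> ?u" "?u \<le> ?v" using \<delta> by (simp_all add: algebra_simps)
      have c: "continuous_on {0..?v} (\<lambda>u. B (Y u))" "continuous_on {?u..?v} (\<lambda>u. B (Y u))"
        using kt uv by (auto intro: continuous_on_subset[OF cB])
      define g where "g = norm (y k - Y ?u) + e"
      have g: "g \<le> e * (1 + L * \<delta>) ^ k" using Suc by (simp add: g_def)
      have "integral {0..?v} (\<lambda>u. B (Y u)) = integral {0..?u} (\<lambda>u. B (Y u)) + integral {?u..?v} (\<lambda>u. B (Y u))"
        using Henstock_Kurzweil_Integration.integral_combine[OF uv integrable_continuous_real[OF c(1)]] by simp
      then have "Y ?v = Y ?u + integral {?u..?v} (\<lambda>u. B (Y u)) + (x ?v - x ?u)"
        using eq[of ?u] eq[of ?v] kt uv by simp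
      then have "y (Suc k) - Y ?v = (y k - Y ?u) - (integral {?u..?v} (\<lambda>u. B (Y u)) - (?v - ?u) *\<^sub>R B (y k))"
        by (simp add: y_def algebra_simps)
      also have "norm \<dots> \<le> norm (y k - Y ?u) + L * g * (?v - ?u)"
      proof (rule order_trans[OF norm_triangle_ineq4 add_mono[OF order_refl integral_near_const[OF c(2) uv(2)]]])
        fix s assume s: "s \<in> {?u..?v}"
        have "norm (Y s - y k) \<le> norm (Y s - Y ?u) + norm (Y ?u - y k)"
          using norm_triangle_ineq[of "Y s - Y ?u" "Y ?u - y k"] by simp
        also have "\<dots> \<le> g"
          using N s Suc.prems by (auto simp: g_def dist_norm \<delta>_def norm_minus_commute)
        finally have "L * norm (Y s - y k) \<le> L * g" using L by (rule mult_left_mono)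
        then show "norm (B (Y s) - B (y k)) \<le> L * g"
          using lipschitz_onD[OF B, of "Y s" "y k"] by (simp add: dist_norm)
      qed
      finally have "norm (y (Suc k) - Y ?v) + e \<le> g * (1 + L * \<delta>)"
        by (simp add: g_def algebra_simps)
      also have "\<dots> \<le> e * (1 + L * \<delta>) ^ k * (1 + L * \<delta>)"
        using g L \<delta> by (intro mult_right_mono) auto
      finally show ?case by (simp add: ac_simps)
    qed
    from this[of N] have "norm (y N - Y t) \<le> e * (1 + L * \<delta>) ^ N" using e \<delta> by simp
    also have "(1 + L * \<delta>) ^ N \<le> exp (L * \<delta>) ^ N"
      using L \<delta> by (intro power_mono exp_ge_add_one_self) auto
    also have "\<dots> = exp (L * t)"
      using \<delta> by (simp add: exp_of_nat_mult[symmetric] mult.left_commute)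
    finally show "norm (euler B (\<lambda>j. x (real j * (t / real N))) (t / real N) N - Y t) < r"
      using e by (simp add: y_def \<delta>_def)
  qed
qed

lemma euler_measurable:
  fixes B :: "'b::euclidean_space \<Rightarrow> 'b"
  assumes [measurable]: "B \<in> borel_measurable borel" and x: "\<And>j. j \<le> k \<Longrightarrow> (\<lambda>\<omega>. x \<omega> j) \<in> borel_measurable F"
  shows "(\<lambda>\<omega>. euler B (x \<omega>) \<delta> k) \<in> borel_measurable F"
  using x
proof (induction k)
  case 0
  then show ?case by simp
next
  case (Suc k)
  have [measurable]: "(\<lambda>\<omega>. euler B (x \<omega>) \<delta> k) \<in> borel_measurable F"
    "(\<lambda>\<omega>. x \<omega> k) \<in> borel_measurable F" "(\<lambda>\<omega>. x \<omega> (Suc k)) \<in> borel_measurable F"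
    using Suc by auto
  show ?case by simp
qed

abbreviation msq :: "'a measure \<Rightarrow> ('a \<Rightarrow> 'b::real_normed_vector) \<Rightarrow> ennreal" where
  "msq M f \<equiv> \<integral>\<^sup>+\<omega>. ennreal ((norm (f \<omega>))\<^sup>2) \<partial>M"

text \<open>Riemann sums and Fatou's lemma replace the joint measurability in \<open>(s, \<omega>)\<close> and Fubini's theorem.\<close>

lemma path_integral_L2:
  fixes f :: "real \<Rightarrow> 'a \<Rightarrow> 'b::euclidean_space"
  assumes f: "\<And>s. s \<in> {a..a + t} \<Longrightarrow> f s \<in> borel_measurable M" and t: "0 \<le> t"
    and cont: "\<And>\<omega>. \<omega> \<in> space M \<Longrightarrow> continuous_on {a..a + t} (\<lambda>s. f s \<omega>)"
    and bound: "\<And>s. s \<in> {a..a + t} \<Longrightarrow> msq M (f s) \<le> ennreal C" and C: "0 \<le> C"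
  shows "(\<lambda>\<omega>. integral {a..a + t} (\<lambda>s. f s \<omega>)) \<in> borel_measurable M"
    and "msq M (\<lambda>\<omega>. integral {a..a + t} (\<lambda>s. f s \<omega>)) \<le> ennreal (t\<^sup>2 * C)"
proof -
  define R where "R N \<omega> = (t / real N) *\<^sub>R (\<Sum>j<N. f (a + real j * (t / real N)) \<omega>)" for N \<omega>
  have pt: "a + real j * (t / real N) \<in> {a..a + t}" if "j < N" for j N
  proof -
    have "real j * (t / real N) \<le> real N * (t / real N)"
      using that t by (intro mult_right_mono) auto
    then show ?thesis using that t by auto
  qed
  have R[measurable]: "R N \<in> borel_measurable M" for N
    unfolding R_def using pt by (intro borel_measurable_scaleR borel_measurable_sum borel_measurable_const f) auto
  have lim: "(\<lambda>N. R N \<omega>) \<longlonglongrightarrow> integral {a..a + t} (\<lambda>s. f s \<omega>)" if "\<omega> \<in> space M" for \<omega>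
    unfolding R_def by (rule riemann_sums_tendsto[OF cont[OF that] t])
  show meas: "(\<lambda>\<omega>. integral {a..a + t} (\<lambda>s. f s \<omega>)) \<in> borel_measurable M"
    by (rule borel_measurable_LIMSEQ_metric[OF R lim])
  have RC: "msq M (\<lambda>\<omega>. R N \<omega>) \<le> ennreal (t\<^sup>2 * C)" for N
  proof (cases "N = 0")
    case False
    have "(norm (R N \<omega>))\<^sup>2 \<le> t\<^sup>2 / real N * (\<Sum>j<N. (norm (f (a + real j * (t / real N)) \<omega>))\<^sup>2)" for \<omega>
    proof -
      have "norm (R N \<omega>) \<le> (t / real N) * (\<Sum>j<N. norm (f (a + real j * (t / real N)) \<omega>))"
        using t by (auto simp: R_def intro!: mult_left_mono norm_sum divide_right_mono)
      then have "(norm (R N \<omega>))\<^sup>2 \<le> (t / real N)\<^sup>2 * (\<Sum>j<N. norm (f (a + real j * (t / real N)) \<omega>))\<^sup>2"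
        by (metis norm_ge_zero power_mono power_mult_distrib)
      also have "\<dots> \<le> (t / real N)\<^sup>2 * ((\<Sum>j<N. (norm (f (a + real j * (t / real N)) \<omega>))\<^sup>2) * real (card {..<N}))"
        by (intro mult_left_mono sum_squared_le_sum_of_squares) auto
      also have "\<dots> = t\<^sup>2 / real N * (\<Sum>j<N. (norm (f (a + real j * (t / real N)) \<omega>))\<^sup>2)"
        using False by (simp add: power2_eq_square field_simps)
      finally show ?thesis .
    qed
    then have "msq M (\<lambda>\<omega>. R N \<omega>) \<le>
        (\<integral>\<^sup>+\<omega>. ennreal (t\<^sup>2 / real N) * (\<Sum>j<N. ennreal ((norm (f (a + real j * (t / real N)) \<omega>))\<^sup>2)) \<partial>M)"
      by (intro nn_integral_mono) (simp add: sum_ennreal ennreal_mult[symmetric] sum_nonneg ennreal_leI)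
    also have "\<dots> = ennreal (t\<^sup>2 / real N) * (\<Sum>j<N. \<integral>\<^sup>+\<omega>. ennreal ((norm (f (a + real j * (t / real N)) \<omega>))\<^sup>2) \<partial>M)"
    proof -
      have "(\<lambda>\<omega>. ennreal ((norm (f (a + real j * (t / real N)) \<omega>))\<^sup>2)) \<in> borel_measurable M" if "j < N" for j
        using f[OF pt[OF that]] by measurable
      then show ?thesis
        by (subst nn_integral_cmult, simp del: sum_ennreal, subst nn_integral_sum, simp_all del: sum_ennreal)
    qed
    also have "\<dots> \<le> ennreal (t\<^sup>2 / real N) * (\<Sum>j<N. ennreal C)"
      by (intro mult_left_mono sum_mono bound pt) auto
    also have "\<dots> = ennreal (t\<^sup>2 * C)"
      using False C by (simp add: ennreal_of_nat_eq_real_of_nat ennreal_mult[symmetric])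
    finally show ?thesis .
  qed (simp add: R_def)
  have "msq M (\<lambda>\<omega>. integral {a..a + t} (\<lambda>s. f s \<omega>)) =
      (\<integral>\<^sup>+\<omega>. liminf (\<lambda>N. ennreal ((norm (R N \<omega>))\<^sup>2)) \<partial>M)"
  proof (intro nn_integral_cong)
    fix \<omega> assume "\<omega> \<in> space M"
    from lim[OF this] have "(\<lambda>N. ennreal ((norm (R N \<omega>))\<^sup>2)) \<longlonglongrightarrow> ennreal ((norm (integral {a..a + t} (\<lambda>s. f s \<omega>)))\<^sup>2)"
      by (intro tendsto_intros)
    then show "ennreal ((norm (integral {a..a + t} (\<lambda>s. f s \<omega>)))\<^sup>2) = liminf (\<lambda>N. ennreal ((norm (R N \<omega>))\<^sup>2))"
      by (rule lim_imp_Liminf[symmetric, OF trivial_limit_sequentially])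
  qed
  also have "\<dots> \<le> liminf (\<lambda>N. \<integral>\<^sup>+\<omega>. ennreal ((norm (R N \<omega>))\<^sup>2) \<partial>M)"
    by (rule nn_integral_liminf) measurable
  also have "\<dots> \<le> ennreal (t\<^sup>2 * C)"
    by (rule order_trans[OF Liminf_mono[of _ "\<lambda>_. ennreal (t\<^sup>2 * C)"]]) (auto simp: RC Liminf_const)
  finally show "msq M (\<lambda>\<omega>. integral {a..a + t} (\<lambda>s. f s \<omega>)) \<le> ennreal (t\<^sup>2 * C)" .
qed

section \<open>Increments of the latent diffusions\<close>

lemma borel_measurable_vec_component [measurable (raw)]:
  "f \<in> borel_measurable M \<Longrightarrow> (\<lambda>x. f x $ i :: real) \<in> borel_measurable M"
  unfolding cart_eq_inner_axis by (intro borel_measurable_inner borel_measurable_const)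

lemma prod_Basis_vec:
  fixes f :: "real^'n \<Rightarrow> 'c::comm_monoid_mult"
  shows "(\<Prod>b\<in>Basis. f b) = (\<Prod>i\<in>UNIV. f (axis i 1))"
  by (simp add: Basis_vec_def UNION_singleton_eq_range prod.reindex axis_eq_axis inj_on_def)

lemma nn_integral_lborel_vec_prod:
  fixes f :: "'n::finite \<Rightarrow> real \<Rightarrow> ennreal"
  assumes [measurable]: "\<And>i. f i \<in> borel_measurable borel"
  shows "(\<integral>\<^sup>+x. (\<Prod>i\<in>UNIV. f i (x $ i)) \<partial>(lborel :: (real^'n) measure)) = (\<Prod>i\<in>UNIV. \<integral>\<^sup>+x. f i x \<partial>lborel)"
proof -
  \<comment> \<open>The product formula runs over basis vectors; \<open>g\<close> reads the index
    back from the vector.\<close>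
  define g where "g b = f (THE i. b = axis i 1)" for b :: "real^'n"
  have "(THE i. axis j (1::real) = axis i 1) = j" for j :: 'n
    by (auto simp: axis_eq_axis)
  then have g: "g (axis j 1) = f j" for j by (simp add: g_def)
  have "(\<integral>\<^sup>+x. (\<Prod>b\<in>Basis. g b (x \<bullet> b)) \<partial>lborel) = (\<Prod>b\<in>Basis. \<integral>\<^sup>+x. g b x \<partial>lborel)"
    by (rule nn_integral_lborel_prod) (simp_all add: g_def)
  then show ?thesis
    by (simp add: prod_Basis_vec g inner_axis)
qed

lemma prob_space_std_normal: "prob_space std_normal_distribution"
  by (rule prob_space_normal_density) simp

lemma nn_integral_normal_scaled:
  assumes "0 < \<sigma>" and [measurable]: "A \<in> sets borel"
  shows "(\<integral>\<^sup>+x. ennreal (normal_density 0 \<sigma> x) * indicator A (x / \<sigma>) \<partial>lborel) = emeasure std_normal_distribution A"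
proof -
  have "(\<integral>\<^sup>+x. ennreal (normal_density 0 \<sigma> x) * indicator A (x / \<sigma>) \<partial>lborel) =
      ennreal \<bar>\<sigma>\<bar> * (\<integral>\<^sup>+x. ennreal (normal_density 0 \<sigma> (0 + \<sigma> * x)) * indicator A ((0 + \<sigma> * x) / \<sigma>) \<partial>lborel)"
    using assms by (intro nn_integral_real_affine) auto
  also have "\<dots> = (\<integral>\<^sup>+x. ennreal \<bar>\<sigma>\<bar> * (ennreal (normal_density 0 \<sigma> (\<sigma> * x)) * indicator A x) \<partial>lborel)"
    using assms(1) by (subst nn_integral_cmult) auto
  also have "\<dots> = (\<integral>\<^sup>+x. ennreal (std_normal_density x) * indicator A x \<partial>lborel)"
  proof (intro nn_integral_cong)
    fix x
    have "\<bar>\<sigma>\<bar> * normal_density 0 \<sigma> (\<sigma> * x) = std_normal_density x"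
      using assms(1) by (simp add: normal_density_def real_sqrt_mult power_mult_distrib field_simps)
    then show "ennreal \<bar>\<sigma>\<bar> * (ennreal (normal_density 0 \<sigma> (\<sigma> * x)) * indicator A x) =
        ennreal (std_normal_density x) * indicator A x"
      by (metis abs_ge_zero ennreal_mult' mult.assoc)
  qed
  also have "\<dots> = emeasure std_normal_distribution A"
    by (simp add: emeasure_density)
  finally show ?thesis .
qed

text \<open>A product density gives rectangles product probabilities. Rectangles determine a joint
  law, so this computation yields the coordinate laws and, later, the law of the four processes
  together.\<close>

lemma wiener_increment_rectangle:
  fixes W :: "real \<Rightarrow> 'a \<Rightarrow> real^'r"
  assumes W: "std_wiener M W" and s: "0 \<le> s" "s < t" and A[measurable]: "\<And>i. A i \<in> sets borel"
  shows "emeasure M {\<omega>\<in>space M. \<forall>i. (W t \<omega> - W s \<omega>) $ i / sqrt (t - s) \<in> A i} =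
    (\<Prod>i\<in>UNIV. emeasure std_normal_distribution (A i))"
proof -
  let ?\<sigma> = "sqrt (t - s)"
  have D: "distributed M lborel (\<lambda>\<omega>. W t \<omega> - W s \<omega>) (\<lambda>x. \<Prod>i\<in>UNIV. ennreal (normal_density 0 ?\<sigma> (x $ i)))"
    using W s by (simp add: std_wiener_def)
  define C where "C = {x::real^'r. \<forall>i. x $ i / ?\<sigma> \<in> A i}"
  have "C = (\<Inter>i. (\<lambda>x. x $ i / ?\<sigma>) -` A i \<inter> space borel)" by (auto simp: C_def)
  also have "\<dots> \<in> sets borel"
    by (intro sets.finite_INT measurable_sets[OF _ A]) auto
  finally have C: "C \<in> sets borel" .
  have ind: "indicator C x = (\<Prod>i\<in>UNIV. indicator (A i) (x $ i / ?\<sigma>) :: ennreal)" for x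
    by (auto simp: C_def indicator_def)
  have "emeasure M {\<omega>\<in>space M. \<forall>i. (W t \<omega> - W s \<omega>) $ i / ?\<sigma> \<in> A i} =
      emeasure M ((\<lambda>\<omega>. W t \<omega> - W s \<omega>) -` C \<inter> space M)"
    by (intro arg_cong[where f="emeasure M"]) (auto simp: C_def)
  also have "\<dots> = (\<integral>\<^sup>+x. (\<Prod>i\<in>UNIV. ennreal (normal_density 0 ?\<sigma> (x $ i))) * indicator C x \<partial>lborel)"
    using distributed_emeasure[OF D] C by simp
  also have "\<dots> = (\<integral>\<^sup>+x. (\<Prod>i\<in>UNIV. ennreal (normal_density 0 ?\<sigma> (x $ i)) * indicator (A i) (x $ i / ?\<sigma>)) \<partial>lborel)"
    by (simp add: ind prod.distrib)
  also have "\<dots> = (\<Prod>i\<in>UNIV. \<integral>\<^sup>+x. ennreal (normal_density 0 ?\<sigma> x) * indicator (A i) (x / ?\<sigma>) \<partial>lborel)"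
    by (rule nn_integral_lborel_vec_prod) measurable
  also have "\<dots> = (\<Prod>i\<in>UNIV. emeasure std_normal_distribution (A i))"
    using s by (intro prod.cong refl nn_integral_normal_scaled A) simp
  finally show ?thesis .
qed

lemma wiener_increment_coordinate:
  fixes W :: "real \<Rightarrow> 'a \<Rightarrow> real^'r"
  assumes W: "std_wiener M W" and s: "0 \<le> s" "s < t"
  shows "distr M borel (\<lambda>\<omega>. (W t \<omega> - W s \<omega>) $ a / sqrt (t - s)) = std_normal_distribution"
proof (rule measure_eqI)
  interpret std: prob_space std_normal_distribution by (rule prob_space_std_normal)
  have [measurable]: "W t \<in> borel_measurable M" "W s \<in> borel_measurable M"
    using W s by (auto simp: std_wiener_def)
  fix A assume "A \<in> sets (distr M borel (\<lambda>\<omega>. (W t \<omega> - W s \<omega>) $ a / sqrt (t - s)))"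
  then have A[measurable]: "A \<in> sets borel" by simp
  define A' where "A' i = (if i = a then A else UNIV)" for i
  have "emeasure M {\<omega>\<in>space M. \<forall>i. (W t \<omega> - W s \<omega>) $ i / sqrt (t - s) \<in> A' i} =
    (\<Prod>i\<in>UNIV. emeasure std_normal_distribution (A' i))"
    by (rule wiener_increment_rectangle[OF W s]) (simp add: A'_def)
  also have "\<dots> = (\<Prod>i\<in>UNIV. if i = a then emeasure std_normal_distribution A else 1)"
    using std.emeasure_space_1 by (intro prod.cong) (auto simp: A'_def)
  also have "\<dots> = emeasure std_normal_distribution A" by simp
  also have "{\<omega>\<in>space M. \<forall>i. (W t \<omega> - W s \<omega>) $ i / sqrt (t - s) \<in> A' i} =
      (\<lambda>\<omega>. (W t \<omega> - W s \<omega>) $ a / sqrt (t - s)) -` A \<inter> space M"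
    by (auto simp: A'_def split: if_splits)
  finally show "emeasure (distr M borel (\<lambda>\<omega>. (W t \<omega> - W s \<omega>) $ a / sqrt (t - s))) A =
      emeasure std_normal_distribution A"
    by (subst emeasure_distr) measurable
qed simp

lemma nn_integral_std_normal_square: "(\<integral>\<^sup>+x. ennreal (x\<^sup>2) \<partial>std_normal_distribution) = 1"
  using std_normal_distribution_even_moments[of 1]
  by (subst nn_integral_eq_integral) auto

lemma nn_integral_wiener_increment:
  fixes W :: "real \<Rightarrow> 'a \<Rightarrow> real^'r"
  assumes W: "std_wiener M W" and s: "0 \<le> s" "s < t"
  shows "msq M (\<lambda>\<omega>. W t \<omega> - W s \<omega>) = ennreal (real CARD('r) * (t - s))"
proof -
  have [measurable]: "W t \<in> borel_measurable M" "W s \<in> borel_measurable M"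
    using W s by (auto simp: std_wiener_def)
  have sq: "(norm (W t \<omega> - W s \<omega>))\<^sup>2 = (\<Sum>a\<in>UNIV. (t - s) * ((W t \<omega> - W s \<omega>) $ a / sqrt (t - s))\<^sup>2)" for \<omega>
    unfolding power2_norm_eq_inner using s by (simp add: inner_vec_def power_divide power2_eq_square)
  have "msq M (\<lambda>\<omega>. W t \<omega> - W s \<omega>) =
      (\<integral>\<^sup>+\<omega>. (\<Sum>a\<in>UNIV. ennreal (t - s) * ennreal (((W t \<omega> - W s \<omega>) $ a / sqrt (t - s))\<^sup>2)) \<partial>M)"
    unfolding sq using s by (simp add: ennreal_mult[symmetric])
  also have "\<dots> = (\<Sum>a\<in>UNIV. ennreal (t - s) * (\<integral>\<^sup>+\<omega>. ennreal (((W t \<omega> - W s \<omega>) $ a / sqrt (t - s))\<^sup>2) \<partial>M))"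
    by (subst nn_integral_sum) (auto simp: nn_integral_cmult simp del: vector_minus_component)
  also have "\<dots> = (\<Sum>a\<in>(UNIV::'r set). ennreal (t - s) * 1)"
  proof (intro sum.cong refl arg_cong2[where f="(*)"])
    fix a
    have "(\<integral>\<^sup>+\<omega>. ennreal (((W t \<omega> - W s \<omega>) $ a / sqrt (t - s))\<^sup>2) \<partial>M) =
        (\<integral>\<^sup>+x. ennreal (x\<^sup>2) \<partial>distr M borel (\<lambda>\<omega>. (W t \<omega> - W s \<omega>) $ a / sqrt (t - s)))"
      by (subst nn_integral_distr) measurable
    then show "(\<integral>\<^sup>+\<omega>. ennreal (((W t \<omega> - W s \<omega>) $ a / sqrt (t - s))\<^sup>2) \<partial>M) = 1"
      unfolding wiener_increment_coordinate[OF W s] by (simp add: nn_integral_std_normal_square)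
  qed
  also have "\<dots> = ennreal (real CARD('r) * (t - s))"
    using s by (simp add: ennreal_of_nat_eq_real_of_nat ennreal_mult)
  finally show ?thesis .
qed

text \<open>A replacement for Minkowski's inequality: constants do not matter, and with non-negative
  integrals no integrability has to be carried along.\<close>

lemma nn_integral_norm_add_le:
  fixes f g :: "'a \<Rightarrow> 'b::euclidean_space"
  assumes [measurable]: "f \<in> borel_measurable M" "g \<in> borel_measurable M"
    and f: "msq M f \<le> ennreal a" and g: "msq M g \<le> ennreal b"
    and "0 \<le> a" "0 \<le> b"
  shows "msq M (\<lambda>\<omega>. f \<omega> + g \<omega>) \<le> ennreal (2 * a + 2 * b)"
proof -
  have "(norm (f \<omega> + g \<omega>))\<^sup>2 \<le> 2 * (norm (f \<omega>))\<^sup>2 + 2 * (norm (g \<omega>))\<^sup>2" for \<omega>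
  proof -
    have "(norm (f \<omega> + g \<omega>))\<^sup>2 \<le> (norm (f \<omega>) + norm (g \<omega>))\<^sup>2"
      by (intro power_mono norm_triangle_ineq) simp
    also have "\<dots> \<le> 2 * (norm (f \<omega>))\<^sup>2 + 2 * (norm (g \<omega>))\<^sup>2"
      using sum_squares_bound[of "norm (f \<omega>)" "norm (g \<omega>)"] by (simp add: power2_sum)
    finally show ?thesis .
  qed
  then have "msq M (\<lambda>\<omega>. f \<omega> + g \<omega>) \<le>
      (\<integral>\<^sup>+\<omega>. 2 * ennreal ((norm (f \<omega>))\<^sup>2) + 2 * ennreal ((norm (g \<omega>))\<^sup>2) \<partial>M)"
    by (intro nn_integral_mono) (simp add: ennreal_mult'[symmetric] ennreal_plus[symmetric] ennreal_leI
        ennreal_numeral[symmetric] del: ennreal_plus ennreal_numeral)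
  also have "\<dots> = 2 * msq M f + 2 * msq M g"
    by (simp add: nn_integral_add nn_integral_cmult)
  also have "\<dots> \<le> 2 * ennreal a + 2 * ennreal b"
    by (intro add_mono mult_left_mono f g) auto
  also have "\<dots> = ennreal (2 * a + 2 * b)"
    using assms(5,6) by (simp add: ennreal_mult'[symmetric] ennreal_plus[symmetric] ennreal_numeral[symmetric] del: ennreal_plus ennreal_numeral)
  finally show ?thesis .
qed

lemma nn_integral_norm_le:
  fixes f :: "'a \<Rightarrow> 'b::euclidean_space" and g :: "'a \<Rightarrow> 'c::euclidean_space"
  assumes [measurable]: "f \<in> borel_measurable M" and le: "\<And>\<omega>. \<omega> \<in> space M \<Longrightarrow> norm (g \<omega>) \<le> c * norm (f \<omega>)"
    and f: "msq M f \<le> ennreal a"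
  shows "msq M g \<le> ennreal (c\<^sup>2 * a)"
proof -
  have "msq M g \<le> (\<integral>\<^sup>+\<omega>. ennreal (c\<^sup>2) * ennreal ((norm (f \<omega>))\<^sup>2) \<partial>M)"
  proof (intro nn_integral_mono)
    fix \<omega> assume "\<omega> \<in> space M"
    then have "(norm (g \<omega>))\<^sup>2 \<le> (c * norm (f \<omega>))\<^sup>2" by (intro power_mono le) auto
    then show "ennreal ((norm (g \<omega>))\<^sup>2) \<le> ennreal (c\<^sup>2) * ennreal ((norm (f \<omega>))\<^sup>2)"
      by (simp add: power_mult_distrib ennreal_mult[symmetric] ennreal_leI)
  qed
  also have "\<dots> = ennreal (c\<^sup>2) * msq M f"
    by (rule nn_integral_cmult) measurable
  also have "\<dots> \<le> ennreal (c\<^sup>2) * ennreal a" by (intro mult_left_mono f) simp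
  also have "\<dots> = ennreal (c\<^sup>2 * a)" by (simp add: ennreal_mult')
  finally show ?thesis .
qed

text \<open>This is all that is needed about the drift: over a step of length \<open>h\<close> it contributes \<open>h \<beta>\<close> with \<open>\<beta>\<close>
  known at the start of the step, up to an error of order \<open>h\<^sup>3\<close> in mean square.\<close>

abbreviation drift_step ::
  "'a measure \<Rightarrow> (real \<Rightarrow> 'a measure) \<Rightarrow> (real \<Rightarrow> 'a \<Rightarrow> 'b::euclidean_space) \<Rightarrow> (real \<Rightarrow> 'a \<Rightarrow> 'b) \<Rightarrow> real \<Rightarrow> real \<Rightarrow> bool" where
  "drift_step M F N X C s \<equiv> \<exists>\<beta>\<in>borel_measurable (F s). msq M \<beta> \<le> ennreal C \<and>
     (\<forall>h. 0 < h \<longrightarrow> h \<le> 1 \<longrightarrow>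
        msq M (\<lambda>\<omega>. X (s + h) \<omega> - X s \<omega> - h *\<^sub>R \<beta> \<omega> - (N (s + h) \<omega> - N s \<omega>)) \<le> ennreal (C * h ^ 3))"

text \<open>\<open>N\<close> is the noise part of \<open>X\<close>. One constant serves all starting
  times, so the errors of n steps can be added. No equation is mentioned, hence the property is
  stable under sums and linear maps, and the observed process inherits it from the latent
  ones.\<close>

definition ito_increments ::
  "'a measure \<Rightarrow> (real \<Rightarrow> 'a measure) \<Rightarrow> (real \<Rightarrow> 'a \<Rightarrow> 'b::euclidean_space) \<Rightarrow> (real \<Rightarrow> 'a \<Rightarrow> 'b) \<Rightarrow> bool" where
  "ito_increments M F N X \<longleftrightarrow>
     (\<forall>t\<ge>0. subalgebra M (F t) \<and> N t \<in> borel_measurable M \<and> X t \<in> borel_measurable M) \<and>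
     (\<exists>C\<ge>0. \<forall>s\<ge>0. drift_step M F N X C s)"

lemma ito_increments_add:
  assumes X: "ito_increments M F N X" and X': "ito_increments M F N' X'"
  shows "ito_increments M F (\<lambda>t \<omega>. N t \<omega> + N' t \<omega>) (\<lambda>t \<omega>. X t \<omega> + X' t \<omega>)"
proof -
  have meas: "subalgebra M (F t)" "N t \<in> borel_measurable M" "X t \<in> borel_measurable M"
    "N' t \<in> borel_measurable M" "X' t \<in> borel_measurable M" if "0 \<le> t" for t
    using X X' that unfolding ito_increments_def by auto
  obtain C where C: "0 \<le> C" "\<And>s. 0 \<le> s \<Longrightarrow> drift_step M F N X C s"
    using X unfolding ito_increments_def by blast
  obtain C' where C': "0 \<le> C'" "\<And>s. 0 \<le> s \<Longrightarrow> drift_step M F N' X' C' s"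
    using X' unfolding ito_increments_def by blast
  have "drift_step M F (\<lambda>t \<omega>. N t \<omega> + N' t \<omega>) (\<lambda>t \<omega>. X t \<omega> + X' t \<omega>) (2 * C + 2 * C') s"
    if s: "0 \<le> s" for s
  proof -
    obtain \<beta> where \<beta>: "\<beta> \<in> borel_measurable (F s)" "msq M \<beta> \<le> ennreal C"
      "\<And>h. 0 < h \<Longrightarrow> h \<le> 1 \<Longrightarrow>
          msq M (\<lambda>\<omega>. X (s + h) \<omega> - X s \<omega> - h *\<^sub>R \<beta> \<omega> - (N (s + h) \<omega> - N s \<omega>)) \<le> ennreal (C * h ^ 3)"
      using C(2)[OF s] by blast
    obtain \<beta>' where \<beta>': "\<beta>' \<in> borel_measurable (F s)" "msq M \<beta>' \<le> ennreal C'"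
      "\<And>h. 0 < h \<Longrightarrow> h \<le> 1 \<Longrightarrow>
          msq M (\<lambda>\<omega>. X' (s + h) \<omega> - X' s \<omega> - h *\<^sub>R \<beta>' \<omega> - (N' (s + h) \<omega> - N' s \<omega>)) \<le> ennreal (C' * h ^ 3)"
      using C'(2)[OF s] by blast
    note [measurable] = \<beta>(1) \<beta>'(1) measurable_from_subalg[OF meas(1)[OF s] \<beta>(1)]
      measurable_from_subalg[OF meas(1)[OF s] \<beta>'(1)]
    show ?thesis
    proof (intro bexI[of _ "\<lambda>\<omega>. \<beta> \<omega> + \<beta>' \<omega>"] conjI allI impI)
      show "msq M (\<lambda>\<omega>. \<beta> \<omega> + \<beta>' \<omega>) \<le> ennreal (2 * C + 2 * C')"
        using \<beta>(2) \<beta>'(2) C(1) C'(1) by (intro nn_integral_norm_add_le) auto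
      fix h :: real assume h: "0 < h" "h \<le> 1"
      have [measurable]: "N s \<in> borel_measurable M" "X s \<in> borel_measurable M" "N' s \<in> borel_measurable M" "X' s \<in> borel_measurable M"
        "N (s + h) \<in> borel_measurable M" "X (s + h) \<in> borel_measurable M" "N' (s + h) \<in> borel_measurable M" "X' (s + h) \<in> borel_measurable M"
        using meas s h by auto
      have "msq M (\<lambda>\<omega>. (X (s + h) \<omega> - X s \<omega> - h *\<^sub>R \<beta> \<omega> - (N (s + h) \<omega> - N s \<omega>)) +
          (X' (s + h) \<omega> - X' s \<omega> - h *\<^sub>R \<beta>' \<omega> - (N' (s + h) \<omega> - N' s \<omega>)))
          \<le> ennreal (2 * (C * h ^ 3) + 2 * (C' * h ^ 3))"
        using \<beta>(3)[OF h] \<beta>'(3)[OF h] C(1) C'(1) h by (intro nn_integral_norm_add_le) auto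
      then show "msq M (\<lambda>\<omega>. (X (s + h) \<omega> + X' (s + h) \<omega>) - (X s \<omega> + X' s \<omega>) - h *\<^sub>R (\<beta> \<omega> + \<beta>' \<omega>) -
             ((N (s + h) \<omega> + N' (s + h) \<omega>) - (N s \<omega> + N' s \<omega>))) \<le> ennreal ((2 * C + 2 * C') * h ^ 3)"
        by (simp add: algebra_simps)
    qed measurable
  qed
  moreover have "0 \<le> 2 * C + 2 * C'" using C C' by simp
  ultimately show ?thesis
    unfolding ito_increments_def using meas by (intro conjI exI[of _ "2 * C + 2 * C'"]) auto
qed

lemma ito_increments_linear:
  assumes T: "bounded_linear T" and X: "ito_increments M F N X"
  shows "ito_increments M F (\<lambda>t \<omega>. T (N t \<omega>)) (\<lambda>t \<omega>. T (X t \<omega>))"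
proof -
  interpret T: bounded_linear T by fact
  have [measurable]: "T \<in> borel_measurable borel"
    by (intro borel_measurable_continuous_onI linear_continuous_on T)
  have meas: "subalgebra M (F t)" "N t \<in> borel_measurable M" "X t \<in> borel_measurable M" if "0 \<le> t" for t
    using X that unfolding ito_increments_def by auto
  obtain k where k: "0 \<le> k" "\<And>x. norm (T x) \<le> k * norm x"
    using T.nonneg_bounded by (auto simp: mult.commute)
  obtain C where C: "0 \<le> C" "\<And>s. 0 \<le> s \<Longrightarrow> drift_step M F N X C s"
    using X unfolding ito_increments_def by blast
  have "drift_step M F (\<lambda>t \<omega>. T (N t \<omega>)) (\<lambda>t \<omega>. T (X t \<omega>)) (k\<^sup>2 * C) s"
    if s: "0 \<le> s" for s
  proof -
    obtain \<beta> where \<beta>: "\<beta> \<in> borel_measurable (F s)" "msq M \<beta> \<le> ennreal C"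
      "\<And>h. 0 < h \<Longrightarrow> h \<le> 1 \<Longrightarrow>
          msq M (\<lambda>\<omega>. X (s + h) \<omega> - X s \<omega> - h *\<^sub>R \<beta> \<omega> - (N (s + h) \<omega> - N s \<omega>)) \<le> ennreal (C * h ^ 3)"
      using C(2)[OF s] by blast
    note [measurable] = \<beta>(1) measurable_from_subalg[OF meas(1)[OF s] \<beta>(1)]
    show ?thesis
    proof (intro bexI[of _ "\<lambda>\<omega>. T (\<beta> \<omega>)"] conjI allI impI)
      show "msq M (\<lambda>\<omega>. T (\<beta> \<omega>)) \<le> ennreal (k\<^sup>2 * C)"
        by (rule nn_integral_norm_le[OF _ k(2) \<beta>(2)]) measurable
      fix h :: real assume h: "0 < h" "h \<le> 1"
      have [measurable]: "N s \<in> borel_measurable M" "X s \<in> borel_measurable M"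
        "N (s + h) \<in> borel_measurable M" "X (s + h) \<in> borel_measurable M"
        using meas s h by auto
      have "msq M (\<lambda>\<omega>. T (X (s + h) \<omega> - X s \<omega> - h *\<^sub>R \<beta> \<omega> - (N (s + h) \<omega> - N s \<omega>))) \<le> ennreal (k\<^sup>2 * (C * h ^ 3))"
        by (rule nn_integral_norm_le[OF _ k(2) \<beta>(3)[OF h]]) measurable
      then show "msq M (\<lambda>\<omega>. T (X (s + h) \<omega>) - T (X s \<omega>) - h *\<^sub>R T (\<beta> \<omega>) - (T (N (s + h) \<omega>) - T (N s \<omega>)))
             \<le> ennreal (k\<^sup>2 * C * h ^ 3)"
        by (simp add: T.diff T.scaleR mult.assoc)
    qed measurable
  qed
  moreover have "0 \<le> k\<^sup>2 * C" using C by simp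
  ultimately show ?thesis
    unfolding ito_increments_def using meas by (intro conjI exI[of _ "k\<^sup>2 * C"]) auto
qed

text \<open>Each diffusion is first treated with the past of its own Wiener process; adding the four
  requires one common filtration.\<close>

lemma ito_increments_mono:
  assumes X: "ito_increments M F N X" and G: "\<And>t. 0 \<le> t \<Longrightarrow> subalgebra M (G t)" "\<And>t. 0 \<le> t \<Longrightarrow> subalgebra (G t) (F t)"
  shows "ito_increments M G N X"
proof -
  obtain C where C: "0 \<le> C" "\<And>s. 0 \<le> s \<Longrightarrow> drift_step M F N X C s"
    using X unfolding ito_increments_def by blast
  show ?thesis
    unfolding ito_increments_def
  proof (intro conjI exI[of _ C] allI impI)
    fix s :: real assume s: "0 \<le> s"
    show "drift_step M G N X C s"
      using C(2)[OF s] measurable_from_subalg[OF G(2)[OF s]] by (elim bexE) (rule bexI)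
  qed (use X G(1) C(1) in \<open>simp_all add: ito_increments_def\<close>)
qed

text \<open>Generated by the Wiener process, not by the diffusion: this is the \<sigma>-algebra that
  \<open>std_wiener\<close> makes independent of the next increment.\<close>

definition past :: "'a measure \<Rightarrow> (real \<Rightarrow> 'a \<Rightarrow> real^'d) \<Rightarrow> real \<Rightarrow> 'a measure" where
  "past M W s = sigma (space M) (generated_sigma M {0..s} W)"

lemma generated_sigma_Pow: "generated_sigma M I W \<subseteq> Pow (space M)"
  unfolding generated_sigma_def by (rule sigma_sets_into_sp[THEN subsetI[of _ "Pow _", OF PowI], rotated]) auto

lemma sigma_sets_generated_sigma:
  "sigma_sets (space M) (generated_sigma M I W) = generated_sigma M I W"
  unfolding generated_sigma_def by (rule sigma_sets_sigma_sets_eq) auto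

lemma space_past [simp]: "space (past M W s) = space M"
  unfolding past_def by (rule space_measure_of) (rule generated_sigma_Pow)

lemma sets_past: "sets (past M W s) = generated_sigma M {0..s} W"
proof -
  have "sets (past M W s) = sigma_sets (space M) (generated_sigma M {0..s} W)"
    unfolding past_def by (rule sets_measure_of) (rule generated_sigma_Pow)
  then show ?thesis by (simp only: sigma_sets_generated_sigma)
qed

lemma past_measurable:
  fixes W :: "real \<Rightarrow> 'a \<Rightarrow> real^'d"
  assumes "u \<in> {0..s}" shows "W u \<in> borel_measurable (past M W s)"
proof (rule measurableI)
  fix A :: "(real^'d) set" assume "A \<in> sets borel"
  then have "W u -` A \<inter> space M \<in> generated_sigma M {0..s} W"
    using assms unfolding generated_sigma_def by (intro sigma_sets.Basic) blast
  then show "W u -` A \<inter> space (past M W s) \<in> sets (past M W s)"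
    by (simp add: sets_past)
qed simp

lemma generated_sigma_events:
  assumes "\<And>t. t \<in> I \<Longrightarrow> W t \<in> borel_measurable M"
  shows "generated_sigma M I W \<subseteq> sets M"
  unfolding generated_sigma_def by (rule sets.sigma_sets_subset) (use assms measurable_sets in blast)

lemma subalgebra_past:
  assumes "std_wiener M W" shows "subalgebra M (past M W s)"
  unfolding subalgebra_def sets_past using generated_sigma_events[of "{0..s}" W M] assms
  by (simp add: std_wiener_def)

text \<open>With \<beta> the drift at the start of the step, the error is the integral of B (Y u) -
  B (Y s). Its mean square is at most h^2 times a bound for that of the integrand, which is of order
  h because \<open>B\<close> is Lipschitz and \<open>Y\<close> moves by sqrt h in mean square;
  together h^3.\<close>

lemma ito_increments_sde:
  fixes W :: "real \<Rightarrow> 'a \<Rightarrow> real^'r" and Y :: "real \<Rightarrow> 'a \<Rightarrow> real^'d"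
  assumes M: "prob_space M" and W: "std_wiener M W" and sde: "sde_solution M W B S y0 Y"
    and L: "L-lipschitz_on UNIV B" and mom: "bounded_moments M Y"
  shows "ito_increments M (past M W) (\<lambda>t \<omega>. S *v W t \<omega>) Y"
proof -
  interpret prob_space M by fact
  have Ym[measurable]: "Y t \<in> borel_measurable M" if "0 \<le> t" for t
    using sde that by (simp add: sde_solution_def)
  have Yc: "continuous_on {0..} (\<lambda>t. Y t \<omega>)" if "\<omega> \<in> space M" for \<omega>
    using sde that by (simp add: sde_solution_def)
  have Ye: "AE \<omega> in M. \<forall>t\<ge>0. Y t \<omega> = y0 + integral {0..t} (\<lambda>s. B (Y s \<omega>)) + S *v W t \<omega>"
    using sde by (simp add: sde_solution_def)
  have Wm[measurable]: "W t \<in> borel_measurable M" if "0 \<le> t" for t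
    using W that by (simp add: std_wiener_def)
  have L0: "0 \<le> L" using L lipschitz_on_nonneg by blast
  have Bc: "continuous_on UNIV B" using L lipschitz_on_continuous_on by blast
  then have Bm[measurable]: "B \<in> borel_measurable borel" by (rule borel_measurable_continuous_onI)
  have BL: "norm (B x - B y) \<le> L * norm (x - y)" for x y
    using lipschitz_onD[OF L, of x y] by (simp add: dist_norm)
  have lin: "bounded_linear ((*v) S)" by simp
  then have Sm[measurable]: "(*v) S \<in> borel_measurable borel"
    by (intro borel_measurable_continuous_onI linear_continuous_on)
  obtain k where k: "0 \<le> k" "\<And>x. norm (S *v x) \<le> k * norm x"
    using bounded_linear.nonneg_bounded[OF lin] by (auto simp: mult.commute)
  obtain C where C: "0 \<le> C" "\<And>t. 0 \<le> t \<Longrightarrow> msq M (Y t) \<le> ennreal C"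
  proof -
    define G where "G = (SUP t\<in>{0..}. \<integral>\<^sup>+\<omega>. ennreal (norm (Y t \<omega>) powr 2) \<partial>M)"
    have "G < \<infinity>"
      unfolding G_def using mom[unfolded bounded_moments_def, rule_format, of 2] by simp
    then obtain C where C: "0 \<le> C" "G = ennreal C"
      by (cases G) auto
    have "msq M (Y t) \<le> ennreal C" if "0 \<le> t" for t
      unfolding C(2)[symmetric] G_def using that by (intro SUP_upper2[of t]) (auto simp: powr_numeral)
    with C(1) that show ?thesis by blast
  qed
  define C1 where "C1 = 2 * (norm (B 0))\<^sup>2 + 2 * (L\<^sup>2 * C)"
  have C1: "0 \<le> C1" using C by (simp add: C1_def)
  have BY: "msq M (\<lambda>\<omega>. B (Y t \<omega>)) \<le> ennreal C1" if t: "0 \<le> t" for t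
  proof -
    have [measurable]: "Y t \<in> borel_measurable M" using t by measurable
    have "msq M (\<lambda>\<omega>. B (Y t \<omega>) - B 0) \<le> ennreal (L\<^sup>2 * C)"
      by (rule nn_integral_norm_le[OF _ _ C(2)[OF t]]) (use BL[of _ 0] in auto)
    then have "msq M (\<lambda>\<omega>. B 0 + (B (Y t \<omega>) - B 0)) \<le> ennreal C1"
      unfolding C1_def using C(1) by (intro nn_integral_norm_add_le) (auto simp: emeasure_space_1)
    then show ?thesis by simp
  qed
  have BYc: "continuous_on {s..s + h} (\<lambda>u. B (Y u \<omega>))" if "0 \<le> s" "\<omega> \<in> space M" for s h \<omega>
    by (intro continuous_on_compose2[OF Bc] continuous_on_subset[OF Yc[OF that(2)]]) (use that in auto)
  have inc: "AE \<omega> in M. Y (s + h) \<omega> - Y s \<omega> = integral {s..s + h} (\<lambda>u. B (Y u \<omega>)) + (S *v W (s + h) \<omega> - S *v W s \<omega>)"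
    if s: "0 \<le> s" "0 \<le> h" for s h
    using Ye AE_space
  proof eventually_elim
    case (elim \<omega>)
    have "integral {0..s} (\<lambda>u. B (Y u \<omega>)) + integral {s..s + h} (\<lambda>u. B (Y u \<omega>)) = integral {0..s + h} (\<lambda>u. B (Y u \<omega>))"
      using s BYc[of 0 \<omega> "s + h"] elim(2)
      by (intro Henstock_Kurzweil_Integration.integral_combine integrable_continuous_real) auto
    then show ?case using elim(1) s by (simp add: algebra_simps)
  qed
  \<comment> \<open>An increment over g has mean square of order g^2 from the drift and g from the
    noise; for steps of length at most 1 both are of order g.\<close>
  define C2 where "C2 = 2 * C1 + 2 * (k\<^sup>2 * real CARD('r))"
  have C2: "0 \<le> C2" using C1 by (simp add: C2_def)
  have Yinc: "msq M (\<lambda>\<omega>. Y u \<omega> - Y s \<omega>) \<le> ennreal (C2 * h)"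
    if s: "0 \<le> s" "u \<in> {s..s + h}" "h \<le> 1" for s u h
  proof (cases "u = s")
    case False
    define g where "g = u - s"
    have g: "0 < g" "g \<le> h" "g \<le> 1" and u: "u = s + g" using s False by (auto simp: g_def)
    have [measurable]: "W s \<in> borel_measurable M" "W (s + g) \<in> borel_measurable M" using s g by auto
    have "(\<lambda>\<omega>. integral {s..s + g} (\<lambda>v. B (Y v \<omega>))) \<in> borel_measurable M"
      by (rule path_integral_L2(1)[OF _ _ BYc[OF s(1)] BY C1]) (use s g in auto)
    moreover have "msq M (\<lambda>\<omega>. integral {s..s + g} (\<lambda>v. B (Y v \<omega>))) \<le> ennreal (g\<^sup>2 * C1)"
      by (rule path_integral_L2(2)[OF _ _ BYc[OF s(1)] BY C1]) (use s g in auto)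
    moreover have "msq M (\<lambda>\<omega>. S *v W (s + g) \<omega> - S *v W s \<omega>) \<le> ennreal (k\<^sup>2 * (real CARD('r) * g))"
    proof (rule nn_integral_norm_le)
      show "msq M (\<lambda>\<omega>. W (s + g) \<omega> - W s \<omega>) \<le> ennreal (real CARD('r) * g)"
        using nn_integral_wiener_increment[OF W s(1), of "s + g"] g by simp
    qed (use k(2) in \<open>auto simp: matrix_vector_mult_diff_distrib[symmetric]\<close>)
    ultimately have "msq M (\<lambda>\<omega>. integral {s..s + g} (\<lambda>v. B (Y v \<omega>)) + (S *v W (s + g) \<omega> - S *v W s \<omega>))
        \<le> ennreal (2 * (g\<^sup>2 * C1) + 2 * (k\<^sup>2 * (real CARD('r) * g)))"
      using C1 g by (intro nn_integral_norm_add_le) auto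
    also have "msq M (\<lambda>\<omega>. integral {s..s + g} (\<lambda>v. B (Y v \<omega>)) + (S *v W (s + g) \<omega> - S *v W s \<omega>)) =
        msq M (\<lambda>\<omega>. Y u \<omega> - Y s \<omega>)"
      using inc[OF s(1), of g] g by (intro nn_integral_cong_AE) (auto simp: u)
    also have "2 * (g\<^sup>2 * C1) + 2 * (k\<^sup>2 * (real CARD('r) * g)) \<le> C2 * h"
    proof -
      have "g\<^sup>2 * C1 \<le> g * C1" using g C1 by (intro mult_right_mono) (auto simp: power2_eq_square mult_left_le)
      then have "2 * (g\<^sup>2 * C1) + 2 * (k\<^sup>2 * (real CARD('r) * g)) \<le> C2 * g"
        by (simp add: C2_def algebra_simps)
      also have "\<dots> \<le> C2 * h" using C2 g by (intro mult_left_mono) auto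
      finally show ?thesis .
    qed
    finally show ?thesis by (simp add: ennreal_leI)
  qed simp
  \<comment> \<open>The equation holds almost everywhere only, so \<open>Y s\<close> itself need not
    be measurable for the past; a version \<open>Z\<close> takes its place.\<close>
  have adapted: "\<exists>Z\<in>borel_measurable (past M W s). AE \<omega> in M. Y s \<omega> = Z \<omega>" if s: "0 \<le> s" for s
  proof -
    define e where "e N \<omega> = euler B (\<lambda>j. y0 + S *v W (real j * (s / real N)) \<omega>) (s / real N) N" for N \<omega>
    have e[measurable]: "e N \<in> borel_measurable (past M W s)" for N
      unfolding e_def
    proof (rule euler_measurable[OF Bm])
      fix j assume "j \<le> N"
      then have "real j * (s / real N) \<le> real N * (s / real N)" using s by (intro mult_right_mono) auto
      \<comment> \<open>For \<open>N = 0\<close> the mesh \<open>s / 0\<close> is 0, and the point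
        still lies in the interval.\<close>
      then have "real j * (s / real N) \<in> {0..s}" using s by (cases "N = 0") auto
      from past_measurable[OF this, of W M] Sm
      show "(\<lambda>\<omega>. y0 + S *v W (real j * (s / real N)) \<omega>) \<in> borel_measurable (past M W s)"
        by measurable
    qed
    have "AE \<omega> in M. Y s \<omega> = lim (\<lambda>N. e N \<omega>)"
      using Ye AE_space
    proof eventually_elim
      case (elim \<omega>)
      have "(\<lambda>N. e N \<omega>) \<longlonglongrightarrow> Y s \<omega>"
        unfolding e_def
        by (rule euler_tendsto[OF L, of s "\<lambda>s. Y s \<omega>" "\<lambda>s. y0 + S *v W s \<omega>"])
          (use elim s in \<open>auto intro: continuous_on_subset[OF Yc]\<close>)
      then show ?case by (simp add: limI)
    qed
    then show ?thesis by (intro bexI[of _ "\<lambda>\<omega>. lim (\<lambda>N. e N \<omega>)"]) auto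
  qed
  define C3 where "C3 = C1 + L\<^sup>2 * C2"
  have C3: "0 \<le> C3" using C1 C2 by (simp add: C3_def)
  have "drift_step M (past M W) (\<lambda>t \<omega>. S *v W t \<omega>) Y C3 s"
    if s: "0 \<le> s" for s
  proof -
    obtain Z where Z[measurable]: "Z \<in> borel_measurable (past M W s)" and YZ: "AE \<omega> in M. Y s \<omega> = Z \<omega>"
      using adapted[OF s] by blast
    have [measurable]: "Y s \<in> borel_measurable M" using s by measurable
    show ?thesis
    proof (intro bexI[of _ "\<lambda>\<omega>. B (Z \<omega>)"] conjI allI impI)
      have "msq M (\<lambda>\<omega>. B (Z \<omega>)) = msq M (\<lambda>\<omega>. B (Y s \<omega>))"
        using YZ by (intro nn_integral_cong_AE) auto
      also have "\<dots> \<le> ennreal C3"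
        by (rule order_trans[OF BY[OF s]]) (use C2 in \<open>simp add: C3_def ennreal_leI\<close>)
      finally show "msq M (\<lambda>\<omega>. B (Z \<omega>)) \<le> ennreal C3" .
      fix h :: real assume h: "0 < h" "h \<le> 1"
      have "msq M (\<lambda>\<omega>. Y (s + h) \<omega> - Y s \<omega> - h *\<^sub>R B (Z \<omega>) - (S *v W (s + h) \<omega> - S *v W s \<omega>)) =
          msq M (\<lambda>\<omega>. integral {s..s + h} (\<lambda>u. B (Y u \<omega>) - B (Y s \<omega>)))"
      proof (intro nn_integral_cong_AE)
        show "AE \<omega> in M. ennreal ((norm (Y (s + h) \<omega> - Y s \<omega> - h *\<^sub>R B (Z \<omega>) - (S *v W (s + h) \<omega> - S *v W s \<omega>)))\<^sup>2) =
            ennreal ((norm (integral {s..s + h} (\<lambda>u. B (Y u \<omega>) - B (Y s \<omega>))))\<^sup>2)"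
          using inc[OF s less_imp_le[OF h(1)]] YZ AE_space
        proof eventually_elim
          case (elim \<omega>)
          have "integral {s..s + h} (\<lambda>u. B (Y u \<omega>) - B (Y s \<omega>)) = integral {s..s + h} (\<lambda>u. B (Y u \<omega>)) - h *\<^sub>R B (Y s \<omega>)"
            using BYc[OF s elim(3)] h by (subst integral_diff) (auto intro: integrable_continuous_real)
          then show ?case using elim by simp
        qed
      qed
      also have "\<dots> \<le> ennreal (h\<^sup>2 * (L\<^sup>2 * (C2 * h)))"
      proof (rule path_integral_L2(2))
        fix u assume u: "u \<in> {s..s + h}"
        then have [measurable]: "Y u \<in> borel_measurable M" using s by auto
        show "(\<lambda>\<omega>. B (Y u \<omega>) - B (Y s \<omega>)) \<in> borel_measurable M" by measurable
        show "msq M (\<lambda>\<omega>. B (Y u \<omega>) - B (Y s \<omega>)) \<le> ennreal (L\<^sup>2 * (C2 * h))"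
          by (rule nn_integral_norm_le[OF _ _ Yinc[OF s u h(2)]]) (use BL in auto)
      qed (use h C2 BYc[OF s] in \<open>auto intro!: continuous_intros\<close>)
      also have "\<dots> \<le> ennreal (C3 * h ^ 3)"
        using C1 h by (intro ennreal_leI) (simp add: C3_def power2_eq_square power3_eq_cube algebra_simps)
      finally show "msq M (\<lambda>\<omega>. Y (s + h) \<omega> - Y s \<omega> - h *\<^sub>R B (Z \<omega>) - (S *v W (s + h) \<omega> - S *v W s \<omega>)) \<le> ennreal (C3 * h ^ 3)" .
    qed measurable
  qed
  moreover have "subalgebra M (past M W t) \<and> (\<lambda>\<omega>. S *v W t \<omega>) \<in> borel_measurable M \<and> Y t \<in> borel_measurable M"
    if "0 \<le> t" for t
  proof -
    have [measurable]: "W t \<in> borel_measurable M" using that by simp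
    show ?thesis using that subalgebra_past[OF W] by simp
  qed
  ultimately show ?thesis
    unfolding ito_increments_def using C3 by blast
qed

section \<open>The joint driving noise\<close>

lemma borel_measurable_vec_iff:
  fixes f :: "'a \<Rightarrow> real^'n"
  shows "f \<in> borel_measurable M \<longleftrightarrow> (\<forall>i. (\<lambda>x. f x $ i) \<in> borel_measurable M)"
proof
  assume "\<forall>i. (\<lambda>x. f x $ i) \<in> borel_measurable M"
  then show "f \<in> borel_measurable M"
    by (subst borel_measurable_euclidean_space) (auto simp: Basis_vec_def inner_axis)
qed auto

text \<open>The classes are indexed by a flag, past or increment, and a process. Independence across
  processes comes from \<open>T\<close>, independence of past and increment from
  \<open>indep\<close>; the doubled family is therefore independent, and collecting by the flag
  gives the two joint \<sigma>-algebras.\<close>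

lemma (in prob_space) indep_past_increments:
  fixes P I T :: "'k \<Rightarrow> 'a set set"
  assumes K: "finite K" "K \<noteq> {}" and T: "indep_sets T K"
    and sub: "\<And>k. k \<in> K \<Longrightarrow> P k \<subseteq> T k" "\<And>k. k \<in> K \<Longrightarrow> I k \<subseteq> T k"
    and T_Int: "\<And>k A B. k \<in> K \<Longrightarrow> A \<in> T k \<Longrightarrow> B \<in> T k \<Longrightarrow> A \<inter> B \<in> T k"
    and space: "\<And>k. k \<in> K \<Longrightarrow> space M \<in> P k" "\<And>k. k \<in> K \<Longrightarrow> space M \<in> I k"
    and stable: "\<And>k. k \<in> K \<Longrightarrow> Int_stable (P k)" "\<And>k. k \<in> K \<Longrightarrow> Int_stable (I k)"
    and indep: "\<And>k. k \<in> K \<Longrightarrow> indep_set (P k) (I k)"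
  shows "indep_set (sigma_sets (space M) (\<Union>k\<in>K. P k)) (sigma_sets (space M) (\<Union>k\<in>K. I k))"
proof -
  define E where "E = (\<lambda>(b, k). if b then P k else I k)"
  have TM: "T k \<subseteq> events" if "k \<in> K" for k using T that by (auto simp: indep_sets_def)
  \<comment> \<open>Every class contains the whole space, so the product formula has to be checked
    for the full index set only.\<close>
  have E: "indep_sets E (UNIV \<times> K)"
  proof (subst indep_sets_finite)
    show "UNIV \<times> K \<noteq> {}" "finite ((UNIV :: bool set) \<times> K)" using K by auto
    show "E i \<subseteq> events" "space M \<in> E i" if "i \<in> UNIV \<times> K" for i
      using that sub[THEN subset_trans, OF _ TM] space by (auto simp: E_def subset_iff split: if_splits)
    show "\<forall>A\<in>Pi (UNIV \<times> K) E. prob (\<Inter>j\<in>UNIV \<times> K. A j) = (\<Prod>j\<in>UNIV \<times> K. prob (A j))"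
    proof
      fix A assume "A \<in> Pi (UNIV \<times> K) E"
      then have A: "A (True, k) \<in> P k" "A (False, k) \<in> I k" if "k \<in> K" for k
        using that by (auto simp: E_def Pi_iff split: if_splits)
      have "(\<Inter>j\<in>UNIV \<times> K. A j) = (\<Inter>k\<in>K. A (True, k) \<inter> A (False, k))"
        by (auto simp: UNIV_bool)
      also have "prob \<dots> = (\<Prod>k\<in>K. prob (A (True, k) \<inter> A (False, k)))"
        using A sub T_Int K by (intro indep_setsD[OF T]) blast+
      also have "\<dots> = (\<Prod>k\<in>K. prob (A (True, k)) * prob (A (False, k)))"
        using A indep by (intro prod.cong refl indep_setD) blast+
      also have "\<dots> = (\<Prod>k\<in>K. \<Prod>b\<in>UNIV. prob (A (b, k)))"
        by (simp add: UNIV_bool mult.commute)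
      also have "\<dots> = (\<Prod>j\<in>UNIV \<times> K. prob (A j))"
        by (subst prod.swap) (simp add: prod.cartesian_product)
      finally show "prob (\<Inter>j\<in>UNIV \<times> K. A j) = (\<Prod>j\<in>UNIV \<times> K. prob (A j))" .
    qed
  qed
  have "indep_sets (\<lambda>b. sigma_sets (space M) (\<Union>i\<in>{b} \<times> K. E i)) UNIV"
  proof (rule indep_sets_collect_sigma)
    have "(\<Union>b\<in>UNIV. {b::bool} \<times> K) = UNIV \<times> K" by auto
    with E show "indep_sets E (\<Union>b\<in>UNIV. {b} \<times> K)" by simp
    show "Int_stable (E i)" if "i \<in> {j} \<times> K" for i j
      using that stable by (auto simp: E_def)
    show "disjoint_family_on (\<lambda>b. {b} \<times> K) UNIV" by (auto simp: disjoint_family_on_def)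
  qed
  moreover have "sigma_sets (space M) (\<Union>i\<in>{b} \<times> K. E i) =
     case_bool (sigma_sets (space M) (\<Union>k\<in>K. P k)) (sigma_sets (space M) (\<Union>k\<in>K. I k)) b" for b
  proof -
    have "E (b, k) = (if b then P k else I k)" for k by (simp add: E_def)
    moreover have "(\<Union>i\<in>{b} \<times> K. E i) = (\<Union>k\<in>K. E (b, k))" by blast
    ultimately show ?thesis by (cases b) (simp_all only: if_True if_False bool.case)
  qed
  ultimately show ?thesis
    unfolding indep_set_def by (simp only:)
qed

definition increment_sets :: "'a measure \<Rightarrow> (real \<Rightarrow> 'a \<Rightarrow> real^'d) \<Rightarrow> real \<Rightarrow> real \<Rightarrow> 'a set set" where
  "increment_sets M W s t = {(\<lambda>\<omega>. W t \<omega> - W s \<omega>) -` A \<inter> space M | A. A \<in> sets borel}"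

text \<open>The interface to the noise: one filtration, independence of each increment from it, and
  the law of the normalized increment. The law is a product measure on functions, so that four
  processes can be joined coordinate by coordinate.\<close>

definition gaussian_noise :: "'a measure \<Rightarrow> (real \<Rightarrow> 'a measure) \<Rightarrow> (real \<Rightarrow> 'a \<Rightarrow> real^'r) \<Rightarrow> bool" where
  "gaussian_noise M F W \<longleftrightarrow>
     (\<forall>t\<ge>0. subalgebra M (F t) \<and> W t \<in> borel_measurable (F t)) \<and>
     (\<forall>s t. 0 \<le> s \<longrightarrow> s \<le> t \<longrightarrow> subalgebra (F t) (F s)) \<and>
     (\<forall>s t. 0 \<le> s \<longrightarrow> s < t \<longrightarrow>
        distr M (PiM UNIV (\<lambda>_. borel)) (\<lambda>\<omega> a. (W t \<omega> - W s \<omega>) $ a / sqrt (t - s)) = PiM UNIV (\<lambda>_. std_normal_distribution) \<and>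
        prob_space.indep_set M (sets (F s)) (increment_sets M W s t))"

definition joint_past :: "'a measure \<Rightarrow> (real \<Rightarrow> 'a \<Rightarrow> real^'a1) \<Rightarrow> (real \<Rightarrow> 'a \<Rightarrow> real^'a2) \<Rightarrow>
    (real \<Rightarrow> 'a \<Rightarrow> real^'a3) \<Rightarrow> (real \<Rightarrow> 'a \<Rightarrow> real^'a4) \<Rightarrow> real \<Rightarrow> 'a measure" where
  "joint_past M W1 W2 W3 W4 s = sigma (space M) (generated_sigma M {0..s} W1 \<union> generated_sigma M {0..s} W2 \<union>
     generated_sigma M {0..s} W3 \<union> generated_sigma M {0..s} W4)"

definition joint_noise :: "(real \<Rightarrow> 'a \<Rightarrow> real^'a1) \<Rightarrow> (real \<Rightarrow> 'a \<Rightarrow> real^'a2) \<Rightarrow>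
    (real \<Rightarrow> 'a \<Rightarrow> real^'a3) \<Rightarrow> (real \<Rightarrow> 'a \<Rightarrow> real^'a4) \<Rightarrow> real \<Rightarrow> 'a \<Rightarrow> real^(('a1 + 'a2) + ('a3 + 'a4))" where
  "joint_noise W1 W2 W3 W4 t \<omega> = stack_vec (stack_vec (W1 t \<omega>) (W2 t \<omega>)) (stack_vec (W3 t \<omega>) (W4 t \<omega>))"

lemma joint_noise_component [simp]:
  "joint_noise W1 W2 W3 W4 t \<omega> $ Inl (Inl a) = W1 t \<omega> $ a"
  "joint_noise W1 W2 W3 W4 t \<omega> $ Inl (Inr b) = W2 t \<omega> $ b"
  "joint_noise W1 W2 W3 W4 t \<omega> $ Inr (Inl c) = W3 t \<omega> $ c"
  "joint_noise W1 W2 W3 W4 t \<omega> $ Inr (Inr d) = W4 t \<omega> $ d"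
  by (simp_all add: joint_noise_def stack_vec_def)

lemma all_sum4: "(\<forall>x::('a + 'b) + ('c + 'd). P x) \<longleftrightarrow>
  (\<forall>a. P (Inl (Inl a))) \<and> (\<forall>b. P (Inl (Inr b))) \<and> (\<forall>c. P (Inr (Inl c))) \<and> (\<forall>d. P (Inr (Inr d)))"
  by (metis sumE)

lemma joint_past_props:
  shows space_joint_past [simp]: "space (joint_past M W1 W2 W3 W4 s) = space M"
    and sets_joint_past: "sets (joint_past M W1 W2 W3 W4 s) = sigma_sets (space M) (generated_sigma M {0..s} W1 \<union>
      generated_sigma M {0..s} W2 \<union> generated_sigma M {0..s} W3 \<union> generated_sigma M {0..s} W4)"
proof -
  have "generated_sigma M {0..s} W1 \<union> generated_sigma M {0..s} W2 \<union> generated_sigma M {0..s} W3 \<union>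
      generated_sigma M {0..s} W4 \<subseteq> Pow (space M)"
    by (intro Un_least generated_sigma_Pow)
  then show "space (joint_past M W1 W2 W3 W4 s) = space M"
    "sets (joint_past M W1 W2 W3 W4 s) = sigma_sets (space M) (generated_sigma M {0..s} W1 \<union>
      generated_sigma M {0..s} W2 \<union> generated_sigma M {0..s} W3 \<union> generated_sigma M {0..s} W4)"
    unfolding joint_past_def by (simp_all add: space_measure_of sets_measure_of)
qed

lemma subalgebra_joint_past:
  "subalgebra (joint_past M W1 W2 W3 W4 s) (past M W1 s)" "subalgebra (joint_past M W1 W2 W3 W4 s) (past M W2 s)"
  "subalgebra (joint_past M W1 W2 W3 W4 s) (past M W3 s)" "subalgebra (joint_past M W1 W2 W3 W4 s) (past M W4 s)"
  unfolding subalgebra_def by (auto simp: sets_past sets_joint_past)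

lemma generated_sigma_mono: "I \<subseteq> J \<Longrightarrow> generated_sigma M I W \<subseteq> generated_sigma M J W"
  unfolding generated_sigma_def by (rule sigma_sets_mono') blast

lemma increment_sets_props:
  fixes W :: "real \<Rightarrow> 'a \<Rightarrow> real^'d"
  assumes "0 \<le> s" "s < t"
  shows "increment_sets M W s t \<subseteq> generated_sigma M {0..} W"
    and "space M \<in> increment_sets M W s t" and "Int_stable (increment_sets M W s t)"
proof -
  define G where "G = sigma (space M) (generated_sigma M {0..} W)"
  have G: "space G = space M" "sets G = generated_sigma M {0..} W"
    unfolding G_def using generated_sigma_Pow[of M "{0..}" W]
    by (simp_all add: space_measure_of sets_measure_of sigma_sets_generated_sigma)
  have [measurable]: "W u \<in> borel_measurable G" if "0 \<le> u" for u
  proof (rule measurableI)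
    fix A :: "(real^'d) set" assume "A \<in> sets borel"
    then show "W u -` A \<inter> space G \<in> sets G"
      using that unfolding G generated_sigma_def by (intro sigma_sets.Basic) auto
  qed simp
  have inc: "(\<lambda>\<omega>. W t \<omega> - W s \<omega>) \<in> borel_measurable G"
    using assms by (intro borel_measurable_diff) auto
  show "increment_sets M W s t \<subseteq> generated_sigma M {0..} W"
    using measurable_sets[OF inc] unfolding increment_sets_def G by auto
  show "space M \<in> increment_sets M W s t"
    unfolding increment_sets_def by (intro CollectI exI[of _ UNIV]) auto
  show "Int_stable (increment_sets M W s t)"
    unfolding increment_sets_def Int_stable_def
  proof clarsimp
    fix A B :: "(real^'d) set" assume "A \<in> sets borel" "B \<in> sets borel"
    then show "\<exists>C. (\<lambda>\<omega>. W t \<omega> - W s \<omega>) -` A \<inter> space M \<inter> ((\<lambda>\<omega>. W t \<omega> - W s \<omega>) -` B \<inter> space M) =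
        (\<lambda>\<omega>. W t \<omega> - W s \<omega>) -` C \<inter> space M \<and> C \<in> sets borel"
      by (intro exI[of _ "A \<inter> B"]) auto
  qed
qed

lemma generated_sigma_Int: "A \<in> generated_sigma M I W \<Longrightarrow> B \<in> generated_sigma M I W \<Longrightarrow> A \<inter> B \<in> generated_sigma M I W"
proof -
  assume AB: "A \<in> generated_sigma M I W" "B \<in> generated_sigma M I W"
  interpret sigma_algebra "space M" "generated_sigma M I W"
    unfolding generated_sigma_def by (rule sigma_algebra_sigma_sets) auto
  show ?thesis using AB by blast
qed

lemma space_in_generated_sigma: "space M \<in> generated_sigma M I W"
  unfolding generated_sigma_def by (rule sigma_sets_top)

text \<open>The law is checked on rectangles: a rectangle for the joint increment is an intersection
  of four rectangles for the single processes, whose probabilities multiply by independence.\<close>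

lemma gaussian_noise_joint:
  fixes W1 :: "real \<Rightarrow> 'a \<Rightarrow> real^'a1" and W2 :: "real \<Rightarrow> 'a \<Rightarrow> real^'a2"
    and W3 :: "real \<Rightarrow> 'a \<Rightarrow> real^'a3" and W4 :: "real \<Rightarrow> 'a \<Rightarrow> real^'a4"
  assumes "prob_space M"
    and W: "std_wiener M W1" "std_wiener M W2" "std_wiener M W3" "std_wiener M W4"
    and ind: "prob_space.indep_sets M
           (\<lambda>i. [generated_sigma M {0..} W1, generated_sigma M {0..} W2,
                 generated_sigma M {0..} W3, generated_sigma M {0..} W4] ! i) {..<4}"
  shows "gaussian_noise M (joint_past M W1 W2 W3 W4) (joint_noise W1 W2 W3 W4)"
proof -
  interpret prob_space M by fact
  let ?F = "joint_past M W1 W2 W3 W4" and ?W = "joint_noise W1 W2 W3 W4"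
  have meas: "W1 t \<in> borel_measurable (?F s)" "W2 t \<in> borel_measurable (?F s)"
    "W3 t \<in> borel_measurable (?F s)" "W4 t \<in> borel_measurable (?F s)" if "t \<in> {0..s}" for t s
    by (rule measurable_from_subalg[OF subalgebra_joint_past(1) past_measurable[OF that]]
        measurable_from_subalg[OF subalgebra_joint_past(2) past_measurable[OF that]]
        measurable_from_subalg[OF subalgebra_joint_past(3) past_measurable[OF that]]
        measurable_from_subalg[OF subalgebra_joint_past(4) past_measurable[OF that]])+
  have Wm: "?W t \<in> borel_measurable (?F s)" if t: "t \<in> {0..s}" for t s
    unfolding borel_measurable_vec_iff all_sum4 using meas[OF t] by auto
  have sub: "subalgebra M (?F t)" if "0 \<le> t" for t
    unfolding subalgebra_def sets_joint_past
    by (intro conjI space_joint_past sets.sigma_sets_subset Un_least generated_sigma_events)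
      (use W in \<open>auto simp: std_wiener_def\<close>)
  have mono: "subalgebra (?F t) (?F s)" if "0 \<le> s" "s \<le> t" for s t
    unfolding subalgebra_def sets_joint_past
    using that by (intro conjI sigma_sets_mono' Un_mono generated_sigma_mono) auto
  have UN4: "(\<Union>k\<in>{..<4::nat}. [a, b, c, d] ! k) = a \<union> b \<union> c \<union> d" for a b c d :: "'b set"
    by (simp add: lessThan_Suc numeral_eq_Suc) blast
  have all4: "(\<forall>k\<in>{..<4}. Q k) \<longleftrightarrow> Q 0 \<and> Q 1 \<and> Q 2 \<and> Q (3::nat)" for Q
    by (auto simp: lessThan_Suc numeral_eq_Suc)
  have main: "distr M (PiM UNIV (\<lambda>_. borel)) (\<lambda>\<omega> a. (?W t \<omega> - ?W s \<omega>) $ a / sqrt (t - s)) = PiM UNIV (\<lambda>_. std_normal_distribution)"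
    "indep_set (sets (?F s)) (increment_sets M ?W s t)" if st: "0 \<le> s" "s < t" for s t
  proof -
    have st0: "0 \<le> t" using st by simp
    note inc = increment_sets_props[OF st]
    have [measurable]: "?W t \<in> borel_measurable M" "?W s \<in> borel_measurable M"
      using st measurable_from_subalg[OF sub Wm, of t t] measurable_from_subalg[OF sub Wm, of s s] by auto
    define T where "T = (!) [generated_sigma M {0..} W1, generated_sigma M {0..} W2,
                 generated_sigma M {0..} W3, generated_sigma M {0..} W4]"
    define P where "P = (!) [generated_sigma M {0..s} W1, generated_sigma M {0..s} W2,
                 generated_sigma M {0..s} W3, generated_sigma M {0..s} W4]"
    define I where "I = (!) [increment_sets M W1 s t, increment_sets M W2 s t,
                 increment_sets M W3 s t, increment_sets M W4 s t]"
    have T: "indep_sets T {..<4}" using ind by (simp add: T_def)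
    have indep: "indep_set (sigma_sets (space M) (\<Union>k\<in>{..<4}. P k)) (sigma_sets (space M) (\<Union>k\<in>{..<4}. I k))"
    proof (rule indep_past_increments[OF _ _ T])
      have "\<forall>k\<in>{..<4}. P k \<subseteq> T k \<and> I k \<subseteq> T k \<and> (\<forall>A B. A \<in> T k \<longrightarrow> B \<in> T k \<longrightarrow> A \<inter> B \<in> T k) \<and>
          space M \<in> P k \<and> space M \<in> I k \<and> Int_stable (P k) \<and> Int_stable (I k) \<and> indep_set (P k) (I k)"
        unfolding all4 P_def T_def I_def
        using W st
        by (simp add: inc generated_sigma_mono generated_sigma_Int space_in_generated_sigma
            Int_stable_def[of "generated_sigma _ _ _"] numeral_eq_Suc std_wiener_def increment_sets_def[symmetric])
      then show "\<And>k. k \<in> {..<4} \<Longrightarrow> P k \<subseteq> T k" "\<And>k. k \<in> {..<4} \<Longrightarrow> I k \<subseteq> T k"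
        "\<And>k A B. k \<in> {..<4} \<Longrightarrow> A \<in> T k \<Longrightarrow> B \<in> T k \<Longrightarrow> A \<inter> B \<in> T k"
        "\<And>k. k \<in> {..<4} \<Longrightarrow> space M \<in> P k" "\<And>k. k \<in> {..<4} \<Longrightarrow> space M \<in> I k"
        "\<And>k. k \<in> {..<4} \<Longrightarrow> Int_stable (P k)" "\<And>k. k \<in> {..<4} \<Longrightarrow> Int_stable (I k)"
        "\<And>k. k \<in> {..<4} \<Longrightarrow> indep_set (P k) (I k)" by blast+
      show "{..<4::nat} \<noteq> {}" using all4[of "\<lambda>_. False"] by auto
    qed simp
    \<comment> \<open>The \<sigma>-algebra of the four increments. The joint increment is measurable
      for it coordinate by coordinate, so its events lie on the increment side of
      \<open>indep\<close>.\<close>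
    define G where "G = sigma (space M) (\<Union>k\<in>{..<4}. I k)"
    have IPow: "(\<Union>k\<in>{..<4}. I k) \<subseteq> Pow (space M)"
      unfolding UN4 I_def by (auto simp: increment_sets_def)
    have G: "space G = space M" "sets G = sigma_sets (space M) (\<Union>k\<in>{..<4}. I k)"
      unfolding G_def using IPow by (auto simp: space_measure_of sets_measure_of)
    have Gm: "(\<lambda>\<omega>. V t \<omega> - V s \<omega>) \<in> borel_measurable G" if "increment_sets M V s t \<subseteq> (\<Union>k\<in>{..<4}. I k)"
      for V :: "real \<Rightarrow> 'a \<Rightarrow> real^'v::finite"
    proof (rule measurableI)
      fix A :: "(real^'v) set" assume "A \<in> sets borel"
      then have "(\<lambda>\<omega>. V t \<omega> - V s \<omega>) -` A \<inter> space M \<in> (\<Union>k\<in>{..<4}. I k)"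
        using that by (auto simp: increment_sets_def)
      then show "(\<lambda>\<omega>. V t \<omega> - V s \<omega>) -` A \<inter> space G \<in> sets G"
        unfolding G by (rule sigma_sets.Basic)
    qed simp
    have [measurable]: "(\<lambda>\<omega>. W1 t \<omega> - W1 s \<omega>) \<in> borel_measurable G" "(\<lambda>\<omega>. W2 t \<omega> - W2 s \<omega>) \<in> borel_measurable G"
      "(\<lambda>\<omega>. W3 t \<omega> - W3 s \<omega>) \<in> borel_measurable G" "(\<lambda>\<omega>. W4 t \<omega> - W4 s \<omega>) \<in> borel_measurable G"
      by (intro Gm, unfold UN4 I_def, blast)+
    have GW: "(\<lambda>\<omega>. ?W t \<omega> - ?W s \<omega>) \<in> borel_measurable G"
      unfolding borel_measurable_vec_iff all_sum4
      using borel_measurable_vec_component[of "\<lambda>\<omega>. W1 t \<omega> - W1 s \<omega>" G] borel_measurable_vec_component[of "\<lambda>\<omega>. W2 t \<omega> - W2 s \<omega>" G]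
        borel_measurable_vec_component[of "\<lambda>\<omega>. W3 t \<omega> - W3 s \<omega>" G] borel_measurable_vec_component[of "\<lambda>\<omega>. W4 t \<omega> - W4 s \<omega>" G]
      by simp
    have FP: "sets (?F s) = sigma_sets (space M) (\<Union>k\<in>{..<4}. P k)"
      unfolding sets_joint_past UN4 P_def ..
    show "indep_set (sets (?F s)) (increment_sets M ?W s t)"
      unfolding indep_set_def
    proof (rule indep_sets_mono_sets[OF indep[unfolded indep_set_def]])
      fix b
      have "increment_sets M ?W s t \<subseteq> sets G"
        using measurable_sets[OF GW] by (auto simp: increment_sets_def G(1))
      then show "case_bool (sets (?F s)) (increment_sets M ?W s t) b
        \<subseteq> case_bool (sigma_sets (space M) (\<Union>k\<in>{..<4}. P k)) (sigma_sets (space M) (\<Union>k\<in>{..<4}. I k)) b"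
        unfolding FP G(2) by (simp split: bool.split)
    qed
    interpret std: prob_space std_normal_distribution by (rule prob_space_std_normal)
    interpret product_sigma_finite "\<lambda>_::('a1 + 'a2) + ('a3 + 'a4). std_normal_distribution" ..
    have vm: "(\<lambda>\<omega> a. (?W t \<omega> - ?W s \<omega>) $ a / sqrt (t - s)) \<in> M \<rightarrow>\<^sub>M PiM UNIV (\<lambda>_. borel)"
      by (rule measurable_PiM_single') auto
    show "distr M (PiM UNIV (\<lambda>_. borel)) (\<lambda>\<omega> a. (?W t \<omega> - ?W s \<omega>) $ a / sqrt (t - s)) = PiM UNIV (\<lambda>_. std_normal_distribution)"
    proof (rule PiM_eqI)
      show "sets (distr M (PiM UNIV (\<lambda>_. borel)) (\<lambda>\<omega> a. (?W t \<omega> - ?W s \<omega>) $ a / sqrt (t - s))) = sets (PiM UNIV (\<lambda>_. std_normal_distribution))"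
        by (simp cong: sets_PiM_cong)
      fix A :: "('a1 + 'a2) + ('a3 + 'a4) \<Rightarrow> real set" assume "\<And>i. i \<in> UNIV \<Longrightarrow> A i \<in> sets std_normal_distribution"
      then have A[measurable]: "A i \<in> sets borel" for i by simp
      define R1 where "R1 = {\<omega>\<in>space M. \<forall>i. (W1 t \<omega> - W1 s \<omega>) $ i / sqrt (t - s) \<in> A (Inl (Inl i))}"
      define R2 where "R2 = {\<omega>\<in>space M. \<forall>i. (W2 t \<omega> - W2 s \<omega>) $ i / sqrt (t - s) \<in> A (Inl (Inr i))}"
      define R3 where "R3 = {\<omega>\<in>space M. \<forall>i. (W3 t \<omega> - W3 s \<omega>) $ i / sqrt (t - s) \<in> A (Inr (Inl i))}"
      define R4 where "R4 = {\<omega>\<in>space M. \<forall>i. (W4 t \<omega> - W4 s \<omega>) $ i / sqrt (t - s) \<in> A (Inr (Inr i))}"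
      have RT: "{\<omega>\<in>space M. \<forall>i. (V t \<omega> - V s \<omega>) $ i / sqrt (t - s) \<in> C i} \<in> increment_sets M V s t"
        if C[measurable]: "\<And>i. C i \<in> sets borel" for V :: "real \<Rightarrow> 'a \<Rightarrow> real^'v::finite" and C
      proof -
        have "{x::real^'v. \<forall>i. x $ i / sqrt (t - s) \<in> C i} = (\<Inter>i. (\<lambda>x. x $ i / sqrt (t - s)) -` C i \<inter> space borel)" by auto
        also have "\<dots> \<in> sets borel"
          by (intro sets.finite_INT measurable_sets[OF _ C]) auto
        finally show ?thesis
          unfolding increment_sets_def by (intro CollectI exI[of _ "{x. \<forall>i. x $ i / sqrt (t - s) \<in> C i}"]) auto
      qed
      have R: "R1 \<in> generated_sigma M {0..} W1" "R2 \<in> generated_sigma M {0..} W2"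
        "R3 \<in> generated_sigma M {0..} W3" "R4 \<in> generated_sigma M {0..} W4"
        unfolding R1_def R2_def R3_def R4_def by (rule subsetD[OF inc(1) RT], rule A)+
      have pT: "prob (\<Inter>k\<in>{..<4}. [R1, R2, R3, R4] ! k) = (\<Prod>k\<in>{..<4}. prob ([R1, R2, R3, R4] ! k))"
      proof (rule indep_setsD[OF T])
        show "{..<4::nat} \<noteq> {}" using all4[of "\<lambda>_. False"] by auto
        show "\<forall>k\<in>{..<4}. [R1, R2, R3, R4] ! k \<in> T k"
          unfolding all4 T_def using R by (simp add: numeral_eq_Suc)
      qed auto
      have "emeasure (distr M (PiM UNIV (\<lambda>_. borel)) (\<lambda>\<omega> a. (?W t \<omega> - ?W s \<omega>) $ a / sqrt (t - s))) (Pi\<^sub>E UNIV A) =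
          emeasure M (R1 \<inter> R2 \<inter> R3 \<inter> R4)"
      proof -
        have PA: "Pi\<^sub>E UNIV A \<in> sets (PiM UNIV (\<lambda>_. borel))" by (rule sets_PiM_I_finite) auto
        show ?thesis
          unfolding emeasure_distr[OF vm PA]
          by (intro arg_cong[where f="emeasure M"])
            (auto simp: PiE_UNIV_domain Pi_iff all_sum4 R1_def R2_def R3_def R4_def)
      qed
      also have "\<dots> = emeasure M R1 * emeasure M R2 * (emeasure M R3 * emeasure M R4)"
        using pT by (simp add: emeasure_eq_measure lessThan_Suc numeral_eq_Suc ennreal_mult ac_simps)
      also have "\<dots> = (\<Prod>i\<in>UNIV. emeasure std_normal_distribution (A i))"
        unfolding R1_def R2_def R3_def R4_def wiener_increment_rectangle[OF W(1) st A]
          wiener_increment_rectangle[OF W(2) st A] wiener_increment_rectangle[OF W(3) st A]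
          wiener_increment_rectangle[OF W(4) st A]
        by (simp add: UNIV_Plus_UNIV[symmetric] prod.Plus del: UNIV_Plus_UNIV)
      finally show "emeasure (distr M (PiM UNIV (\<lambda>_. borel)) (\<lambda>\<omega> a. (?W t \<omega> - ?W s \<omega>) $ a / sqrt (t - s))) (Pi\<^sub>E UNIV A) =
          (\<Prod>i\<in>UNIV. emeasure std_normal_distribution (A i))" .
    qed simp
  qed
  show ?thesis
    unfolding gaussian_noise_def using sub mono main Wm by auto
qed

section \<open>Normalized noise increments\<close>

text \<open>Obtained from the product measure rather than from a density, so that integrals of
  monomials factor at once, as in \<open>std_gauss_monomial\<close>.\<close>

definition std_gauss :: "(real^'r) measure" where
  "std_gauss = distr (PiM UNIV (\<lambda>_. std_normal_distribution)) borel (\<lambda>x. \<chi> a. x a)"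

lemma sets_std_gauss [simp]: "sets std_gauss = sets borel" "space std_gauss = UNIV"
  by (simp_all add: std_gauss_def)

lemma measurable_vec_lambda_PiM:
  "(\<lambda>x. \<chi> a. x a) \<in> borel_measurable (PiM (UNIV :: 'r::finite set) (\<lambda>_. std_normal_distribution))"
  unfolding borel_measurable_vec_iff by (simp add: measurable_component_singleton) measurable

lemma prob_space_std_gauss: "prob_space (std_gauss :: (real^'r) measure)"
proof -
  interpret prob_space "PiM (UNIV :: 'r set) (\<lambda>_. std_normal_distribution)"
    by (rule prob_space_PiM) (rule prob_space_std_normal)
  show ?thesis unfolding std_gauss_def by (rule prob_space_distr) (rule measurable_vec_lambda_PiM)
qed

definition normal_moment :: "nat \<Rightarrow> real" where
  "normal_moment k = (\<integral>x. x ^ k \<partial>std_normal_distribution)"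

lemma normal_moment_values:
  "normal_moment 0 = 1" "normal_moment 1 = 0" "normal_moment 2 = 1" "normal_moment 3 = 0" "normal_moment 4 = 3"
proof -
  interpret prob_space std_normal_distribution by (rule prob_space_std_normal)
  show "normal_moment 0 = 1" unfolding normal_moment_def using prob_space by simp
  show "normal_moment 1 = 0" unfolding normal_moment_def using integral_std_normal_distribution_moment_odd[of 1] by simp
  show "normal_moment 3 = 0" unfolding normal_moment_def using integral_std_normal_distribution_moment_odd[of 3] by simp
  show "normal_moment 2 = 1" unfolding normal_moment_def using std_normal_distribution_even_moments(1)[of 1] by (simp add: fact_numeral)
  show "normal_moment 4 = 3" unfolding normal_moment_def using std_normal_distribution_even_moments(1)[of 2] by (simp add: fact_numeral)
qed

lemma std_gauss_monomial:
  fixes k :: "'r::finite \<Rightarrow> nat"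
  shows "has_bochner_integral std_gauss (\<lambda>z::real^'r. \<Prod>i\<in>UNIV. (z $ i) ^ k i) (\<Prod>i\<in>UNIV. normal_moment (k i))"
proof -
  interpret std: prob_space std_normal_distribution by (rule prob_space_std_normal)
  interpret product_sigma_finite "\<lambda>_::'r. std_normal_distribution" ..
  have [measurable]: "(\<lambda>z::real^'r. \<Prod>i\<in>UNIV. (z $ i) ^ k i) \<in> borel_measurable borel" by measurable
  have "integrable (PiM UNIV (\<lambda>_. std_normal_distribution)) (\<lambda>x. \<Prod>i\<in>UNIV. (x i) ^ k i)"
    by (rule product_integrable_prod) (auto intro: integrable_std_normal_distribution_moment)
  moreover have "(\<integral>x. (\<Prod>i\<in>UNIV. (x i) ^ k i) \<partial>PiM UNIV (\<lambda>_. std_normal_distribution)) = (\<Prod>i\<in>UNIV. normal_moment (k i))"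
    unfolding normal_moment_def by (rule product_integral_prod) (auto intro: integrable_std_normal_distribution_moment)
  ultimately show ?thesis
    unfolding std_gauss_def has_bochner_integral_iff
    by (simp add: integrable_distr_eq[OF measurable_vec_lambda_PiM] integral_distr[OF measurable_vec_lambda_PiM])
qed

lemma power_indicator_prod:
  fixes z :: "real^'r"
  shows "(\<Prod>i\<in>UNIV. (z $ i) ^ of_bool (i = a)) = z $ a"
proof -
  have "(\<Prod>i\<in>UNIV. (z $ i) ^ of_bool (i = a)) = (\<Prod>i\<in>UNIV. if i = a then z $ a else 1)"
    by (intro prod.cong) auto
  then show ?thesis by simp
qed

text \<open>Wick's formula up to order four, whose last case sums over the three pairings. A
  coordinate is a monomial with exponents 0 and 1, so products of coordinates are monomials too, and
  coincidences of the indices are sorted out by cases.\<close>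

lemma std_gauss_moments:
  fixes a b c d :: "'r::finite"
  shows "has_bochner_integral std_gauss (\<lambda>z::real^'r. z $ a) 0"
    and "has_bochner_integral std_gauss (\<lambda>z::real^'r. z $ a * z $ b) (of_bool (a = b))"
    and "has_bochner_integral std_gauss (\<lambda>z::real^'r. z $ a * z $ b * (z $ c * z $ d))
      (of_bool (a = b \<and> c = d) + of_bool (a = c \<and> b = d) + of_bool (a = d \<and> b = c))"
proof -
  \<comment> \<open>Indices with exponent 0 contribute the factor \<open>normal_moment 0\<close>,
    which is 1; only those that occur remain.\<close>
  have red: "(\<Prod>i\<in>UNIV. normal_moment (k i)) = (\<Prod>i\<in>A. normal_moment (k i))"
    if "\<And>i. i \<notin> A \<Longrightarrow> k i = 0" for A and k :: "'r \<Rightarrow> nat"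
    by (rule prod.mono_neutral_right) (auto simp: that normal_moment_values(1))
  have nmS: "normal_moment (Suc 0) = 0" "normal_moment (Suc (Suc 0)) = 1"
    "normal_moment (Suc (Suc (Suc 0))) = 0" "normal_moment (Suc (Suc (Suc (Suc 0)))) = 3"
    using normal_moment_values by (simp_all add: numeral_eq_Suc)
  note nm = normal_moment_values(1) nmS
  have "has_bochner_integral std_gauss (\<lambda>z::real^'r. z $ a) (\<Prod>i\<in>{a}. normal_moment (of_bool (i = a)))"
    using std_gauss_monomial[of "\<lambda>i. of_bool (i = a)"] by (subst red[symmetric]) (auto simp: power_indicator_prod)
  then show "has_bochner_integral std_gauss (\<lambda>z::real^'r. z $ a) 0"
    by (simp add: nm)
  have "has_bochner_integral std_gauss (\<lambda>z::real^'r. z $ a * z $ b)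
      (\<Prod>i\<in>{a, b}. normal_moment (of_bool (i = a) + of_bool (i = b)))"
    using std_gauss_monomial[of "\<lambda>i. of_bool (i = a) + of_bool (i = b)"]
    by (subst red[symmetric]) (auto simp: power_add prod.distrib power_indicator_prod)
  then show "has_bochner_integral std_gauss (\<lambda>z::real^'r. z $ a * z $ b) (of_bool (a = b))"
    by (cases "a = b") (auto simp: nm numeral_2_eq_2)
  have 4: "has_bochner_integral std_gauss (\<lambda>z::real^'r. z $ a * z $ b * (z $ c * z $ d))
      (\<Prod>i\<in>{a, b, c, d}. normal_moment (of_bool (i = a) + of_bool (i = b) + (of_bool (i = c) + of_bool (i = d))))"
    using std_gauss_monomial[of "\<lambda>i. of_bool (i = a) + of_bool (i = b) + (of_bool (i = c) + of_bool (i = d))"]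
    by (subst red[symmetric]) (auto simp: power_add prod.distrib power_indicator_prod)
  have "(\<Prod>i\<in>{a, b, c, d}. normal_moment (of_bool (i = a) + of_bool (i = b) + (of_bool (i = c) + of_bool (i = d)))) =
     of_bool (a = b \<and> c = d) + of_bool (a = c \<and> b = d) + of_bool (a = d \<and> b = c)"
    by (cases "a = b"; cases "a = c"; cases "a = d"; cases "b = c"; cases "b = d"; cases "c = d")
      (simp_all add: nm insert_commute)
  with 4 show "has_bochner_integral std_gauss (\<lambda>z::real^'r. z $ a * z $ b * (z $ c * z $ d))
      (of_bool (a = b \<and> c = d) + of_bool (a = c \<and> b = d) + of_bool (a = d \<and> b = c))" by simp
qed

text \<open>Centring removes the pairing of \<open>a\<close> with \<open>b\<close> and
  \<open>c\<close> with \<open>d\<close>; the two mixed pairings remain as covariance.\<close>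

lemma std_gauss_centred_products:
  fixes a b c d :: "'r::finite"
  shows "has_bochner_integral std_gauss (\<lambda>z::real^'r. z $ a * z $ b - of_bool (a = b)) 0"
    and "has_bochner_integral std_gauss (\<lambda>z::real^'r. (z $ a * z $ b - of_bool (a = b)) * (z $ c * z $ d - of_bool (c = d)))
      (of_bool (a = c \<and> b = d) + of_bool (a = d \<and> b = c))"
proof -
  interpret prob_space "std_gauss :: (real^'r) measure" by (rule prob_space_std_gauss)
  let ?c = "\<lambda>a b. of_bool (a = b) :: real"
  show m2: "has_bochner_integral std_gauss (\<lambda>z::real^'r. z $ a * z $ b - ?c a b) 0" for a b
    using has_bochner_integral_diff[OF std_gauss_moments(2)[of a b], of "\<lambda>_. ?c a b" "?c a b"]
    by (simp add: has_bochner_integral_iff prob_space[simplified])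
  have "has_bochner_integral std_gauss (\<lambda>z::real^'r. z $ a * z $ b * (z $ c * z $ d) - ?c a b * (z $ c * z $ d) - ?c c d * (z $ a * z $ b - ?c a b))
    (of_bool (a = b \<and> c = d) + of_bool (a = c \<and> b = d) + of_bool (a = d \<and> b = c) - ?c a b * ?c c d - ?c c d * 0)"
    by (intro has_bochner_integral_diff has_bochner_integral_mult_right std_gauss_moments m2)
  moreover have "?c a b * ?c c d = of_bool (a = b \<and> c = d)" by simp
  ultimately show "has_bochner_integral std_gauss (\<lambda>z::real^'r. (z $ a * z $ b - ?c a b) * (z $ c * z $ d - ?c c d))
      (of_bool (a = c \<and> b = d) + of_bool (a = d \<and> b = c))"
    by (simp add: algebra_simps)
qed

text \<open>For a symmetric matrix the two mixed pairings contribute equally, hence the factor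
  2.\<close>

lemma std_gauss_quadratic_form:
  fixes G :: "real^'r^'r"
  assumes sym: "transpose G = G"
  defines "q \<equiv> (\<lambda>z. z \<bullet> (G *v z) - trace G)"
  shows "has_bochner_integral std_gauss q 0"
    and "has_bochner_integral std_gauss (\<lambda>z. (q z)\<^sup>2) (2 * (norm G)\<^sup>2)"
proof -
  interpret prob_space "std_gauss :: (real^'r) measure" by (rule prob_space_std_gauss)
  have Gs: "G $ i $ j = G $ j $ i" for i j
  proof -
    have "transpose G $ i $ j = G $ i $ j" using sym by simp
    then show ?thesis by (simp add: transpose_def)
  qed
  let ?c = "\<lambda>a b. of_bool (a = b) :: real"
  have q: "q z = (\<Sum>a\<in>UNIV. \<Sum>b\<in>UNIV. G $ a $ b * (z $ a * z $ b - ?c a b))" for z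
  proof -
    have "trace G = (\<Sum>a\<in>UNIV. \<Sum>b\<in>UNIV. G $ a $ b * ?c a b)"
      by (simp add: trace_def of_bool_def if_distrib cong: if_cong)
    moreover have "z \<bullet> (G *v z) = (\<Sum>a\<in>UNIV. \<Sum>b\<in>UNIV. G $ a $ b * (z $ a * z $ b))"
      by (simp add: inner_vec_def matrix_vector_mult_def sum_distrib_left ac_simps)
    ultimately show ?thesis
      by (simp add: q_def sum_subtractf right_diff_distrib)
  qed
  have "has_bochner_integral std_gauss (\<lambda>z. \<Sum>a\<in>UNIV. \<Sum>b\<in>UNIV. G $ a $ b * (z $ a * z $ b - ?c a b)) (\<Sum>a\<in>UNIV. \<Sum>b\<in>UNIV. G $ a $ b * 0)"
    by (intro has_bochner_integral_sum has_bochner_integral_mult_right std_gauss_centred_products)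
  then show "has_bochner_integral std_gauss q 0" unfolding q[abs_def] by simp
  have "(q z)\<^sup>2 = (\<Sum>a\<in>UNIV. \<Sum>b\<in>UNIV. \<Sum>c\<in>UNIV. \<Sum>d\<in>UNIV. G $ a $ b * G $ c $ d *
      ((z $ a * z $ b - ?c a b) * (z $ c * z $ d - ?c c d)))" for z
    unfolding q power2_eq_square sum_distrib_right sum_distrib_left
    by (intro sum.cong refl) (simp only: ac_simps)
  moreover have "has_bochner_integral std_gauss (\<lambda>z. \<Sum>a\<in>UNIV. \<Sum>b\<in>UNIV. \<Sum>c\<in>UNIV. \<Sum>d\<in>UNIV. G $ a $ b * G $ c $ d *
      ((z $ a * z $ b - ?c a b) * (z $ c * z $ d - ?c c d)))
     (\<Sum>a\<in>UNIV. \<Sum>b\<in>UNIV. \<Sum>c\<in>UNIV. \<Sum>d\<in>UNIV. G $ a $ b * G $ c $ d * (of_bool (a = c \<and> b = d) + of_bool (a = d \<and> b = c)))"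
    by (intro has_bochner_integral_sum has_bochner_integral_mult_right std_gauss_centred_products)
  moreover have "(\<Sum>c\<in>UNIV. \<Sum>d\<in>UNIV. G $ a $ b * G $ c $ d * (of_bool (a = c \<and> b = d) + of_bool (a = d \<and> b = c))) = 2 * (G $ a $ b)\<^sup>2" for a b
  proof -
    have "(\<Sum>c\<in>UNIV. \<Sum>d\<in>UNIV. G $ a $ b * G $ c $ d * (of_bool (a = c \<and> b = d) + of_bool (a = d \<and> b = c))) =
        (\<Sum>c\<in>UNIV. \<Sum>d\<in>UNIV. (if c = a then if d = b then G $ a $ b * G $ a $ b else 0 else 0)) +
        (\<Sum>c\<in>UNIV. \<Sum>d\<in>UNIV. (if c = b then if d = a then G $ a $ b * G $ a $ b else 0 else 0))"
      unfolding sum.distrib[symmetric] by (intro sum.cong refl) (auto simp: Gs)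
    also have "\<dots> = 2 * (G $ a $ b)\<^sup>2"
      by (simp add: sum.delta' if_distrib[of "sum _"] power2_eq_square sum.If_cases)
    finally show ?thesis .
  qed
  ultimately show "has_bochner_integral std_gauss (\<lambda>z. (q z)\<^sup>2) (2 * (norm G)\<^sup>2)"
    unfolding power2_norm_eq_inner by (simp add: inner_matrix power2_eq_square sum_distrib_left)
qed

text \<open>Step \<open>i\<close> runs from i h to (i + 1) h: the increment is known at its right
  end and independent of the past at its left end. Division by sqrt h frees its law from
  \<open>h\<close>.\<close>

definition zinc :: "(real \<Rightarrow> 'a \<Rightarrow> real^'r) \<Rightarrow> real \<Rightarrow> nat \<Rightarrow> 'a \<Rightarrow> real^'r" where
  "zinc W h i \<omega> = (1 / sqrt h) *\<^sub>R (W (real (Suc i) * h) \<omega> - W (real i * h) \<omega>)"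

context
  fixes M :: "'a measure" and F and W :: "real \<Rightarrow> 'a \<Rightarrow> real^'r" and h :: real
  assumes M: "prob_space M" and W: "gaussian_noise M F W" and h: "0 < h"
begin

interpretation prob_space M by (rule M)

lemma filtration: "subalgebra M (F (real i * h))" "i \<le> j \<Longrightarrow> subalgebra (F (real j * h)) (F (real i * h))"
proof -
  show "subalgebra M (F (real i * h))" using W h unfolding gaussian_noise_def by simp
  assume "i \<le> j"
  then have "real i * h \<le> real j * h" using h by simp
  then show "subalgebra (F (real j * h)) (F (real i * h))"
    using W h unfolding gaussian_noise_def by simp
qed

lemma zinc_adapted: "i < j \<Longrightarrow> zinc W h i \<in> borel_measurable (F (real j * h))"
proof -
  assume ij: "i < j"
  have *: "W (real k * h) \<in> borel_measurable (F (real j * h))" if "k \<le> j" for k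
    using W h measurable_from_subalg[OF filtration(2)[OF that], of "W (real k * h)"] unfolding gaussian_noise_def by simp
  show "zinc W h i \<in> borel_measurable (F (real j * h))"
    unfolding zinc_def using ij
    by (intro borel_measurable_scaleR borel_measurable_diff borel_measurable_const *) auto
qed

lemma zinc_measurable [measurable]: "zinc W h i \<in> borel_measurable M"
  using measurable_from_subalg[OF filtration(1) zinc_adapted[OF lessI]] .

lemma zinc_law: "distr M borel (zinc W h i) = std_gauss"
proof -
  let ?s = "real i * h" and ?t = "real (Suc i) * h"
  have st: "0 \<le> ?s" "?s < ?t" "?t - ?s = h" using h by (simp_all add: algebra_simps)
  have "distr M (PiM UNIV (\<lambda>_. borel)) (\<lambda>\<omega> a. (W ?t \<omega> - W ?s \<omega>) $ a / sqrt (?t - ?s)) = PiM UNIV (\<lambda>_. std_normal_distribution)"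
    using W st(1,2) unfolding gaussian_noise_def by blast
  then have D: "distr M (PiM UNIV (\<lambda>_. borel)) (\<lambda>\<omega> a. zinc W h i \<omega> $ a) = PiM UNIV (\<lambda>_. std_normal_distribution)"
    unfolding st(3) by (simp add: zinc_def divide_inverse mult.commute)
  have vm: "(\<lambda>x. \<chi> a. x a) \<in> borel_measurable (PiM (UNIV :: 'r set) (\<lambda>_. borel :: real measure))"
    unfolding borel_measurable_vec_iff by simp measurable
  have zm: "(\<lambda>\<omega> a. zinc W h i \<omega> $ a) \<in> M \<rightarrow>\<^sub>M PiM UNIV (\<lambda>_. borel)"
    by (rule measurable_PiM_single') auto
  have "distr M borel (zinc W h i) = distr M borel ((\<lambda>x. \<chi> a. x a) \<circ> (\<lambda>\<omega> a. zinc W h i \<omega> $ a))"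
    by (simp add: comp_def)
  also have "\<dots> = distr (distr M (PiM UNIV (\<lambda>_. borel)) (\<lambda>\<omega> a. zinc W h i \<omega> $ a)) borel (\<lambda>x. \<chi> a. x a)"
    by (rule distr_distr[OF vm zm, symmetric])
  finally show ?thesis unfolding D std_gauss_def .
qed

lemma has_integral_zinc:
  fixes g :: "real^'r \<Rightarrow> 'b::{banach, second_countable_topology}"
  assumes "has_bochner_integral std_gauss g x"
  shows "has_bochner_integral M (\<lambda>\<omega>. g (zinc W h i \<omega>)) x"
proof -
  have [measurable]: "g \<in> borel_measurable borel"
    using borel_measurable_has_bochner_integral[OF assms] by (simp add: measurable_def)
  show ?thesis
    using assms unfolding zinc_law[of i, symmetric] has_bochner_integral_iff
    by (simp add: integrable_distr_eq integral_distr)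
qed

text \<open>Keeping \<open>g\<close> free lets one statement serve complex exponentials, centred
  functions of the increment and their squares.\<close>

lemma indep_past_zinc:
  fixes f :: "'a \<Rightarrow> 'b::topological_space"
  assumes f: "f \<in> borel_measurable (F (real i * h))" and g: "g \<in> borel_measurable borel"
  shows "indep_var borel f borel (\<lambda>\<omega>. g (zinc W h i \<omega>))"
  unfolding indep_var_eq
proof (intro conjI)
  let ?s = "real i * h" and ?t = "real (Suc i) * h"
  have st: "0 \<le> ?s" "?s < ?t" using h by (simp_all add: algebra_simps)
  have ind: "indep_set (sets (F ?s)) (increment_sets M W ?s ?t)"
    using W st unfolding gaussian_noise_def by blast
  have spF: "space (F ?s) = space M" using filtration(1)[of i] by (simp add: subalgebra_def)
  show "random_variable borel f" using measurable_from_subalg[OF filtration(1) f] .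
  show "random_variable borel (\<lambda>\<omega>. g (zinc W h i \<omega>))" using g by measurable
  show "indep_set (sigma_sets (space M) {f -` A \<inter> space M |A. A \<in> sets borel})
     (sigma_sets (space M) {(\<lambda>\<omega>. g (zinc W h i \<omega>)) -` A \<inter> space M |A. A \<in> sets borel})"
  proof (rule indep_set_sigma_sets)
    show "indep_set {f -` A \<inter> space M |A. A \<in> sets borel} {(\<lambda>\<omega>. g (zinc W h i \<omega>)) -` A \<inter> space M |A. A \<in> sets borel}"
      unfolding indep_set_def
    proof (rule indep_sets_mono_sets[OF ind[unfolded indep_set_def]])
      fix b
      have "{f -` A \<inter> space M |A. A \<in> sets borel} \<subseteq> sets (F ?s)"
        using measurable_sets[OF f] spF by auto
      moreover have "{(\<lambda>\<omega>. g (zinc W h i \<omega>)) -` A \<inter> space M |A. A \<in> sets borel} \<subseteq> increment_sets M W ?s ?t"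
      proof clarify
        fix A :: "'b set" assume "A \<in> sets borel"
        moreover have "(\<lambda>x::real^'r. g ((1 / sqrt h) *\<^sub>R x)) \<in> borel_measurable borel" using g by measurable
        ultimately have "(\<lambda>x. g ((1 / sqrt h) *\<^sub>R x)) -` A \<inter> space borel \<in> sets borel" by (rule measurable_sets[rotated])
        then show "(\<lambda>\<omega>. g (zinc W h i \<omega>)) -` A \<inter> space M \<in> increment_sets M W ?s ?t"
          unfolding increment_sets_def zinc_def by (intro CollectI exI conjI) auto
      qed
      ultimately show "case_bool {f -` A \<inter> space M |A. A \<in> sets borel} {(\<lambda>\<omega>. g (zinc W h i \<omega>)) -` A \<inter> space M |A. A \<in> sets borel} b
         \<subseteq> case_bool (sets (F ?s)) (increment_sets M W ?s ?t) b"
        by (simp split: bool.split)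
    qed
    have st: "Int_stable {k -` A \<inter> space M |A. A \<in> sets borel}" for k :: "'a \<Rightarrow> 'b"
      unfolding Int_stable_def
    proof clarify
      fix A B :: "'b set" assume "A \<in> sets borel" "B \<in> sets borel"
      then show "\<exists>C. k -` A \<inter> space M \<inter> (k -` B \<inter> space M) = k -` C \<inter> space M \<and> C \<in> sets borel"
        by (intro exI[of _ "A \<inter> B"]) auto
    qed
    show "Int_stable {f -` A \<inter> space M |A. A \<in> sets borel}"
      "Int_stable {(\<lambda>\<omega>. g (zinc W h i \<omega>)) -` A \<inter> space M |A. A \<in> sets borel}" by (rule st)+
  qed
qed

text \<open>Induction on \<open>n\<close>: the first \<open>n\<close> factors are known at time n h,
  and the next one is independent of that past.\<close>

lemma expectation_prod_zinc:
  fixes f :: "real^'r \<Rightarrow> complex"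
  assumes f: "integrable std_gauss f"
  shows "integrable M (\<lambda>\<omega>. \<Prod>i<n. f (zinc W h i \<omega>)) \<and>
    expectation (\<lambda>\<omega>. \<Prod>i<n. f (zinc W h i \<omega>)) = (\<integral>z. f z \<partial>std_gauss) ^ n"
proof (induction n)
  case 0
  then show ?case by (simp add: prob_space)
next
  case (Suc n)
  have fm[measurable]: "f \<in> borel_measurable borel"
    using borel_measurable_integrable[OF f] by (simp add: measurable_def)
  have hb: "has_bochner_integral M (\<lambda>\<omega>. f (zinc W h n \<omega>)) (\<integral>z. f z \<partial>std_gauss)"
    by (rule has_integral_zinc) (rule has_bochner_integral_integrable[OF f])
  have "(\<lambda>\<omega>. f (zinc W h i \<omega>)) \<in> borel_measurable (F (real n * h))" if "i < n" for i
    using measurable_compose[OF zinc_adapted[OF that] fm] .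
  then have "(\<lambda>\<omega>. \<Prod>i<n. f (zinc W h i \<omega>)) \<in> borel_measurable (F (real n * h))"
    by (intro borel_measurable_prod) auto
  note ind = indep_past_zinc[OF this fm]
  show ?case
    using indep_var_lebesgue_integral[OF ind] indep_var_integrable[OF ind] Suc hb
    by (simp add: has_bochner_integral_iff mult.commute)
qed

text \<open>A martingale transform: the cross terms vanish because the later increment is centred and
  independent of everything else.\<close>

lemma martingale_L2:
  fixes \<beta> :: "nat \<Rightarrow> 'a \<Rightarrow> real" and g :: "real^'r \<Rightarrow> real"
  assumes \<beta>: "\<And>i. i < n \<Longrightarrow> \<beta> i \<in> borel_measurable (F (real i * h))"
    "\<And>i. i < n \<Longrightarrow> integrable M (\<lambda>\<omega>. (\<beta> i \<omega>)\<^sup>2)" "\<And>i. i < n \<Longrightarrow> expectation (\<lambda>\<omega>. (\<beta> i \<omega>)\<^sup>2) \<le> C"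
    and g: "has_bochner_integral std_gauss g 0" "has_bochner_integral std_gauss (\<lambda>z. (g z)\<^sup>2) v"
  shows "integrable M (\<lambda>\<omega>. (\<Sum>i<n. \<beta> i \<omega> * g (zinc W h i \<omega>))\<^sup>2)"
    and "expectation (\<lambda>\<omega>. (\<Sum>i<n. \<beta> i \<omega> * g (zinc W h i \<omega>))\<^sup>2) \<le> real n * (C * v)"
proof -
  have gm[measurable]: "g \<in> borel_measurable borel"
    using borel_measurable_has_bochner_integral[OF g(1)] by (simp add: measurable_def)
  have v: "0 \<le> v"
    unfolding has_bochner_integral_integral_eq[OF g(2), symmetric] by (rule integral_nonneg_AE) simp
  have g1: "integrable M (\<lambda>\<omega>. g (zinc W h i \<omega>))" "expectation (\<lambda>\<omega>. g (zinc W h i \<omega>)) = 0"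
    and g2: "integrable M (\<lambda>\<omega>. (g (zinc W h i \<omega>))\<^sup>2)" "expectation (\<lambda>\<omega>. (g (zinc W h i \<omega>))\<^sup>2) = v" for i
    using has_integral_zinc[OF g(1), of i] has_integral_zinc[OF g(2), of i]
    unfolding has_bochner_integral_iff by simp_all
  define \<xi> where "\<xi> i \<omega> = \<beta> i \<omega> * g (zinc W h i \<omega>)" for i \<omega>
  have \<beta>M[measurable]: "i < n \<Longrightarrow> \<beta> i \<in> borel_measurable M" for i
    using measurable_from_subalg[OF filtration(1) \<beta>(1)] .
  have \<xi>M: "i < n \<Longrightarrow> \<xi> i \<in> borel_measurable M" for i unfolding \<xi>_def by measurable
  have sq: "integrable M (\<lambda>\<omega>. (\<xi> i \<omega>)\<^sup>2)" "expectation (\<lambda>\<omega>. (\<xi> i \<omega>)\<^sup>2) \<le> C * v" if i: "i < n" for i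
  proof -
    have "(\<lambda>\<omega>. (\<beta> i \<omega>)\<^sup>2) \<in> borel_measurable (F (real i * h))" using \<beta>(1)[OF i] by measurable
    moreover have "(\<lambda>z. (g z)\<^sup>2) \<in> borel_measurable borel" by measurable
    ultimately have ind: "indep_var borel (\<lambda>\<omega>. (\<beta> i \<omega>)\<^sup>2) borel (\<lambda>\<omega>. (g (zinc W h i \<omega>))\<^sup>2)"
      by (rule indep_past_zinc)
    show "integrable M (\<lambda>\<omega>. (\<xi> i \<omega>)\<^sup>2)"
      unfolding \<xi>_def power_mult_distrib by (rule indep_var_integrable[OF ind \<beta>(2)[OF i] g2(1)])
    have "expectation (\<lambda>\<omega>. (\<xi> i \<omega>)\<^sup>2) = expectation (\<lambda>\<omega>. (\<beta> i \<omega>)\<^sup>2) * v"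
      unfolding \<xi>_def power_mult_distrib using indep_var_lebesgue_integral[OF ind \<beta>(2)[OF i] g2(1)] g2(2) by simp
    also have "\<dots> \<le> C * v" using \<beta>(3)[OF i] v by (rule mult_right_mono)
    finally show "expectation (\<lambda>\<omega>. (\<xi> i \<omega>)\<^sup>2) \<le> C * v" .
  qed
  have prod: "integrable M (\<lambda>\<omega>. f \<omega> * k \<omega>)"
    if [measurable]: "f \<in> borel_measurable M" "k \<in> borel_measurable M"
      and "integrable M (\<lambda>\<omega>. (f \<omega>)\<^sup>2)" "integrable M (\<lambda>\<omega>. (k \<omega>)\<^sup>2)" for f k :: "'a \<Rightarrow> real"
  proof (rule Bochner_Integration.integrable_bound)
    show "integrable M (\<lambda>\<omega>. (f \<omega>)\<^sup>2 + (k \<omega>)\<^sup>2)" using that by simp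
    have "\<bar>f \<omega> * k \<omega>\<bar> \<le> (f \<omega>)\<^sup>2 + (k \<omega>)\<^sup>2" for \<omega>
      using sum_squares_bound[of "\<bar>f \<omega>\<bar>" "\<bar>k \<omega>\<bar>"] mult_nonneg_nonneg[of "\<bar>f \<omega>\<bar>" "\<bar>k \<omega>\<bar>"]
      unfolding abs_mult power2_abs by linarith
    then show "AE \<omega> in M. norm (f \<omega> * k \<omega>) \<le> norm ((f \<omega>)\<^sup>2 + (k \<omega>)\<^sup>2)"
      by (auto intro: order_trans abs_ge_self)
  qed measurable
  have lt: "expectation (\<lambda>\<omega>. \<xi> i \<omega> * \<xi> j \<omega>) = 0" if ij: "i < j" "j < n" for i j
  proof -
    have i: "i < n" using ij by simp
    have "\<beta> i \<in> borel_measurable (F (real j * h))"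
      using measurable_from_subalg[OF filtration(2) \<beta>(1)[OF i], of j] ij by simp
    then have "(\<lambda>\<omega>. \<xi> i \<omega> * \<beta> j \<omega>) \<in> borel_measurable (F (real j * h))"
      unfolding \<xi>_def using zinc_adapted[OF ij(1)] \<beta>(1)[OF ij(2)] by measurable
    from indep_past_zinc[OF this gm]
    have ind: "indep_var borel (\<lambda>\<omega>. \<xi> i \<omega> * \<beta> j \<omega>) borel (\<lambda>\<omega>. g (zinc W h j \<omega>))" .
    have "integrable M (\<lambda>\<omega>. \<xi> i \<omega> * \<beta> j \<omega>)"
      by (rule prod[OF \<xi>M[OF i] \<beta>M[OF ij(2)] sq(1)[OF i] \<beta>(2)[OF ij(2)]])
    from indep_var_lebesgue_integral[OF ind this g1(1)] show ?thesis
      by (simp add: g1(2) \<xi>_def[of j] mult.assoc)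
  qed
  have ortho: "expectation (\<lambda>\<omega>. \<xi> i \<omega> * \<xi> j \<omega>) = (if i = j then expectation (\<lambda>\<omega>. (\<xi> i \<omega>)\<^sup>2) else 0)"
    if "i < n" "j < n" for i j
    using lt[of i j] lt[of j i] that by (cases i j rule: linorder_cases) (auto simp: mult.commute power2_eq_square)
  have expand: "(\<Sum>i<n. \<beta> i \<omega> * g (zinc W h i \<omega>))\<^sup>2 = (\<Sum>i<n. \<Sum>j<n. \<xi> i \<omega> * \<xi> j \<omega>)" for \<omega>
    by (simp add: \<xi>_def power2_eq_square sum_product)
  have int: "integrable M (\<lambda>\<omega>. \<xi> i \<omega> * \<xi> j \<omega>)" if "i < n" "j < n" for i j
    using that by (intro prod \<xi>M sq(1))
  show "integrable M (\<lambda>\<omega>. (\<Sum>i<n. \<beta> i \<omega> * g (zinc W h i \<omega>))\<^sup>2)"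
    unfolding expand by (intro Bochner_Integration.integrable_sum int) auto
  have "expectation (\<lambda>\<omega>. (\<Sum>i<n. \<beta> i \<omega> * g (zinc W h i \<omega>))\<^sup>2) = (\<Sum>i<n. \<Sum>j<n. expectation (\<lambda>\<omega>. \<xi> i \<omega> * \<xi> j \<omega>))"
  proof -
    have "expectation (\<lambda>\<omega>. \<Sum>j<n. \<xi> i \<omega> * \<xi> j \<omega>) = (\<Sum>j<n. expectation (\<lambda>\<omega>. \<xi> i \<omega> * \<xi> j \<omega>))" if "i < n" for i
      using int[OF that] by (intro Bochner_Integration.integral_sum) auto
    then show ?thesis
      unfolding expand using int by (subst Bochner_Integration.integral_sum) (auto intro!: Bochner_Integration.integrable_sum)
  qed
  also have "\<dots> = (\<Sum>i<n. expectation (\<lambda>\<omega>. (\<xi> i \<omega>)\<^sup>2))"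
    by (intro sum.cong) (simp_all add: ortho)
  also have "\<dots> \<le> (\<Sum>i<n. C * v)" using sq(2) by (intro sum_mono) auto
  finally show "expectation (\<lambda>\<omega>. (\<Sum>i<n. \<beta> i \<omega> * g (zinc W h i \<omega>))\<^sup>2) \<le> real n * (C * v)" by simp
qed

end

section \<open>The realized covariance\<close>

text \<open>The sum whose Gaussian limit decides the statistic. For \<open>n = 0\<close> the factor
  \<open>1 / sqrt 0\<close> is 0, and so is the value.\<close>

definition centred_gram :: "(real \<Rightarrow> 'a \<Rightarrow> real^'r) \<Rightarrow> real \<Rightarrow> nat \<Rightarrow> 'a \<Rightarrow> real^'r^'r" where
  "centred_gram W h n \<omega> = (1 / sqrt (real n)) *\<^sub>R (\<Sum>i<n. outer (zinc W h i \<omega>) (zinc W h i \<omega>) - mat 1)"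

lemma borel_measurable_matrix_iff:
  fixes f :: "'a \<Rightarrow> real^'n^'m"
  shows "f \<in> borel_measurable M \<longleftrightarrow> (\<forall>i j. (\<lambda>x. f x $ i $ j) \<in> borel_measurable M)"
proof -
  have "(\<lambda>x. f x $ i $ j) = (\<lambda>x. f x \<bullet> axis i (axis j 1))" for i j
    by (simp add: inner_axis)
  then show ?thesis
    by (subst borel_measurable_euclidean_space) (auto simp: Basis_vec_def)
qed

lemma inner_outer: "outer x y \<bullet> (G::real^'n^'m) = x \<bullet> (G *v y)"
  by (simp add: inner_matrix outer_def inner_vec_def matrix_vector_mult_def sum_distrib_left ac_simps)

lemma inner_mat_1: "mat 1 \<bullet> (G::real^'n^'n) = trace G"
proof -
  have "mat 1 \<bullet> G = (\<Sum>i\<in>UNIV. \<Sum>j\<in>UNIV. if i = j then G $ i $ j else 0)"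
    unfolding inner_matrix by (intro sum.cong refl) (simp add: mat_def)
  then show ?thesis by (simp add: trace_def)
qed

text \<open>Paired with a symmetric matrix and divided by sqrt 2, the sum is one of n independent
  copies of a centred variable with variance |G|^2, divided by sqrt n. The increments differ for
  every n but their law does not, so the characteristic function is the n-th power of a fixed one at
  1 / sqrt n.\<close>

lemma centred_gram_char_tendsto:
  fixes G :: "real^'r^'r"
  assumes M: "prob_space M" and W: "gaussian_noise M F W" and h: "\<And>n. 0 < h n" and sym: "transpose G = G"
  shows "(\<lambda>n. \<integral>\<omega>. iexp ((centred_gram W (h n) n \<omega> \<bullet> G) / sqrt 2) \<partial>M) \<longlonglongrightarrow> complex_of_real (exp (- (norm G)\<^sup>2 / 2))"
proof -
  interpret prob_space M by fact
  interpret G: prob_space "std_gauss :: (real^'r) measure" by (rule prob_space_std_gauss)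
  define q where "q z = (z \<bullet> (G *v z) - trace G) / sqrt 2" for z
  have qm[measurable]: "q \<in> borel_measurable borel"
    unfolding q_def
    by (intro borel_measurable_continuous_onI continuous_intros matrix_vector_mult_linear_continuous_on) auto
  have qm': "q \<in> borel_measurable (std_gauss :: (real^'r) measure)"
    unfolding measurable_cong_sets[OF sets_std_gauss(1) refl] by (rule qm)
  define \<mu> where "\<mu> = distr (std_gauss :: (real^'r) measure) borel q"
  interpret \<mu>: real_distribution \<mu>
    unfolding \<mu>_def by (rule G.real_distribution_distr) (rule qm')
  have q1: "has_bochner_integral std_gauss q 0" and q2: "has_bochner_integral std_gauss (\<lambda>z. (q z)\<^sup>2) ((norm G)\<^sup>2)"
  proof -
    show "has_bochner_integral std_gauss q 0"
      using has_bochner_integral_divide_zero[OF std_gauss_quadratic_form(1)[OF sym], of "sqrt 2"]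
      by (simp add: q_def[abs_def])
    show "has_bochner_integral std_gauss (\<lambda>z. (q z)\<^sup>2) ((norm G)\<^sup>2)"
      using has_bochner_integral_divide_zero[OF std_gauss_quadratic_form(2)[OF sym], of 2]
      by (simp add: q_def[abs_def] power_divide)
  qed
  have \<mu>1: "integrable \<mu> (\<lambda>x. x)" "\<mu>.expectation (\<lambda>x. x) = 0" and \<mu>2: "integrable \<mu> (\<lambda>x. x\<^sup>2)" "\<mu>.expectation (\<lambda>x. x\<^sup>2) = (norm G)\<^sup>2"
    unfolding \<mu>_def using q1 q2
    by (auto simp: has_bochner_integral_iff integrable_distr_eq[OF qm'] integral_distr[OF qm'])
  define \<psi> where "\<psi> n = char \<mu> (1 / sqrt (real n))" for n
  define \<phi> where "\<phi> n = (\<integral>\<omega>. iexp ((centred_gram W (h n) n \<omega> \<bullet> G) / sqrt 2) \<partial>M)" for n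
  have \<phi>: "\<phi> n = \<psi> n ^ n" for n
  proof -
    define f where "f z = iexp (1 / sqrt (real n) * q z)" for z :: "real^'r"
    have f: "integrable std_gauss f"
      unfolding f_def using qm' by (intro G.integrable_const_bound[where B=1]) auto
    have "(centred_gram W (h n) n \<omega> \<bullet> G) / sqrt 2 = (\<Sum>i<n. 1 / sqrt (real n) * q (zinc W (h n) i \<omega>))" for \<omega>
      by (simp add: centred_gram_def inner_sum_left inner_diff_left inner_outer inner_mat_1 q_def
          sum_distrib_left sum_divide_distrib diff_divide_distrib right_diff_distrib)
    then have "\<phi> n = (\<integral>\<omega>. (\<Prod>i<n. f (zinc W (h n) i \<omega>)) \<partial>M)"
      by (simp add: \<phi>_def f_def exp_sum[symmetric] sum_distrib_left)
    also have "\<dots> = (\<integral>z. f z \<partial>std_gauss) ^ n"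
      using expectation_prod_zinc[OF M W h f] by blast
    also have "(\<integral>z. f z \<partial>std_gauss) = \<psi> n"
      unfolding \<psi>_def char_def \<mu>_def f_def by (simp add: integral_distr[OF qm'])
    finally show ?thesis .
  qed
  let ?s = "(norm G)\<^sup>2"
  let ?e = "\<lambda>n. LINT x|\<mu>. min (6 * x\<^sup>2) (\<bar>1 / sqrt (real n)\<bar> * \<bar>x\<bar> ^ 3)"
  \<comment> \<open>The n-th powers of two numbers in the unit disc differ by at most n times their
    difference; n at least |G|^2 keeps 1 - |G|^2 / (2 n) in the disc.\<close>
  have main: "\<forall>\<^sub>F n in sequentially. cmod (\<phi> n - complex_of_real ((1 + (- ?s / 2) / real n) ^ n)) \<le> 1 / 6 * ?e n"
    using eventually_ge_at_top[of "nat \<lceil>?s\<rceil> + 1"]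
  proof eventually_elim
    case (elim n)
    then have n: "real n \<ge> ?s" "0 < real n" by linarith+
    have **: "norm (\<psi> n - complex_of_real (1 + (- ?s / 2) / real n)) \<le> 1 / real n / 6 * ?e n"
      using \<mu>.char_approx3[OF \<mu>1 \<mu>2(1), of ?s "1 / sqrt (real n)"] \<mu>1 \<mu>2 n
      by (simp add: \<psi>_def power_divide field_simps)
    have "norm (\<phi> n - complex_of_real ((1 + (- ?s / 2) / real n) ^ n)) \<le>
        real n * norm (\<psi> n - complex_of_real (1 + (- ?s / 2) / real n))"
      unfolding \<phi> of_real_power
    proof (rule norm_power_diff)
      show "cmod (\<psi> n) \<le> 1" unfolding \<psi>_def by (rule \<mu>.cmod_char_le_1)
      have "?s / 2 / real n \<le> 1 / 2" "0 \<le> ?s / 2 / real n" using n by (simp_all add: field_simps)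
      then show "cmod (complex_of_real (1 + (- ?s / 2) / real n)) \<le> 1"
        unfolding norm_of_real by (simp only: minus_divide_left[symmetric])
    qed
    also have "\<dots> \<le> real n * (1 / real n / 6 * ?e n)"
      by (rule mult_left_mono[OF **]) simp
    also have "\<dots> = 1 / 6 * ?e n" using n by simp
    finally show ?case .
  qed
  \<comment> \<open>The minimum is dominated by 6 x^2, which is integrable, and tends to 0
    pointwise; second moments suffice.\<close>
  have "(\<lambda>n. ?e n) \<longlonglongrightarrow> (LINT x|\<mu>. 0)"
  proof (rule integral_dominated_convergence[where w="\<lambda>x. 6 * x\<^sup>2"])
    have lim: "(\<lambda>n. min (6 * x\<^sup>2) (\<bar>1 / sqrt (real n)\<bar> * \<bar>x\<bar> ^ 3)) \<longlonglongrightarrow> 0" for x :: real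
    proof (rule tendsto_sandwich[of "\<lambda>_. 0" _ _ "\<lambda>n. \<bar>x\<bar> ^ 3 * (1 / sqrt (real n))"])
      have "(\<lambda>n. 1 / sqrt (real n)) \<longlonglongrightarrow> 0"
        by (intro tendsto_divide_0[OF tendsto_const] filterlim_at_top_imp_at_infinity
            filterlim_compose[OF sqrt_at_top filterlim_real_sequentially])
      then show "(\<lambda>n. \<bar>x\<bar> ^ 3 * (1 / sqrt (real n))) \<longlonglongrightarrow> 0"
        by (rule tendsto_mult_right_zero)
    qed (auto simp: mult.commute)
    then show "AE x in \<mu>. (\<lambda>n. min (6 * x\<^sup>2) (\<bar>1 / sqrt (real n)\<bar> * \<bar>x\<bar> ^ 3)) \<longlonglongrightarrow> 0" by simp
  qed (use \<mu>2 in \<open>auto simp: \<mu>_def\<close>)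
  then have e0: "(\<lambda>n. 1 / 6 * ?e n) \<longlonglongrightarrow> 0" by (simp add: tendsto_mult_right_zero)
  have "(\<lambda>n. complex_of_real ((1 + (- ?s / 2) / real n) ^ n)) \<longlonglongrightarrow> complex_of_real (exp (- ?s / 2))"
    by (rule tendsto_of_real[OF tendsto_exp_limit_sequentially])
  then have "\<phi> \<longlonglongrightarrow> complex_of_real (exp (- ?s / 2))"
    by (rule Lim_transform) (rule Lim_null_comparison[OF main e0])
  then show ?thesis unfolding \<phi>_def[abs_def] .
qed

lemma power2_norm_matrix: "(norm (A::real^'n^'m))\<^sup>2 = (\<Sum>i\<in>UNIV. \<Sum>j\<in>UNIV. (A $ i $ j)\<^sup>2)"
  unfolding power2_norm_eq_inner inner_matrix by (simp add: power2_eq_square)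

text \<open>\<open>martingale_L2\<close> with all coefficients 1. An entry has variance 1, or 2 on
  the diagonal; the bound 2 for each entry gives the constant.\<close>

lemma centred_gram_L2:
  fixes W :: "real \<Rightarrow> 'a \<Rightarrow> real^'r"
  assumes M: "prob_space M" and W: "gaussian_noise M F W" and h: "0 < h" and n: "0 < n"
  shows "centred_gram W h n \<in> borel_measurable M"
    and "integrable M (\<lambda>\<omega>. (norm (centred_gram W h n \<omega>))\<^sup>2)"
    and "(\<integral>\<omega>. (norm (centred_gram W h n \<omega>))\<^sup>2 \<partial>M) \<le> 2 * (real CARD('r))\<^sup>2"
proof -
  interpret prob_space M by fact
  have e: "centred_gram W h n \<omega> $ a $ b =
      1 / sqrt (real n) * (\<Sum>i<n. 1 * (zinc W h i \<omega> $ a * zinc W h i \<omega> $ b - of_bool (a = b)))" for \<omega> a b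
    by (simp add: centred_gram_def outer_def mat_def of_bool_def)
  note [measurable] = zinc_measurable[OF M W h]
  show "centred_gram W h n \<in> borel_measurable M"
    unfolding borel_measurable_matrix_iff e by measurable
  have L2: "integrable M (\<lambda>\<omega>. (centred_gram W h n \<omega> $ a $ b)\<^sup>2)"
    "expectation (\<lambda>\<omega>. (centred_gram W h n \<omega> $ a $ b)\<^sup>2) \<le> 2" for a b
  proof -
    have sq: "has_bochner_integral std_gauss (\<lambda>z::real^'r. (z $ a * z $ b - of_bool (a = b))\<^sup>2) (1 + of_bool (a = b))"
      using std_gauss_centred_products(2)[of a b a b] by (auto simp: power2_eq_square)
    note m = martingale_L2[OF M W h _ _ _ std_gauss_centred_products(1)[of a b] sq, of n "\<lambda>_ _. 1" 1, simplified]
    have m1: "integrable M (\<lambda>\<omega>. (\<Sum>i<n. zinc W h i \<omega> $ a * zinc W h i \<omega> $ b - of_bool (a = b))\<^sup>2)"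
      and m2: "expectation (\<lambda>\<omega>. (\<Sum>i<n. zinc W h i \<omega> $ a * zinc W h i \<omega> $ b - of_bool (a = b))\<^sup>2) \<le> real n * (1 + of_bool (a = b))"
      using m by (auto simp: prob_space[simplified])
    have sq': "(centred_gram W h n \<omega> $ a $ b)\<^sup>2 = 1 / real n * (\<Sum>i<n. zinc W h i \<omega> $ a * zinc W h i \<omega> $ b - of_bool (a = b))\<^sup>2" for \<omega>
      unfolding e by (simp add: power_mult_distrib power_divide)
    show "integrable M (\<lambda>\<omega>. (centred_gram W h n \<omega> $ a $ b)\<^sup>2)" unfolding sq' using m1 by simp
    have "expectation (\<lambda>\<omega>. (centred_gram W h n \<omega> $ a $ b)\<^sup>2) \<le> 1 / real n * (real n * (1 + of_bool (a = b)))"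
      unfolding sq' integral_mult_right_zero by (intro mult_left_mono m2) auto
    also have "\<dots> \<le> 2" using n by simp
    finally show "expectation (\<lambda>\<omega>. (centred_gram W h n \<omega> $ a $ b)\<^sup>2) \<le> 2" .
  qed
  show "integrable M (\<lambda>\<omega>. (norm (centred_gram W h n \<omega>))\<^sup>2)"
    unfolding power2_norm_matrix using L2 by auto
  have "(\<integral>\<omega>. (norm (centred_gram W h n \<omega>))\<^sup>2 \<partial>M) =
      (\<Sum>a\<in>UNIV. \<Sum>b\<in>UNIV. expectation (\<lambda>\<omega>. (centred_gram W h n \<omega> $ a $ b)\<^sup>2))"
    unfolding power2_norm_matrix using L2 by (simp add: Bochner_Integration.integral_sum)
  also have "\<dots> \<le> (\<Sum>a\<in>(UNIV::'r set). \<Sum>b\<in>(UNIV::'r set). 2)" by (intro sum_mono L2)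
  also have "\<dots> = 2 * (real CARD('r))\<^sup>2" by (simp add: power2_eq_square)
  finally show "(\<integral>\<omega>. (norm (centred_gram W h n \<omega>))\<^sup>2 \<partial>M) \<le> 2 * (real CARD('r))\<^sup>2" .
qed

lemma outer_linear:
  "outer (x + y) z = outer x z + outer y z" "outer z (x + y) = outer z x + outer z y"
  "outer (c *\<^sub>R x) z = c *\<^sub>R outer x z" "outer z (c *\<^sub>R x) = c *\<^sub>R outer z x"
  by (simp_all add: outer_def vec_eq_iff algebra_simps)

lemma norm_outer: "norm (outer x y) = norm x * norm y"
proof -
  have "(norm (outer x y))\<^sup>2 = (norm x * norm y)\<^sup>2"
    unfolding power2_norm_matrix power_mult_distrib power2_norm_eq_inner inner_vec_def
    by (simp add: outer_def sum_product power2_eq_square ac_simps) (rule sum.swap)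
  then show ?thesis by simp
qed

lemma outer_matrix_mult: "outer (A *v x) (B *v y) = A ** outer x y ** transpose B"
  by (simp add: vec_eq_iff outer_def matrix_matrix_mult_def matrix_vector_mult_def transpose_def
      sum_distrib_left sum_distrib_right ac_simps)

lemma norm_matrix_le_sum: "norm (A::real^'n^'m) \<le> (\<Sum>i\<in>UNIV. \<Sum>j\<in>UNIV. \<bar>A $ i $ j\<bar>)"
proof -
  have "norm A \<le> (\<Sum>i\<in>UNIV. norm (A $ i))" unfolding norm_vec_def by (rule L2_set_le_sum) simp
  also have "\<dots> \<le> (\<Sum>i\<in>UNIV. \<Sum>j\<in>UNIV. \<bar>A $ i $ j\<bar>)" by (intro sum_mono norm_le_l1_cart)
  finally show ?thesis .
qed

lemma nn_integral_le_imp_integrable: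
  fixes f :: "'a \<Rightarrow> real"
  assumes [measurable]: "f \<in> borel_measurable M" and "\<And>\<omega>. 0 \<le> f \<omega>" "(\<integral>\<^sup>+\<omega>. ennreal (f \<omega>) \<partial>M) \<le> ennreal c" "0 \<le> c"
  shows "integrable M f" "(\<integral>\<omega>. f \<omega> \<partial>M) \<le> c"
proof -
  show *: "integrable M f"
    using assms by (intro integrableI_nonneg) (auto simp: order_le_less_trans)
  show "(\<integral>\<omega>. f \<omega> \<partial>M) \<le> c"
    using nn_integral_eq_integral[OF *] assms by (simp add: ennreal_le_iff)
qed

lemma linear_std_gauss:
  fixes \<sigma> :: "real^'r^'p"
  shows "has_bochner_integral std_gauss (\<lambda>z. (\<sigma> *v z) $ c) 0"
    and "has_bochner_integral std_gauss (\<lambda>z. ((\<sigma> *v z) $ c)\<^sup>2) ((norm (\<sigma> $ c))\<^sup>2)"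
proof -
  have "has_bochner_integral std_gauss (\<lambda>z::real^'r. \<Sum>a\<in>UNIV. \<sigma> $ c $ a * z $ a) (\<Sum>a\<in>UNIV. \<sigma> $ c $ a * 0)"
    by (intro has_bochner_integral_sum has_bochner_integral_mult_right std_gauss_moments)
  then show "has_bochner_integral std_gauss (\<lambda>z. (\<sigma> *v z) $ c) 0"
    by (simp add: matrix_vector_mult_def)
  have "has_bochner_integral std_gauss (\<lambda>z::real^'r. \<Sum>a\<in>UNIV. \<Sum>b\<in>UNIV. (\<sigma> $ c $ a * \<sigma> $ c $ b) * (z $ a * z $ b))
     (\<Sum>a\<in>UNIV. \<Sum>b\<in>UNIV. (\<sigma> $ c $ a * \<sigma> $ c $ b) * of_bool (a = b))"
    by (intro has_bochner_integral_sum has_bochner_integral_mult_right std_gauss_moments)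
  moreover have "(\<Sum>a\<in>UNIV. \<Sum>b\<in>UNIV. (\<sigma> $ c $ a * \<sigma> $ c $ b) * of_bool (a = b)) = (norm (\<sigma> $ c))\<^sup>2"
    unfolding power2_norm_eq_inner inner_vec_def by (simp add: of_bool_def if_distrib cong: if_cong)
  moreover have "((\<sigma> *v z) $ c)\<^sup>2 = (\<Sum>a\<in>UNIV. \<Sum>b\<in>UNIV. (\<sigma> $ c $ a * \<sigma> $ c $ b) * (z $ a * z $ b))" for z
    by (simp add: matrix_vector_mult_def power2_eq_square sum_product ac_simps)
  ultimately show "has_bochner_integral std_gauss (\<lambda>z. ((\<sigma> *v z) $ c)\<^sup>2) ((norm (\<sigma> $ c))\<^sup>2)" by simp
qed

text \<open>Write an increment of \<open>X\<close> as D + N with D = h \<beta> + R. N N^T gives the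
  Gram term. D D^T is of order h^2, and so is R N^T, since R has size h^(3/2) and N size h^(1/2). A
  single h \<beta> N^T has size h^(3/2), but these terms sum as a martingale to sqrt n h^(3/2).
  Division by sqrt n h leaves sqrt n h and sqrt h.\<close>

lemma realized_cov_remainder:
  fixes W :: "real \<Rightarrow> 'a \<Rightarrow> real^'r" and X :: "real \<Rightarrow> 'a \<Rightarrow> real^'p" and \<sigma> :: "real^'r^'p"
  assumes M: "prob_space M" and W: "gaussian_noise M F W"
    and X: "ito_increments M F (\<lambda>t \<omega>. \<sigma> *v W t \<omega>) X"
  defines "Rem \<equiv> (\<lambda>h n \<omega>. sqrt (real n) *\<^sub>R (realized_cov n h (\<lambda>t. X t \<omega>) - \<sigma> ** transpose \<sigma>) -
      \<sigma> ** centred_gram W h n \<omega> ** transpose \<sigma>)"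
  shows "\<exists>K. \<forall>h n. 0 < h \<longrightarrow> h \<le> 1 \<longrightarrow> 0 < n \<longrightarrow> Rem h n \<in> borel_measurable M \<and>
    integrable M (\<lambda>\<omega>. norm (Rem h n \<omega>)) \<and> (\<integral>\<omega>. norm (Rem h n \<omega>) \<partial>M) \<le> K * (sqrt (real n) * h + sqrt h)"
proof -
  interpret prob_space M by fact
  have Xm: "X t \<in> borel_measurable M" if "0 \<le> t" for t using X that unfolding ito_increments_def by blast
  have Fm: "subalgebra M (F t)" if "0 \<le> t" for t using X that unfolding ito_increments_def by blast
  obtain C where C: "0 \<le> C" "\<And>s. 0 \<le> s \<Longrightarrow> drift_step M F (\<lambda>t \<omega>. \<sigma> *v W t \<omega>) X C s"
    using X unfolding ito_increments_def by blast
  define v where "v = (norm \<sigma>)\<^sup>2"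
  have v: "0 \<le> v" by (simp add: v_def)
  define p where "p = real CARD('p)"
  define K where "K = 5 * C + v + p\<^sup>2 * (1 + C * v)"
  have main: "Rem h n \<in> borel_measurable M \<and> integrable M (\<lambda>\<omega>. norm (Rem h n \<omega>)) \<and>
    (\<integral>\<omega>. norm (Rem h n \<omega>) \<partial>M) \<le> K * (sqrt (real n) * h + sqrt h)" if h: "0 < h" "h \<le> 1" and n: "0 < n" for h n
  proof -
    define t where "t i = real i * h" for i
    have t: "0 \<le> t i" "t (Suc i) = t i + h" for i using h by (simp_all add: t_def algebra_simps)
    have ex: "\<forall>i. \<exists>\<beta>. \<beta> \<in> borel_measurable (F (t i)) \<and> msq M \<beta> \<le> ennreal C \<and>
       msq M (\<lambda>\<omega>. X (t (Suc i)) \<omega> - X (t i) \<omega> - h *\<^sub>R \<beta> \<omega> - (\<sigma> *v W (t (Suc i)) \<omega> - \<sigma> *v W (t i) \<omega>)) \<le> ennreal (C * h ^ 3)"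
      using C(2)[OF t(1)] h unfolding t(2) by blast
    obtain \<beta> where \<beta>: "\<forall>i. \<beta> i \<in> borel_measurable (F (t i)) \<and> msq M (\<beta> i) \<le> ennreal C \<and>
       msq M (\<lambda>\<omega>. X (t (Suc i)) \<omega> - X (t i) \<omega> - h *\<^sub>R \<beta> i \<omega> - (\<sigma> *v W (t (Suc i)) \<omega> - \<sigma> *v W (t i) \<omega>)) \<le> ennreal (C * h ^ 3)"
      using choice[OF ex] by (elim exE)
    then have \<beta>F: "\<And>i. \<beta> i \<in> borel_measurable (F (t i))"
      and \<beta>2: "\<And>i. msq M (\<beta> i) \<le> ennreal C"
      and R2: "\<And>i. msq M (\<lambda>\<omega>. X (t (Suc i)) \<omega> - X (t i) \<omega> - h *\<^sub>R \<beta> i \<omega> - (\<sigma> *v W (t (Suc i)) \<omega> - \<sigma> *v W (t i) \<omega>)) \<le> ennreal (C * h ^ 3)"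
      by blast+
    note [measurable] = zinc_measurable[OF M W h(1)] Xm[OF t(1)] measurable_from_subalg[OF Fm[OF t(1)] \<beta>F]
    define N where "N i \<omega> = sqrt h *\<^sub>R (\<sigma> *v zinc W h i \<omega>)" for i \<omega>
    have \<sigma>m[measurable]: "(*v) \<sigma> \<in> borel_measurable borel"
      by (intro borel_measurable_continuous_onI linear_continuous_on) simp
    have Nm[measurable]: "N i \<in> borel_measurable M" for i unfolding N_def by measurable
    have N: "N i \<omega> = \<sigma> *v W (t (Suc i)) \<omega> - \<sigma> *v W (t i) \<omega>" for i \<omega>
      using h by (simp add: N_def zinc_def t_def matrix_vector_mult_scaleR matrix_vector_mult_diff_distrib)
    define R where "R i \<omega> = X (t (Suc i)) \<omega> - X (t i) \<omega> - h *\<^sub>R \<beta> i \<omega> - N i \<omega>" for i \<omega>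
    have Rm[measurable]: "R i \<in> borel_measurable M" for i unfolding R_def by measurable
    have R: "integrable M (\<lambda>\<omega>. (norm (R i \<omega>))\<^sup>2)" "(\<integral>\<omega>. (norm (R i \<omega>))\<^sup>2 \<partial>M) \<le> C * h ^ 3" for i
    proof -
      have "msq M (R i) \<le> ennreal (C * h ^ 3)"
        using R2[of i] by (simp only: R_def N)
      then show "integrable M (\<lambda>\<omega>. (norm (R i \<omega>))\<^sup>2)" "(\<integral>\<omega>. (norm (R i \<omega>))\<^sup>2 \<partial>M) \<le> C * h ^ 3"
        using C(1) h by (intro nn_integral_le_imp_integrable[where c="C * h ^ 3"]; simp)+
    qed
    have \<beta>: "integrable M (\<lambda>\<omega>. (norm (\<beta> i \<omega>))\<^sup>2)" "(\<integral>\<omega>. (norm (\<beta> i \<omega>))\<^sup>2 \<partial>M) \<le> C" for i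
      using \<beta>2[of i] C(1) by (intro nn_integral_le_imp_integrable[where c=C]; simp)+
    have NI: "integrable M (\<lambda>\<omega>. (norm (\<sigma> *v zinc W h i \<omega>))\<^sup>2)" "(\<integral>\<omega>. (norm (\<sigma> *v zinc W h i \<omega>))\<^sup>2 \<partial>M) = v" for i
    proof -
      have "has_bochner_integral std_gauss (\<lambda>z. \<Sum>c\<in>UNIV. ((\<sigma> *v z) $ c)\<^sup>2) (\<Sum>c\<in>UNIV. (norm (\<sigma> $ c))\<^sup>2)"
        by (intro has_bochner_integral_sum linear_std_gauss)
      moreover have "(\<Sum>c\<in>UNIV. (norm (\<sigma> $ c))\<^sup>2) = v"
        unfolding v_def power2_norm_eq_inner inner_vec_def[of \<sigma> \<sigma>] ..
      moreover have "(norm x)\<^sup>2 = (\<Sum>c\<in>UNIV. (x $ c)\<^sup>2)" for x :: "real^'p"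
        unfolding power2_norm_eq_inner inner_vec_def by (simp add: power2_eq_square)
      ultimately have "has_bochner_integral std_gauss (\<lambda>z. (norm (\<sigma> *v z))\<^sup>2) v" by simp
      from has_integral_zinc[OF M W h(1) this, of i]
      show "integrable M (\<lambda>\<omega>. (norm (\<sigma> *v zinc W h i \<omega>))\<^sup>2)" "(\<integral>\<omega>. (norm (\<sigma> *v zinc W h i \<omega>))\<^sup>2 \<partial>M) = v"
        by (auto simp: has_bochner_integral_iff)
    qed
    define D where "D i \<omega> = h *\<^sub>R \<beta> i \<omega> + R i \<omega>" for i \<omega>
    \<comment> \<open>The mixed terms with the powers of \<open>h\<close> taken out: h from the
      drift and sqrt h from the noise.\<close>
    define B where "B \<omega> = (\<Sum>i<n. outer (\<beta> i \<omega>) (\<sigma> *v zinc W h i \<omega>))" for \<omega>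
    have inc: "X (t (Suc i)) \<omega> - X (t i) \<omega> = D i \<omega> + N i \<omega>" for i \<omega> by (simp add: D_def R_def)
    \<comment> \<open>This is sqrt n times the factor 1 / (n h) of the realized covariance.\<close>
    define c where "c = 1 / (sqrt (real n) * h)"
    have c: "0 < c" using n h by (simp add: c_def)
    have Q: "realized_cov n h (\<lambda>t. X t \<omega>) = (1 / (real n * h)) *\<^sub>R (\<Sum>i<n. outer (D i \<omega> + N i \<omega>) (D i \<omega> + N i \<omega>))" for \<omega>
    proof -
      have "(\<Sum>i=1..n. outer (X (real i * h) \<omega> - X (real (i - 1) * h) \<omega>) (X (real i * h) \<omega> - X (real (i - 1) * h) \<omega>)) =
          (\<Sum>i<n. outer (X (t (Suc i)) \<omega> - X (t i) \<omega>) (X (t (Suc i)) \<omega> - X (t i) \<omega>))"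
        unfolding t_def One_nat_def sum.atLeast1_atMost_eq by simp
      then show ?thesis unfolding realized_cov_def inc by simp
    qed
    have outN: "outer (N i \<omega>) (N i \<omega>) = h *\<^sub>R (\<sigma> ** outer (zinc W h i \<omega>) (zinc W h i \<omega>) ** transpose \<sigma>)" for i \<omega>
      using h by (simp add: N_def outer_linear outer_matrix_mult)
    have lin: "linear (\<lambda>A::real^'r^'r. \<sigma> ** A ** transpose \<sigma>)" by (rule linear_congruence)
    have sgram: "\<sigma> ** centred_gram W h n \<omega> ** transpose \<sigma> =
        c *\<^sub>R (\<Sum>i<n. outer (N i \<omega>) (N i \<omega>)) - sqrt (real n) *\<^sub>R (\<sigma> ** transpose \<sigma>)" for \<omega>
    proof -
      have "\<sigma> ** centred_gram W h n \<omega> ** transpose \<sigma> = (1 / sqrt (real n)) *\<^sub>R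
          (\<Sum>i<n. \<sigma> ** outer (zinc W h i \<omega>) (zinc W h i \<omega>) ** transpose \<sigma> - \<sigma> ** mat 1 ** transpose \<sigma>)"
        unfolding centred_gram_def linear_scale[OF lin] linear_sum[OF lin] linear_diff[OF lin] ..
      also have "\<dots> = (1 / sqrt (real n)) *\<^sub>R (\<Sum>i<n. \<sigma> ** outer (zinc W h i \<omega>) (zinc W h i \<omega>) ** transpose \<sigma>)
          - (1 / sqrt (real n) * real n) *\<^sub>R (\<sigma> ** transpose \<sigma>)"
        by (simp add: sum_subtractf scaleR_diff_right sum_constant_scaleR del: sum_constant)
      also have "1 / sqrt (real n) * real n = sqrt (real n)" using n by (simp add: real_div_sqrt)
      also have "(1 / sqrt (real n)) *\<^sub>R (\<Sum>i<n. \<sigma> ** outer (zinc W h i \<omega>) (zinc W h i \<omega>) ** transpose \<sigma>) =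
          c *\<^sub>R (\<Sum>i<n. outer (N i \<omega>) (N i \<omega>))"
        unfolding outN scaleR_sum_right[symmetric] using h by (simp add: c_def)
      finally show ?thesis .
    qed
    have cn: "sqrt (real n) * (1 / (real n * h)) = c"
    proof -
      have "r * (1 / ((r * r) * h)) = 1 / (r * h)" if "0 < r" for r :: real using that by simp
      from this[of "sqrt (real n)"] show ?thesis using n by (simp add: c_def)
    qed
    have Rem: "Rem h n \<omega> = c *\<^sub>R ((\<Sum>i<n. outer (D i \<omega>) (D i \<omega>) + outer (R i \<omega>) (N i \<omega>) + outer (N i \<omega>) (R i \<omega>)) +
        (h * sqrt h) *\<^sub>R (B \<omega> + transpose (B \<omega>)))" for \<omega>
    proof -
      have tr: "transpose (outer x y) = outer y x" for x y :: "real^'p"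
        by (simp add: outer_def transpose_def vec_eq_iff mult.commute)
      have "linear (transpose :: real^'p^'p \<Rightarrow> _)" by (rule linearI) (simp_all add: transpose_def vec_eq_iff)
      then have trB: "transpose (B \<omega>) = (\<Sum>i<n. outer (\<sigma> *v zinc W h i \<omega>) (\<beta> i \<omega>))"
        unfolding B_def by (simp add: linear_sum tr)
      have "Rem h n \<omega> = c *\<^sub>R (\<Sum>i<n. outer (D i \<omega> + N i \<omega>) (D i \<omega> + N i \<omega>)) - c *\<^sub>R (\<Sum>i<n. outer (N i \<omega>) (N i \<omega>))"
        unfolding Rem_def Q sgram by (simp add: scaleR_diff_right cn[symmetric])
      also have "\<dots> = c *\<^sub>R (\<Sum>i<n. outer (D i \<omega> + N i \<omega>) (D i \<omega> + N i \<omega>) - outer (N i \<omega>) (N i \<omega>))"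
        by (simp add: sum_subtractf scaleR_diff_right)
      also have "(\<Sum>i<n. outer (D i \<omega> + N i \<omega>) (D i \<omega> + N i \<omega>) - outer (N i \<omega>) (N i \<omega>)) =
          (\<Sum>i<n. (outer (D i \<omega>) (D i \<omega>) + outer (R i \<omega>) (N i \<omega>) + outer (N i \<omega>) (R i \<omega>)) +
            (h * sqrt h) *\<^sub>R (outer (\<beta> i \<omega>) (\<sigma> *v zinc W h i \<omega>) + outer (\<sigma> *v zinc W h i \<omega>) (\<beta> i \<omega>)))"
      proof (intro sum.cong refl)
        fix i
        have "outer (D i \<omega> + N i \<omega>) (D i \<omega> + N i \<omega>) - outer (N i \<omega>) (N i \<omega>) =
            outer (D i \<omega>) (D i \<omega>) + outer (D i \<omega>) (N i \<omega>) + outer (N i \<omega>) (D i \<omega>)"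
          by (simp add: outer_linear)
        also have "outer (D i \<omega>) (N i \<omega>) = outer (R i \<omega>) (N i \<omega>) + (h * sqrt h) *\<^sub>R outer (\<beta> i \<omega>) (\<sigma> *v zinc W h i \<omega>)"
          by (simp add: D_def N_def outer_linear scaleR_add_right mult.commute)
        also have "outer (N i \<omega>) (D i \<omega>) = outer (N i \<omega>) (R i \<omega>) + (h * sqrt h) *\<^sub>R outer (\<sigma> *v zinc W h i \<omega>) (\<beta> i \<omega>)"
          by (simp add: D_def N_def outer_linear scaleR_add_right mult.commute)
        finally show "outer (D i \<omega> + N i \<omega>) (D i \<omega> + N i \<omega>) - outer (N i \<omega>) (N i \<omega>) =
          (outer (D i \<omega>) (D i \<omega>) + outer (R i \<omega>) (N i \<omega>) + outer (N i \<omega>) (R i \<omega>)) +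
            (h * sqrt h) *\<^sub>R (outer (\<beta> i \<omega>) (\<sigma> *v zinc W h i \<omega>) + outer (\<sigma> *v zinc W h i \<omega>) (\<beta> i \<omega>))"
          by (simp add: scaleR_add_right)
      qed
      finally show ?thesis
        unfolding trB unfolding B_def by (simp add: sum.distrib scaleR_sum_right[symmetric])
    qed
    have outer_m: "(\<lambda>\<omega>. outer (f \<omega>) (g \<omega>)) \<in> borel_measurable M"
      if [measurable]: "f \<in> borel_measurable M" "g \<in> borel_measurable M" for f :: "'a \<Rightarrow> real^'p" and g :: "'a \<Rightarrow> real^'p"
      unfolding borel_measurable_matrix_iff by (simp add: outer_def) measurable
    have Dm[measurable]: "D i \<in> borel_measurable M" for i unfolding D_def by measurable
    have szm[measurable]: "(\<lambda>\<omega>. \<sigma> *v zinc W h i \<omega>) \<in> borel_measurable M" for i by measurable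
    have Bm[measurable]: "B \<in> borel_measurable M" unfolding B_def by (intro borel_measurable_sum outer_m) measurable
    have trm[measurable]: "(transpose :: real^'p^'p \<Rightarrow> _) \<in> borel_measurable borel"
    proof -
      have "linear (transpose :: real^'p^'p \<Rightarrow> _)" by (rule linearI) (simp_all add: transpose_def vec_eq_iff)
      then show ?thesis
        by (intro borel_measurable_continuous_onI linear_continuous_on) (simp add: linear_conv_bounded_linear)
    qed
    have RemM[measurable]: "Rem h n \<in> borel_measurable M"
      unfolding Rem[abs_def]
      by (intro borel_measurable_scaleR borel_measurable_add borel_measurable_sum outer_m borel_measurable_const
          measurable_compose[OF Bm trm] Bm Dm Rm Nm)
    \<comment> \<open>The term 2 |R| |N| is split with the weights 1 / h and h^2, so that both
      halves have mean of order h^2.\<close>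
    define E1 where "E1 i \<omega> = 2 * h\<^sup>2 * (norm (\<beta> i \<omega>))\<^sup>2 + (2 + 1 / h) * (norm (R i \<omega>))\<^sup>2 + h\<^sup>2 * (norm (\<sigma> *v zinc W h i \<omega>))\<^sup>2" for i \<omega>
    have E1: "norm (outer (D i \<omega>) (D i \<omega>) + outer (R i \<omega>) (N i \<omega>) + outer (N i \<omega>) (R i \<omega>)) \<le> E1 i \<omega>" for i \<omega>
    proof -
      have "norm (outer (D i \<omega>) (D i \<omega>)) \<le> 2 * h\<^sup>2 * (norm (\<beta> i \<omega>))\<^sup>2 + 2 * (norm (R i \<omega>))\<^sup>2"
      proof -
        have "norm (outer (D i \<omega>) (D i \<omega>)) = (norm (D i \<omega>))\<^sup>2" by (simp add: norm_outer power2_eq_square)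
        also have "\<dots> \<le> (h * norm (\<beta> i \<omega>) + norm (R i \<omega>))\<^sup>2"
          using h norm_triangle_ineq[of "h *\<^sub>R \<beta> i \<omega>" "R i \<omega>"] by (intro power_mono) (auto simp: D_def)
        also have "\<dots> \<le> 2 * (h * norm (\<beta> i \<omega>))\<^sup>2 + 2 * (norm (R i \<omega>))\<^sup>2"
          using sum_squares_bound[of "h * norm (\<beta> i \<omega>)" "norm (R i \<omega>)"] by (simp add: power2_sum)
        finally show ?thesis by (simp add: power_mult_distrib)
      qed
      moreover have "2 * (norm (R i \<omega>) * norm (N i \<omega>)) \<le> 1 / h * (norm (R i \<omega>))\<^sup>2 + h\<^sup>2 * (norm (\<sigma> *v zinc W h i \<omega>))\<^sup>2"
      proof -
        have "2 * (norm (R i \<omega>) / sqrt h) * (h * norm (\<sigma> *v zinc W h i \<omega>)) \<le> (norm (R i \<omega>) / sqrt h)\<^sup>2 + (h * norm (\<sigma> *v zinc W h i \<omega>))\<^sup>2"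
          by (rule sum_squares_bound)
        moreover have "(norm (R i \<omega>) / sqrt h) * (h * norm (\<sigma> *v zinc W h i \<omega>)) = norm (R i \<omega>) * norm (N i \<omega>)"
        proof -
          have "norm (R i \<omega>) / sqrt h * (h * norm (\<sigma> *v zinc W h i \<omega>)) = norm (R i \<omega>) * norm (\<sigma> *v zinc W h i \<omega>) * (h / sqrt h)"
            by simp
          also have "h / sqrt h = sqrt h" using h by (intro real_div_sqrt) simp
          finally show ?thesis using h by (simp add: N_def)
        qed
        ultimately show ?thesis using h by (simp add: power_divide power_mult_distrib mult.assoc)
      qed
      moreover have "norm (outer (D i \<omega>) (D i \<omega>) + outer (R i \<omega>) (N i \<omega>) + outer (N i \<omega>) (R i \<omega>)) \<le>
          norm (outer (D i \<omega>) (D i \<omega>)) + 2 * (norm (R i \<omega>) * norm (N i \<omega>))"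
        using norm_triangle_ineq[of "outer (D i \<omega>) (D i \<omega>) + outer (R i \<omega>) (N i \<omega>)" "outer (N i \<omega>) (R i \<omega>)"]
          norm_triangle_ineq[of "outer (D i \<omega>) (D i \<omega>)" "outer (R i \<omega>) (N i \<omega>)"]
        by (simp add: norm_outer mult.commute)
      ultimately show ?thesis unfolding E1_def distrib_right by linarith
    qed
    have E1I: "integrable M (E1 i)" "(\<integral>\<omega>. E1 i \<omega> \<partial>M) \<le> h\<^sup>2 * (5 * C + v)" for i
    proof -
      show "integrable M (E1 i)" unfolding E1_def using \<beta> R NI by simp
      have "(\<integral>\<omega>. E1 i \<omega> \<partial>M) = 2 * h\<^sup>2 * (\<integral>\<omega>. (norm (\<beta> i \<omega>))\<^sup>2 \<partial>M) + (2 + 1 / h) * (\<integral>\<omega>. (norm (R i \<omega>))\<^sup>2 \<partial>M) + h\<^sup>2 * v"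
        unfolding E1_def using \<beta> R NI by simp
      also have "\<dots> \<le> 2 * h\<^sup>2 * C + (2 + 1 / h) * (C * h ^ 3) + h\<^sup>2 * v"
        using \<beta> R h by (intro add_mono mult_left_mono) auto
      also have "\<dots> = 2 * h\<^sup>2 * C + 2 * C * h ^ 3 + C * h\<^sup>2 + h\<^sup>2 * v"
        using h by (simp add: power2_eq_square power3_eq_cube algebra_simps)
      also have "\<dots> \<le> 2 * h\<^sup>2 * C + 2 * C * h\<^sup>2 + C * h\<^sup>2 + h\<^sup>2 * v"
      proof -
        have "h ^ 3 \<le> h\<^sup>2" using h by (intro power_decreasing) auto
        then have "2 * C * h ^ 3 \<le> 2 * C * h\<^sup>2" using C(1) by (intro mult_left_mono) auto
        then show ?thesis by simp
      qed
      also have "\<dots> = h\<^sup>2 * (5 * C + v)" by (simp add: algebra_simps)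
      finally show "(\<integral>\<omega>. E1 i \<omega> \<partial>M) \<le> h\<^sup>2 * (5 * C + v)" .
    qed
    define b where "b a d \<omega> = (\<Sum>i<n. \<beta> i \<omega> $ a * (\<sigma> *v zinc W h i \<omega>) $ d)" for a d \<omega>
    have bI: "integrable M (\<lambda>\<omega>. (b a d \<omega>)\<^sup>2)" "(\<integral>\<omega>. (b a d \<omega>)\<^sup>2 \<partial>M) \<le> real n * (C * v)" for a d
    proof -
      have le: "(\<beta> i \<omega> $ a)\<^sup>2 \<le> (norm (\<beta> i \<omega>))\<^sup>2" for i \<omega>
        using component_le_norm_cart[of "\<beta> i \<omega>" a] by (metis abs_ge_zero power2_abs power_mono)
      have i1: "integrable M (\<lambda>\<omega>. (\<beta> i \<omega> $ a)\<^sup>2)" for i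
        by (rule Bochner_Integration.integrable_bound[OF \<beta>(1)[of i]]) (auto simp: le)
      have i2: "(\<integral>\<omega>. (\<beta> i \<omega> $ a)\<^sup>2 \<partial>M) \<le> C" for i
        by (rule order_trans[OF integral_mono[OF i1 \<beta>(1)[of i] le] \<beta>(2)])
      have bF: "(\<lambda>\<omega>. \<beta> i \<omega> $ a) \<in> borel_measurable (F (real i * h))" for i
        using \<beta>F[of i] unfolding t_def by measurable
      note m = martingale_L2[OF M W h(1) bF i1 i2 linear_std_gauss[of \<sigma> d], of n, folded b_def]
      show "integrable M (\<lambda>\<omega>. (b a d \<omega>)\<^sup>2)" by (rule m(1))
      have "(\<integral>\<omega>. (b a d \<omega>)\<^sup>2 \<partial>M) \<le> real n * (C * (norm (\<sigma> $ d))\<^sup>2)" by (rule m(2))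
      also have "\<dots> \<le> real n * (C * v)"
        unfolding v_def using C(1)
        by (intro mult_left_mono power_mono Finite_Cartesian_Product.norm_nth_le) auto
      finally show "(\<integral>\<omega>. (b a d \<omega>)\<^sup>2 \<partial>M) \<le> real n * (C * v)" .
    qed
    \<comment> \<open>Second moments of \<open>b\<close> have to bound its first moment: 2 |b| is at
      most s + b^2 / s for every positive \<open>s\<close>, and s = sqrt n balances the two
      means.\<close>
    define s where "s = sqrt (real n)"
    have s: "0 < s" "s * s = real n" using n by (simp_all add: s_def)
    define E2 where "E2 \<omega> = (\<Sum>a\<in>(UNIV::'p set). \<Sum>d\<in>(UNIV::'p set). (s + (b a d \<omega>)\<^sup>2 / s))" for \<omega>
    have E2: "norm (B \<omega> + transpose (B \<omega>)) \<le> E2 \<omega>" for \<omega>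
    proof -
      have "norm (B \<omega> + transpose (B \<omega>)) \<le> 2 * norm (B \<omega>)"
        using norm_triangle_ineq[of "B \<omega>" "transpose (B \<omega>)"] by simp
      also have "\<dots> \<le> 2 * (\<Sum>a\<in>UNIV. \<Sum>d\<in>UNIV. \<bar>B \<omega> $ a $ d\<bar>)"
        by (intro mult_left_mono norm_matrix_le_sum) simp
      also have "\<dots> = (\<Sum>a\<in>UNIV. \<Sum>d\<in>UNIV. 2 * \<bar>b a d \<omega>\<bar>)"
        by (simp add: B_def b_def outer_def sum_distrib_left)
      also have "\<dots> \<le> E2 \<omega>"
        unfolding E2_def
      proof (intro sum_mono)
        fix a d
        have "2 * s * \<bar>b a d \<omega>\<bar> \<le> s\<^sup>2 + \<bar>b a d \<omega>\<bar>\<^sup>2" by (rule sum_squares_bound)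
        then show "2 * \<bar>b a d \<omega>\<bar> \<le> s + (b a d \<omega>)\<^sup>2 / s"
          using s by (simp add: field_simps power2_eq_square)
      qed
      finally show ?thesis .
    qed
    have E2I: "integrable M E2" "(\<integral>\<omega>. E2 \<omega> \<partial>M) \<le> p\<^sup>2 * (s * (1 + C * v))"
    proof -
      show "integrable M E2" unfolding E2_def using bI by simp
      have "(\<integral>\<omega>. E2 \<omega> \<partial>M) = (\<Sum>a\<in>(UNIV::'p set). \<Sum>d\<in>(UNIV::'p set). s + (\<integral>\<omega>. (b a d \<omega>)\<^sup>2 \<partial>M) / s)"
        unfolding E2_def using bI by (simp add: Bochner_Integration.integral_sum prob_space)
      also have "\<dots> \<le> (\<Sum>a\<in>(UNIV::'p set). \<Sum>d\<in>(UNIV::'p set). s + (real n * (C * v)) / s)"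
        using s bI by (intro sum_mono add_left_mono divide_right_mono) auto
      also have "\<dots> = p\<^sup>2 * (s * (1 + C * v))"
        using s by (simp add: p_def power2_eq_square field_simps s(2)[symmetric])
      finally show "(\<integral>\<omega>. E2 \<omega> \<partial>M) \<le> p\<^sup>2 * (s * (1 + C * v))" .
    qed
    define E where "E \<omega> = c * ((\<Sum>i<n. E1 i \<omega>) + h * sqrt h * E2 \<omega>)" for \<omega>
    have RE: "norm (Rem h n \<omega>) \<le> E \<omega>" for \<omega>
    proof -
      have "norm (\<Sum>i<n. outer (D i \<omega>) (D i \<omega>) + outer (R i \<omega>) (N i \<omega>) + outer (N i \<omega>) (R i \<omega>)) \<le> (\<Sum>i<n. E1 i \<omega>)"
        by (intro sum_norm_le E1)
      moreover have "norm ((h * sqrt h) *\<^sub>R (B \<omega> + transpose (B \<omega>))) \<le> h * sqrt h * E2 \<omega>"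
        using h E2[of \<omega>] by (simp add: mult_left_mono)
      ultimately have "norm ((\<Sum>i<n. outer (D i \<omega>) (D i \<omega>) + outer (R i \<omega>) (N i \<omega>) + outer (N i \<omega>) (R i \<omega>)) +
          (h * sqrt h) *\<^sub>R (B \<omega> + transpose (B \<omega>))) \<le> (\<Sum>i<n. E1 i \<omega>) + h * sqrt h * E2 \<omega>"
        by (rule norm_triangle_le[OF add_mono])
      then show ?thesis
        unfolding Rem E_def norm_scaleR using c by (simp add: mult_left_mono)
    qed
    have EI: "integrable M E" unfolding E_def using E1I E2I by simp
    have "integrable M (\<lambda>\<omega>. norm (Rem h n \<omega>))"
      by (rule Bochner_Integration.integrable_bound[OF EI]) (use RE in \<open>auto intro: order_trans abs_ge_self\<close>)
    moreover have "(\<integral>\<omega>. norm (Rem h n \<omega>) \<partial>M) \<le> K * (sqrt (real n) * h + sqrt h)"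
    proof -
      have "(\<integral>\<omega>. norm (Rem h n \<omega>) \<partial>M) \<le> (\<integral>\<omega>. E \<omega> \<partial>M)"
        by (rule integral_mono[OF calculation EI RE])
      also have "\<dots> = c * ((\<Sum>i<n. \<integral>\<omega>. E1 i \<omega> \<partial>M) + h * sqrt h * (\<integral>\<omega>. E2 \<omega> \<partial>M))"
        unfolding E_def using E1I E2I by (simp add: Bochner_Integration.integral_sum)
      also have "\<dots> \<le> c * ((\<Sum>i<n. h\<^sup>2 * (5 * C + v)) + h * sqrt h * (p\<^sup>2 * (s * (1 + C * v))))"
        using c h E1I E2I by (intro mult_left_mono add_mono sum_mono) auto
      also have "\<dots> = (5 * C + v) * (s * h) + p\<^sup>2 * (1 + C * v) * sqrt h"
      proof -
        have "c * (\<Sum>i<n. h\<^sup>2 * (5 * C + v)) = (5 * C + v) * (s * h)"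
          unfolding c_def s_def[symmetric] using s h by (simp add: s(2)[symmetric] power2_eq_square)
        moreover have "c * (h * sqrt h * (p\<^sup>2 * (s * (1 + C * v)))) = p\<^sup>2 * (1 + C * v) * sqrt h"
          unfolding c_def s_def[symmetric] using s h by simp
        ultimately show ?thesis by (simp add: distrib_left)
      qed
      also have "\<dots> \<le> K * (s * h) + K * sqrt h"
      proof (intro add_mono mult_right_mono)
        have "0 \<le> C * v" "0 \<le> p\<^sup>2 * (1 + C * v)" using C(1) v by simp_all
        then show "5 * C + v \<le> K" "p\<^sup>2 * (1 + C * v) \<le> K" using C(1) v by (simp_all add: K_def)
      qed (use s h in auto)
      finally show ?thesis by (simp add: s_def distrib_left)
    qed
    ultimately show ?thesis using RemM by blast
  qed
  then show ?thesis by (intro exI allI impI)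
qed

section \<open>The covariance structure\<close>

lemmas matrix_add_left = bounded_bilinear.add_left[OF bounded_bilinear_matrix_mult]
lemmas matrix_add_right = bounded_bilinear.add_right[OF bounded_bilinear_matrix_mult]

lemma transpose_add: "transpose ((A::real^'n^'m) + B) = transpose A + transpose B"
  by (simp add: transpose_def vec_eq_iff)

lemma differentiable_matrix_mult:
  fixes f :: "'a::real_normed_vector \<Rightarrow> real^'n^'m" and g :: "'a \<Rightarrow> real^'k^'n"
  assumes "f differentiable (at x)" "g differentiable (at x)"
  shows "(\<lambda>x. f x ** g x) differentiable (at x)"
  using assms bounded_bilinear.FDERIV[OF bounded_bilinear_matrix_mult]
  unfolding differentiable_def by blast

lemma differentiable_transpose:
  fixes f :: "'a::real_normed_vector \<Rightarrow> real^'n^'m"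
  assumes "f differentiable (at x)" shows "(\<lambda>x. transpose (f x)) differentiable (at x)"
proof -
  have "bounded_linear (transpose :: real^'n^'m \<Rightarrow> real^'m^'n)"
    unfolding linear_conv_bounded_linear[symmetric]
    by (rule linearI) (simp_all add: transpose_def vec_eq_iff)
  then show ?thesis
    using assms bounded_linear.has_derivative unfolding differentiable_def by blast
qed

lemma fill_differentiable: "fill P differentiable (at \<theta>)"
proof -
  have "(\<lambda>\<theta>. fill P \<theta> \<bullet> axis i (axis j 1)) differentiable (at \<theta>)" for i j
  proof (cases "P $ i $ j")
    case (Known c)
    then show ?thesis by (simp add: inner_axis fill_def)
  next
    case (Free q)
    have "(\<lambda>\<theta>. \<theta> $ q) differentiable (at \<theta>)"
      by (intro bounded_linear_imp_differentiable bounded_linear_vec_nth)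
    with Free show ?thesis by (simp add: inner_axis fill_def)
  qed
  then show ?thesis
    by (subst differentiable_componentwise_within) (auto simp: Basis_vec_def)
qed

lemma transpose_fill: "transpose P = P \<Longrightarrow> transpose (fill P \<theta>) = fill P \<theta>"
  by (simp add: transpose_def fill_def vec_eq_iff)

text \<open>Embeddings of the two blocks turn block matrices and stacked vectors into sums of
  products, to which the rules for products apply.\<close>

definition emb1 :: "real^'p1^('p1::finite + 'p2::finite)" where
  "emb1 = (\<chi> k i. if k = Inl i then 1 else 0)"

definition emb2 :: "real^'p2^('p1::finite + 'p2::finite)" where
  "emb2 = (\<chi> k j. if k = Inr j then 1 else 0)"

lemma emb_mult:
  "(emb1 ** (A::real^'k^'p1)) $ Inl i = A $ i" "(emb1 ** A) $ Inr j = 0"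
  "(emb2 ** (B::real^'k^'p2)) $ Inl i = 0" "(emb2 ** B) $ Inr j = B $ j"
  by (simp_all add: emb1_def emb2_def matrix_matrix_mult_def vec_eq_iff if_distrib[of "\<lambda>x. x * _"] cong: if_cong)

lemma emb_transpose_mult:
  "((A::real^'p1^'k) ** transpose emb1) $ l $ Inl i = A $ l $ i" "(A ** transpose emb1) $ l $ Inr j = 0"
  "((B::real^'p2^'k) ** transpose emb2) $ l $ Inl i = 0" "(B ** transpose emb2) $ l $ Inr j = B $ l $ j"
  by (simp_all add: emb1_def emb2_def matrix_matrix_mult_def transpose_def vec_eq_iff if_distrib[of "\<lambda>x. _ * x"] cong: if_cong)

lemma all_sum: "(\<forall>x::'a + 'b. P x) \<longleftrightarrow> (\<forall>a. P (Inl a)) \<and> (\<forall>b. P (Inr b))"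
  by (metis sumE)

lemma stack_vec_emb: "stack_vec x y = emb1 *v x + emb2 *v y"
  by (simp add: vec_eq_iff all_sum stack_vec_def emb1_def emb2_def matrix_vector_mult_def
      if_distrib[of "\<lambda>x. x * _"] cong: if_cong)

lemma block_mat_emb:
  "block_mat A B C D = emb1 ** A ** transpose emb1 + emb1 ** B ** transpose emb2 +
     emb2 ** C ** transpose emb1 + emb2 ** D ** transpose emb2"
  by (simp add: vec_eq_iff all_sum block_mat_def emb_transpose_mult emb_mult)

lemma Sigma_struct_differentiable:
  assumes "invertible (fill (Psi_pat m) \<theta>)"
  shows "Sigma_struct m differentiable (at \<theta>)"
proof -
  have inv: "(\<lambda>\<theta>. matrix_inv (fill (Psi_pat m) \<theta>)) differentiable (at \<theta>)"
    using differentiable_compose[OF matrix_inv_differentiable[OF assms] fill_differentiable] .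
  show ?thesis
    unfolding Sigma_struct_def Let_def block_mat_emb
    by (intro differentiable_add differentiable_matrix_mult differentiable_transpose differentiable_const
        fill_differentiable inv)
qed

text \<open>The summands are the contributions of \<xi>, \<delta>, \<epsilon> and \<zeta>;
  \<open>A\<close> and \<open>D\<close> are the loadings of \<xi> and \<zeta> on the observations
  once the structural equation is solved for \<eta>. Symmetry and positivity can be read off this
  sum of congruences.\<close>

lemma Sigma_struct_sum:
  assumes sym: "transpose (Sigma_xi m) = Sigma_xi m"
  defines "I \<equiv> \<lambda>\<theta>. matrix_inv (fill (Psi_pat m) \<theta>)"
  defines "A \<equiv> \<lambda>\<theta>. emb1 ** fill (Lambda_x1 m) \<theta> + emb2 ** (fill (Lambda_x2 m) \<theta> ** I \<theta> ** fill (Gamma_pat m) \<theta>)"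
    and "D \<equiv> \<lambda>\<theta>. emb2 ** (fill (Lambda_x2 m) \<theta> ** I \<theta>)"
  shows "Sigma_struct m \<theta> = A \<theta> ** fill (Sigma_xi m) \<theta> ** transpose (A \<theta>) + emb1 ** fill (Sigma_delta m) \<theta> ** transpose emb1 +
    emb2 ** fill (Sigma_eps m) \<theta> ** transpose emb2 + D \<theta> ** fill (Sigma_zeta m) \<theta> ** transpose (D \<theta>)"
  unfolding Sigma_struct_def Let_def block_mat_emb A_def D_def I_def
  by (simp add: matrix_add_left matrix_add_right transpose_add matrix_transpose_mul matrix_mul_assoc
      transpose_fill[OF sym])

lemma congruence_quadratic: "x \<bullet> ((V ** S ** transpose V) *v x) = (transpose V *v x) \<bullet> (S *v (transpose V *v x))"
  for V :: "real^'k^'n"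
  by (metis dot_lmul_matrix matrix_vector_mul_assoc transpose_matrix_vector transpose_transpose)

lemma gram_psd:
  fixes S :: "real^'d^'d"
  assumes "gram S" shows "0 \<le> y \<bullet> (S *v y)"
proof -
  obtain R :: "real^'d^'d" where "S = R ** transpose R" using assms unfolding gram_def by blast
  then show ?thesis using congruence_quadratic[of y R "mat 1"] by simp
qed

lemma Sigma_struct_sym:
  assumes "sem_model m \<Theta>" shows "transpose (Sigma_struct m \<theta>) = Sigma_struct m \<theta>"
proof -
  have sym: "transpose (Sigma_xi m) = Sigma_xi m" "transpose (Sigma_delta m) = Sigma_delta m"
    "transpose (Sigma_eps m) = Sigma_eps m" "transpose (Sigma_zeta m) = Sigma_zeta m"
    using assms by (auto simp: sem_model_def)
  show ?thesis
    unfolding Sigma_struct_sum[OF sym(1)] transpose_add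
    by (simp add: matrix_transpose_mul transpose_fill sym matrix_mul_assoc transpose_add)
qed

text \<open>The parts of \<delta> and \<epsilon> are definite on their blocks, and a non-zero vector
  has a non-zero block; from the parts of \<xi> and \<zeta> non-negativity is enough.\<close>

lemma pos_def_Sigma_struct:
  fixes m :: "('k1::finite, 'k2::finite, 'p1::finite, 'p2::finite, 'q::finite) sem"
  assumes m: "sem_model m \<Theta>" "sem_regular m \<Theta>" and \<theta>: "\<theta> \<in> \<Theta>"
  shows "pos_def (Sigma_struct m \<theta>)"
  unfolding pos_def_def
proof (intro conjI allI impI)
  show "transpose (Sigma_struct m \<theta>) = Sigma_struct m \<theta>" by (rule Sigma_struct_sym[OF m(1)])
  fix x :: "real^('p1 + 'p2)" assume x: "x \<noteq> 0"
  have sym: "transpose (Sigma_xi m) = Sigma_xi m"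
    and gram: "gram (fill (Sigma_xi m) \<theta>)" "gram (fill (Sigma_zeta m) \<theta>)"
    and pd: "pos_def (fill (Sigma_delta m) \<theta>)" "pos_def (fill (Sigma_eps m) \<theta>)"
    using m \<theta> by (auto simp: sem_model_def sem_regular_def)
  define y1 where "y1 = transpose emb1 *v x"
  define y2 where "y2 = transpose emb2 *v x"
  have y: "y1 = (\<chi> i. x $ Inl i)" "y2 = (\<chi> j. x $ Inr j)"
    by (simp_all add: y1_def y2_def vec_eq_iff matrix_vector_mult_def transpose_def emb1_def emb2_def
        if_distrib[of "\<lambda>x. x * _"] cong: if_cong)
  have "y1 \<noteq> 0 \<or> y2 \<noteq> 0" using x by (auto simp: y vec_eq_iff all_sum)
  moreover have "0 \<le> y1 \<bullet> (fill (Sigma_delta m) \<theta> *v y1)" "y1 \<noteq> 0 \<Longrightarrow> 0 < y1 \<bullet> (fill (Sigma_delta m) \<theta> *v y1)"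
    "0 \<le> y2 \<bullet> (fill (Sigma_eps m) \<theta> *v y2)" "y2 \<noteq> 0 \<Longrightarrow> 0 < y2 \<bullet> (fill (Sigma_eps m) \<theta> *v y2)"
    using pd by (cases "y1 = 0"; cases "y2 = 0"; auto simp: pos_def_def less_imp_le)+
  ultimately have "0 < y1 \<bullet> (fill (Sigma_delta m) \<theta> *v y1) + y2 \<bullet> (fill (Sigma_eps m) \<theta> *v y2)"
    by (auto intro: add_pos_nonneg add_nonneg_pos)
  then have pos: "0 \<le> c \<Longrightarrow> 0 \<le> d \<Longrightarrow>
      0 < c + y1 \<bullet> (fill (Sigma_delta m) \<theta> *v y1) + y2 \<bullet> (fill (Sigma_eps m) \<theta> *v y2) + d" for c d
    by linarith
  show "0 < x \<bullet> (Sigma_struct m \<theta> *v x)"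
    unfolding Sigma_struct_sum[OF sym] matrix_vector_mult_add_rdistrib[of "_ + _ + _"]
      matrix_vector_mult_add_rdistrib[of "_ + _"] matrix_vector_mult_add_rdistrib[of "_ ** _ ** _"] inner_add_right congruence_quadratic
      y1_def[symmetric] y2_def[symmetric]
    by (rule pos[OF gram_psd[OF gram(1)] gram_psd[OF gram(2)]])
qed

text \<open>\<open>vech\<close> chooses an entry and need not be linear on all matrices.
  \<open>f\<close> fixes a representative of every unordered pair; it is linear and agrees with
  \<open>vech\<close> on symmetric matrices. By the chain rule \<open>f\<close> after
  \<open>G'\<close> is the Jacobian, so full rank makes \<open>G'\<close> injective.\<close>

lemma inj_derivative_of_full_rank:
  fixes G :: "real^'q \<Rightarrow> real^'n^'n"
  assumes sym: "\<And>\<theta>. transpose (G \<theta>) = G \<theta>" and deriv: "(G has_derivative G') (at \<theta>0)"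
    and rank: "rank (jacobian (\<lambda>\<theta>. vech (G \<theta>)) (at \<theta>0)) = CARD('q)"
  shows "inj G'"
proof -
  define rep where "rep u = (SOME ij. u = Upair (fst ij) (snd ij))" for u :: "'n uprod"
  have rep: "u = Upair (fst (rep u)) (snd (rep u))" for u
    unfolding rep_def by (rule someI_ex) (metis fst_conv snd_conv uprod_exhaust)
  define f where "f A = (\<chi> u. A $ fst (rep u) $ snd (rep u))" for A :: "real^'n^'n"
  have f: "vech A = f A" if "transpose A = A" for A
    unfolding f_def vec_eq_iff using vech_Upair[OF that] rep by (metis vec_lambda_beta)
  have lin: "bounded_linear f"
    unfolding linear_conv_bounded_linear[symmetric] by (rule linearI) (simp_all add: f_def vec_eq_iff)
  have "((\<lambda>\<theta>. vech (G \<theta>)) has_derivative (\<lambda>h. f (G' h))) (at \<theta>0)"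
    unfolding f[OF sym] by (rule bounded_linear.has_derivative[OF lin deriv])
  moreover from this have "((\<lambda>\<theta>. vech (G \<theta>)) has_derivative (\<lambda>h. jacobian (\<lambda>\<theta>. vech (G \<theta>)) (at \<theta>0) *v h)) (at \<theta>0)"
    unfolding jacobian_works[symmetric] differentiable_def by blast
  ultimately have eq: "f (G' h) = jacobian (\<lambda>\<theta>. vech (G \<theta>)) (at \<theta>0) *v h" for h
    by (metis has_derivative_unique)
  have "inj ((*v) (jacobian (\<lambda>\<theta>. vech (G \<theta>)) (at \<theta>0)))"
    using rank full_rank_injective by blast
  then show ?thesis
    unfolding inj_def by (metis eq)
qed

definition joint_matrix :: "real^'a1^'p \<Rightarrow> real^'a2^'p \<Rightarrow> real^'a3^'p \<Rightarrow> real^'a4^'p \<Rightarrow> real^(('a1 + 'a2) + ('a3 + 'a4))^'p" where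
  "joint_matrix T1 T2 T3 T4 = (\<chi> i a. case a of Inl (Inl b) \<Rightarrow> T1 $ i $ b | Inl (Inr b) \<Rightarrow> T2 $ i $ b
     | Inr (Inl b) \<Rightarrow> T3 $ i $ b | Inr (Inr b) \<Rightarrow> T4 $ i $ b)"

lemma sum_UNIV_sum:
  "(\<Sum>x\<in>(UNIV :: ('a::finite + 'b::finite) set). f x) = (\<Sum>a\<in>UNIV. f (Inl a)) + (\<Sum>b\<in>UNIV. f (Inr b))"
  by (simp add: UNIV_Plus_UNIV[symmetric] sum.Plus del: UNIV_Plus_UNIV)

lemma joint_matrix_noise:
  "joint_matrix T1 T2 T3 T4 *v joint_noise W1 W2 W3 W4 t \<omega> = T1 *v W1 t \<omega> + T2 *v W2 t \<omega> + T3 *v W3 t \<omega> + T4 *v W4 t \<omega>"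
  by (simp add: vec_eq_iff matrix_vector_mult_def joint_matrix_def sum_UNIV_sum)

lemma joint_matrix_gram:
  "joint_matrix T1 T2 T3 T4 ** transpose (joint_matrix T1 T2 T3 T4) =
    T1 ** transpose T1 + T2 ** transpose T2 + T3 ** transpose T3 + T4 ** transpose T4"
  by (simp add: vec_eq_iff matrix_matrix_mult_def transpose_def joint_matrix_def sum_UNIV_sum)

section \<open>Positivity of the realized covariance and measurability of the contrast\<close>

lemma realized_cov_psd:
  fixes x :: "real \<Rightarrow> real^'p"
  assumes "0 < h"
  shows "transpose (realized_cov n h x) = realized_cov n h x" "0 \<le> y \<bullet> (realized_cov n h x *v y)"
proof -
  show "transpose (realized_cov n h x) = realized_cov n h x"
    by (simp add: realized_cov_def outer_def transpose_def vec_eq_iff mult.commute)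
  have "0 \<le> y \<bullet> (outer z z *v y)" for z :: "real^'p"
  proof -
    have "outer z z *v y = (z \<bullet> y) *\<^sub>R z"
      by (simp add: vec_eq_iff outer_def matrix_vector_mult_def inner_vec_def sum_distrib_left sum_distrib_right ac_simps)
    then show ?thesis by (simp add: inner_commute)
  qed
  moreover have "linear (\<lambda>A. y \<bullet> (A *v y))"
    by (auto intro!: linearI simp: matrix_vector_mult_add_rdistrib inner_add_right scaleR_matrix_vector_assoc[symmetric])
  ultimately show "0 \<le> y \<bullet> (realized_cov n h x *v y)"
    unfolding realized_cov_def using assms
    by (simp add: linear_scale[of "\<lambda>A. y \<bullet> (A *v y)"] linear_sum[of "\<lambda>A. y \<bullet> (A *v y)"] sum_nonneg)
qed

lemma psd_invertible_pos_def:
  fixes P :: "real^'n^'n"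
  assumes sym: "transpose P = P" and psd: "\<And>x. 0 \<le> x \<bullet> (P *v x)" and inv: "invertible P"
  shows "pos_def P"
  unfolding pos_def_def
proof (intro conjI allI impI sym)
  fix x :: "real^'n" assume x: "x \<noteq> 0"
  obtain R :: "real^'n^'n" where R: "P = R ** transpose R" using psd_gram[OF sym psd] unfolding gram_def by blast
  have "x \<bullet> (P *v x) \<noteq> 0"
  proof
    assume "x \<bullet> (P *v x) = 0"
    then have "transpose R *v x = 0"
      using congruence_quadratic[of x R "mat 1"] by (simp add: R)
    then have "P *v x = 0" by (simp add: R matrix_vector_mul_assoc[symmetric])
    then have "(matrix_inv P ** P) *v x = 0" by (simp add: matrix_vector_mul_assoc[symmetric])
    then show False using x matrix_inv_left_right(2)[OF inv] by simp
  qed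
  then show "0 < x \<bullet> (P *v x)" using psd[of x] by simp
qed

lemma continuous_on_det: "continuous_on UNIV (det :: real^'n^'n \<Rightarrow> real)"
proof (intro continuous_at_imp_continuous_on ballI differentiable_imp_continuous_within)
  fix A :: "real^'n^'n"
  have "(\<lambda>B::real^'n^'n. B $ i $ j) differentiable (at A)" for i j
    by (intro bounded_linear_imp_differentiable bounded_linear_vec_nth
      bounded_linear_compose[OF bounded_linear_vec_nth])
  then show "(det :: real^'n^'n \<Rightarrow> real) differentiable (at A)"
    by (rule det_differentiable[of "\<lambda>x. x"])
qed

lemma invertible_near:
  fixes S :: "real^'n^'n"
  assumes "invertible S"
  obtains \<delta> where "0 < \<delta>" "\<And>Q. norm (Q - S) < \<delta> \<Longrightarrow> invertible Q"
proof -
  have "isCont (det :: real^'n^'n \<Rightarrow> real) S"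
    using continuous_on_det[where 'n = 'n] by (simp add: continuous_on_eq_continuous_at)
  then obtain \<delta> where "0 < \<delta>" "\<And>Q. norm (Q - S) < \<delta> \<Longrightarrow> norm (det Q - det S) < \<bar>det S\<bar>"
    unfolding continuous_at_eps_delta dist_norm using assms by (metis invertible_det_nz zero_less_abs_iff)
  with that show ?thesis
    unfolding invertible_det_nz by (metis abs_minus_cancel diff_0 less_irrefl real_norm_def)
qed

text \<open>The contrast is defined by cases. On the measurable set where \<open>Q\<close> is
  invertible, \<open>Q\<close> is definite and the contrast is continuous in both arguments; on the
  rest the weight is the identity and a squared distance remains.\<close>

lemma contrast_measurable:
  fixes Q Y :: "'a \<Rightarrow> real^'n^'n"
  assumes [measurable]: "Q \<in> borel_measurable M" "Y \<in> borel_measurable M"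
    and Q: "\<And>\<omega>. \<omega> \<in> space M \<Longrightarrow> invertible (Q \<omega>) \<Longrightarrow> pos_def (Q \<omega>)"
    and Qs: "\<And>\<omega>. \<omega> \<in> space M \<Longrightarrow> transpose (Q \<omega>) = Q \<omega>"
    and Y: "\<And>\<omega>. \<omega> \<in> space M \<Longrightarrow> pos_def (Y \<omega>)"
  shows "(\<lambda>\<omega>. contrast (Q \<omega>) (Y \<omega>)) \<in> borel_measurable M"
proof -
  define g where "g \<omega> = (vech (Q \<omega>) - vech (Y \<omega>)) \<bullet> (vech (Q \<omega>) - vech (Y \<omega>))" for \<omega>
  have eq: "contrast (Q \<omega>) (Y \<omega>) = (if invertible (Q \<omega>) then contrast (Q \<omega>) (Y \<omega>) else g \<omega>)" for \<omega>
    by (simp add: contrast_def V_tilde_def g_def)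
  have [measurable]: "(\<lambda>\<omega>. det (Q \<omega>)) \<in> borel_measurable M"
    using measurable_compose[OF assms(1) borel_measurable_continuous_onI[OF continuous_on_det]] .
  have set: "{\<omega> \<in> space M. invertible (Q \<omega>)} \<in> sets M"
    unfolding invertible_det_nz by measurable
  have "(\<lambda>\<omega>. (Q \<omega>, Y \<omega>)) \<in> restrict_space M {\<omega>. invertible (Q \<omega>)} \<rightarrow>\<^sub>M
      restrict_space borel {z. pos_def (fst z) \<and> pos_def (snd z)}"
  proof (rule measurable_restrict_space2)
    show "(\<lambda>\<omega>. (Q \<omega>, Y \<omega>)) \<in> borel_measurable (restrict_space M {\<omega>. invertible (Q \<omega>)})"
      by (intro measurable_restrict_space1) measurable
  qed (use Q Y in \<open>auto simp: space_restrict_space\<close>)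
  from measurable_compose[OF this borel_measurable_continuous_on_restrict[OF continuous_on_contrast]]
  have 1: "(\<lambda>\<omega>. contrast (Q \<omega>) (Y \<omega>)) \<in> borel_measurable (restrict_space M {\<omega>. invertible (Q \<omega>)})" by simp
  have "g \<in> borel_measurable M"
  proof -
    have v: "(\<lambda>\<omega>. vech (Z \<omega>)) \<in> borel_measurable M"
      if Zm: "Z \<in> borel_measurable M" and Z: "\<And>\<omega>. \<omega> \<in> space M \<Longrightarrow> transpose (Z \<omega>) = Z \<omega>" for Z :: "'a \<Rightarrow> real^'n^'n"
      unfolding borel_measurable_vec_iff
    proof
      fix u :: "'n uprod"
      obtain i j where u: "u = Upair i j" by (rule uprod_exhaust)
      have "(\<lambda>\<omega>. Z \<omega> $ i $ j) \<in> borel_measurable M" using Zm borel_measurable_matrix_iff by blast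
      then show "(\<lambda>\<omega>. vech (Z \<omega>) $ u) \<in> borel_measurable M"
        by (subst measurable_cong[of _ _ "\<lambda>\<omega>. Z \<omega> $ i $ j"]) (simp_all add: u vech_Upair Z)
    qed
    have [measurable]: "(\<lambda>\<omega>. vech (Q \<omega>)) \<in> borel_measurable M" "(\<lambda>\<omega>. vech (Y \<omega>)) \<in> borel_measurable M"
      using v[OF assms(1) Qs] v[OF assms(2) pos_def_sym[OF Y]] by auto
    show ?thesis unfolding g_def by measurable
  qed
  then have 2: "g \<in> borel_measurable (restrict_space M {\<omega>. \<not> invertible (Q \<omega>)})"
    by (rule measurable_restrict_space1)
  show ?thesis
    by (subst eq, subst measurable_If_restrict_space_iff[OF set]) (use 1 2 in blast)
qed

section \<open>The likelihood ratio statistic\<close>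

lemma realized_cov_measurable:
  fixes X :: "real \<Rightarrow> 'a \<Rightarrow> real^'p"
  assumes X: "\<And>t. 0 \<le> t \<Longrightarrow> X t \<in> borel_measurable M" and h: "0 < h"
  shows "(\<lambda>\<omega>. realized_cov n h (\<lambda>t. X t \<omega>)) \<in> borel_measurable M"
proof -
  have Xh: "X (real i * h) \<in> borel_measurable M" for i using X h by simp
  have c: "realized_cov n h x $ i $ j = 1 / (real n * h) * (\<Sum>k=1..n. (x (real k * h) $ i - x (real (k - 1) * h) $ i) *
      (x (real k * h) $ j - x (real (k - 1) * h) $ j))" for x :: "real \<Rightarrow> real^'p" and i j
    by (simp add: realized_cov_def outer_def)
  show ?thesis
    unfolding borel_measurable_matrix_iff c
    by (intro allI borel_measurable_times borel_measurable_const borel_measurable_sum borel_measurable_diff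
        borel_measurable_vec_component Xh)
qed

lemma abs_diff_squares_le:
  fixes x y :: real
  assumes "\<bar>x - y\<bar> \<le> d" "\<bar>y\<bar> \<le> a" "d \<le> c"
  shows "\<bar>x\<^sup>2 - y\<^sup>2\<bar> \<le> d * (2 * a + c)"
proof -
  have "\<bar>x\<^sup>2 - y\<^sup>2\<bar> = \<bar>x - y\<bar> * \<bar>x + y\<bar>"
    by (simp add: power2_eq_square square_diff_square_factored abs_mult mult.commute)
  also have "\<dots> \<le> d * (2 * a + c)"
    using assms by (intro mult_mono) auto
  finally show ?thesis .
qed

text \<open>The statistic \<open>V\<close> and the sum of squares \<open>T\<close> are close unless
  the noise sum \<open>A\<close> or the remainder \<open>Rem\<close> is large, which has small
  probability. Otherwise Q - S is of order 1 / sqrt n and the deterministic expansion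
  applies.\<close>

lemma likelihood_ratio_weak_conv:
  fixes M :: "'a measure" and W :: "real \<Rightarrow> 'a \<Rightarrow> real^'r" and X :: "real \<Rightarrow> 'a \<Rightarrow> real^'p" and \<sigma> :: "real^'r^'p"
    and G :: "real^'q \<Rightarrow> real^'p^'p" and \<theta>_hat :: "nat \<Rightarrow> 'a \<Rightarrow> real^'q"
  assumes M: "prob_space M" and W: "gaussian_noise M F W" and X: "ito_increments M F (\<lambda>t \<omega>. \<sigma> *v W t \<omega>) X"
    and \<Theta>: "compact \<Theta>" and \<theta>0: "\<theta>0 \<in> interior \<Theta>" and pd: "\<And>\<theta>. \<theta> \<in> \<Theta> \<Longrightarrow> pos_def (G \<theta>)"
    and cont: "continuous_on \<Theta> G" and inj: "inj_on G \<Theta>"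
    and deriv: "(G has_derivative G') (at \<theta>0)" and injG': "inj G'" and G0: "G \<theta>0 = \<sigma> ** transpose \<sigma>"
    and h: "\<And>n. 0 < h n" "h \<longlonglongrightarrow> 0" "(\<lambda>n. real n * (h n)\<^sup>2) \<longlonglongrightarrow> 0"
    and hat_m: "\<And>n. \<theta>_hat n \<in> borel_measurable M"
    and hat: "\<And>n \<omega>. 1 \<le> n \<Longrightarrow> \<omega> \<in> space M \<Longrightarrow> \<theta>_hat n \<omega> \<in> \<Theta> \<and>
      contrast (realized_cov n (h n) (\<lambda>t. X t \<omega>)) (G (\<theta>_hat n \<omega>)) =
        (INF \<theta>\<in>\<Theta>. contrast (realized_cov n (h n) (\<lambda>t. X t \<omega>)) (G \<theta>))"
  shows "weak_conv_m (\<lambda>n. distr M borel (\<lambda>\<omega>. real n * contrast (realized_cov n (h n) (\<lambda>t. X t \<omega>)) (G (\<theta>_hat n \<omega>))))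
    (chi_squared (CARD('p) * (CARD('p) + 1) div 2 - CARD('q)))"
proof -
  interpret prob_space M by fact
  define Q where "Q n \<omega> = realized_cov n (h n) (\<lambda>t. X t \<omega>)" for n \<omega>
  have Xm: "X t \<in> borel_measurable M" if "0 \<le> t" for t using X that unfolding ito_increments_def by blast
  have Qm[measurable]: "Q n \<in> borel_measurable M" for n
    unfolding Q_def[abs_def] by (rule realized_cov_measurable[OF Xm h(1)])
  have Qs: "transpose (Q n \<omega>) = Q n \<omega>" for n \<omega>
    unfolding Q_def by (rule realized_cov_psd(1)[OF h(1)])
  have Qpd: "pos_def (Q n \<omega>)" if "invertible (Q n \<omega>)" for n \<omega>
    using psd_invertible_pos_def[OF Qs _ that] realized_cov_psd(2)[OF h(1)] unfolding Q_def by blast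
  define S where "S = G \<theta>0"
  have \<theta>0': "\<theta>0 \<in> \<Theta>" using \<theta>0 interior_subset by blast
  have Spd: "pos_def S" unfolding S_def by (rule pd[OF \<theta>0'])
  obtain R :: "real^'p^'p" where R: "S = R ** transpose R" "invertible R" using pos_def_factor[OF Spd] .
  define Ri where "Ri = matrix_inv R"
  define J where "J D = Ri ** D ** transpose Ri" for D
  have linJ: "linear J" unfolding J_def by (rule linear_congruence)
  have linG': "linear G'" using has_derivative_bounded_linear[OF deriv] by (rule bounded_linear.linear)
  have injJ: "inj J"
  proof (rule injI)
    fix x y assume "J x = J y"
    then have "J (x - y) = 0" using linear_diff[OF linJ] by simp
    then show "x = y" using factor_quadratic(2)[OF R, of "x - y"] by (simp add: J_def Ri_def)
  qed
  have symJG: "transpose (J (G' v)) = J (G' v)" for v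
    unfolding J_def transpose_congruence by (subst derivative_symmetric[OF pos_def_sym[OF pd] \<theta>0 deriv]) auto
  have "linear (\<lambda>v. J (G' v))" "inj (\<lambda>v. J (G' v))"
    using linear_compose[OF linG' linJ] inj_compose[OF injJ injG'] by (simp_all add: o_def)
  from exists_residual_basis[OF this symJG]
  obtain B where B: "finite B" "pairwise orthogonal B" "\<And>b. b \<in> B \<Longrightarrow> norm b = 1"
    "span B = {X. transpose X = X \<and> (\<forall>v. X \<bullet> J (G' v) = 0)}"
    and cardB: "card B = CARD('p) * (CARD('p) + 1) div 2 - CARD('q)" by blast
  define k where "k = card B"
  obtain e where e: "bij_betw e {..<k} B"
    using ex_bij_betw_nat_finite[OF B(1)] by (auto simp: k_def atLeast0LessThan)
  have eB: "e j \<in> B" if "j < k" for j using e that by (auto simp: bij_betw_def)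
  have Bsym: "transpose b = b" if "b \<in> B" for b using B(4) span_base[OF that] by blast
  \<comment> \<open>\<open>U\<close> has orthonormal rows, because \<sigma> and \<open>R\<close>
    factor the same covariance. Although it is rectangular in general, conjugation of
    \<open>b\<close> with it preserves inner products, so the residual basis yields orthonormal
    matrices \<open>Fm b\<close> of the size of \<open>A\<close>.\<close>
  define U where "U = Ri ** \<sigma>"
  have UU: "U ** transpose U = mat 1"
  proof -
    have "U ** transpose U = Ri ** (\<sigma> ** transpose \<sigma>) ** transpose Ri"
      by (simp add: U_def matrix_transpose_mul matrix_mul_assoc)
    also have "\<dots> = (Ri ** R) ** transpose (Ri ** R)"
      unfolding G0[symmetric] S_def[symmetric] R(1) by (simp add: matrix_transpose_mul matrix_mul_assoc)
    finally show ?thesis using matrix_inv_left_right(2)[OF R(2)] by (simp add: Ri_def transpose_mat)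
  qed
  define Fm where "Fm b = transpose U ** b ** U" for b
  have Fm_inner: "Fm b \<bullet> Fm b' = b \<bullet> b'" for b b'
  proof -
    have "Fm b \<bullet> Fm b' = (b ** U) \<bullet> ((U ** transpose U) ** (b' ** U))"
      unfolding Fm_def by (simp add: matrix_mul_assoc[symmetric] inner_mult_left)
    also have "\<dots> = b \<bullet> (b' ** (U ** transpose U))"
      unfolding UU by (simp add: inner_mult_right matrix_mul_assoc[symmetric] UU)
    finally show ?thesis by (simp add: UU)
  qed
  have Fm_norm: "norm (Fm b) = 1" if "b \<in> B" for b
    using Fm_inner[of b b] B(3)[OF that] by (simp add: norm_eq_sqrt_inner)
  have Fm_J: "J (\<sigma> ** A ** transpose \<sigma>) \<bullet> b = A \<bullet> Fm b" for A b
  proof -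
    have "J (\<sigma> ** A ** transpose \<sigma>) = U ** (A ** transpose U)"
      by (simp add: J_def U_def matrix_transpose_mul matrix_mul_assoc)
    then show ?thesis
      by (simp only:, subst inner_mult_left, subst inner_mult_right) (simp add: Fm_def matrix_mul_assoc)
  qed
  define A where "A n \<omega> = centred_gram W (h n) n \<omega>" for n \<omega>
  have Am[measurable]: "A n \<in> borel_measurable M" for n
  proof (cases "n = 0")
    case True
    then show ?thesis by (simp add: A_def[abs_def] centred_gram_def)
  next
    case False
    then show ?thesis unfolding A_def[abs_def] using centred_gram_L2(1)[OF M W h(1)] by simp
  qed
  \<comment> \<open>\<open>A\<close> paired with a unit symmetric matrix has variance 2, hence the
    sqrt 2; the factor 1/2 of the contrast is the same 2, and \<open>T\<close> needs no further
    constant.\<close>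
  define Y where "Y n j \<omega> = (A n \<omega> \<bullet> Fm (e j)) / sqrt 2" for n j \<omega>
  have Ym[measurable]: "Y n j \<in> borel_measurable M" for n j unfolding Y_def by measurable
  have char: "(\<lambda>n. \<integral>\<omega>. iexp (\<Sum>j<k. g j * Y n j \<omega>) \<partial>M) \<longlonglongrightarrow> complex_of_real (exp (- (\<Sum>j<k. (g j)\<^sup>2) / 2))" for g
  proof -
    \<comment> \<open>A linear combination of the coordinates is again \<open>A\<close> paired with
      one symmetric matrix, whose norm is the Euclidean norm of the coefficients.\<close>
    define H where "H = (\<Sum>j<k. g j *\<^sub>R Fm (e j))"
    have "transpose (Fm b) = Fm b" if "b \<in> B" for b
      using transpose_congruence[of "transpose U" b] Bsym[OF that] by (simp add: Fm_def)
    moreover have "linear (transpose :: real^'r^'r \<Rightarrow> _)" by (rule linearI) (simp_all add: transpose_def vec_eq_iff)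
    ultimately have Hs: "transpose H = H"
      unfolding H_def by (simp add: linear_sum linear_scale eB)
    have "(norm H)\<^sup>2 = (\<Sum>i<k. \<Sum>j<k. g i * g j * (e j \<bullet> e i))"
      unfolding power2_norm_eq_inner H_def by (simp add: inner_sum_left inner_sum_right Fm_inner sum_distrib_left mult.assoc)
    also have "\<dots> = (\<Sum>i<k. \<Sum>j<k. if j = i then (g i)\<^sup>2 else 0)"
    proof (intro sum.cong refl)
      fix i j assume ij: "i \<in> {..<k}" "j \<in> {..<k}"
      have "e i \<bullet> e j = (if j = i then 1 else 0)"
      proof (cases "i = j")
        case True
        then show ?thesis using B(3)[OF eB, of i] ij by (simp add: norm_eq_sqrt_inner)
      next
        case False
        then have "e i \<noteq> e j" using e ij by (auto simp: bij_betw_def inj_on_def)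
        then show ?thesis using B(2) eB ij False by (auto simp: pairwise_def orthogonal_def)
      qed
      then show "g i * g j * (e j \<bullet> e i) = (if j = i then (g i)\<^sup>2 else 0)"
        by (simp add: power2_eq_square inner_commute[of "e j"])
    qed
    also have "\<dots> = (\<Sum>i<k. (g i)\<^sup>2)" by (simp add: sum.delta)
    finally have Hn: "(norm H)\<^sup>2 = (\<Sum>i<k. (g i)\<^sup>2)" .
    have "(\<Sum>j<k. g j * Y n j \<omega>) = (A n \<omega> \<bullet> H) / sqrt 2" for n \<omega>
      by (simp add: Y_def H_def inner_sum_right sum_divide_distrib)
    then show ?thesis
      using centred_gram_char_tendsto[OF M W h(1) Hs] unfolding Hn A_def by simp
  qed
  define T where "T n \<omega> = (\<Sum>j<k. (Y n j \<omega>)\<^sup>2)" for n \<omega>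
  have Tm: "T n \<in> borel_measurable M" for n unfolding T_def by measurable
  have TB: "T n \<omega> = (\<Sum>b\<in>B. (A n \<omega> \<bullet> Fm b)\<^sup>2) / 2" for n \<omega>
    unfolding T_def Y_def
    by (subst sum.reindex_bij_betw[OF e, symmetric]) (simp add: power_divide sum_divide_distrib)
  define V where "V n \<omega> = real n * contrast (Q n \<omega>) (G (\<theta>_hat n \<omega>))" for n \<omega>
  have Vm: "V n \<in> borel_measurable M" for n
  proof (cases "n = 0")
    case False
    then have n: "1 \<le> n" by simp
    \<comment> \<open>\<open>G\<close> is continuous on \<Theta> only, so the estimator is regarded
      as a map into \<Theta> before composing.\<close>
    have "\<theta>_hat n \<in> M \<rightarrow>\<^sub>M restrict_space borel \<Theta>"
      by (rule measurable_restrict_space2[OF _ hat_m]) (use hat[OF n] in auto)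
    from measurable_compose[OF this borel_measurable_continuous_on_restrict[OF cont]]
    have "(\<lambda>\<omega>. contrast (Q n \<omega>) (G (\<theta>_hat n \<omega>))) \<in> borel_measurable M"
      using hat[OF n] by (intro contrast_measurable[OF Qm] Qpd Qs pd) auto
    then show ?thesis unfolding V_def[abs_def] by measurable
  qed (simp add: V_def[abs_def])
  define Rem where "Rem n \<omega> = sqrt (real n) *\<^sub>R (Q n \<omega> - \<sigma> ** transpose \<sigma>) - \<sigma> ** A n \<omega> ** transpose \<sigma>" for n \<omega>
  let ?Rem = "\<lambda>h n \<omega>. sqrt (real n) *\<^sub>R (realized_cov n h (\<lambda>t. X t \<omega>) - \<sigma> ** transpose \<sigma>) -
      \<sigma> ** centred_gram W h n \<omega> ** transpose \<sigma>"
  obtain K where K': "\<forall>h n. 0 < h \<longrightarrow> h \<le> 1 \<longrightarrow> 0 < n \<longrightarrow> ?Rem h n \<in> borel_measurable M \<and>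
      integrable M (\<lambda>\<omega>. norm (?Rem h n \<omega>)) \<and> (\<integral>\<omega>. norm (?Rem h n \<omega>) \<partial>M) \<le> K * (sqrt (real n) * h + sqrt h)"
    using realized_cov_remainder[OF M W X] by (elim exE)
  have K: "Rem n \<in> borel_measurable M \<and> integrable M (\<lambda>\<omega>. norm (Rem n \<omega>)) \<and>
      (\<integral>\<omega>. norm (Rem n \<omega>) \<partial>M) \<le> K * (sqrt (real n) * h n + sqrt (h n))" if "h n \<le> 1" "0 < n" for n
    unfolding Rem_def[abs_def] Q_def A_def by (rule K'[rule_format, OF h(1) that])
  \<comment> \<open>The first term is the square root of n h^2; this is the place where the step
    size has to shrink fast enough.\<close>
  have K0: "(\<lambda>n. K * (sqrt (real n) * h n + sqrt (h n))) \<longlonglongrightarrow> 0"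
  proof -
    have "(\<lambda>n. sqrt (real n * (h n)\<^sup>2)) \<longlonglongrightarrow> sqrt 0" by (intro tendsto_intros h)
    then have 1: "(\<lambda>n. sqrt (real n) * h n) \<longlonglongrightarrow> 0"
      using h(1) by (simp add: real_sqrt_mult less_imp_le)
    have 2: "(\<lambda>n. sqrt (h n)) \<longlonglongrightarrow> sqrt 0" by (intro tendsto_intros h)
    show ?thesis using tendsto_mult_left[OF tendsto_add[OF 1 2], of K] by simp
  qed
  define \<kappa> where "\<kappa> = (norm Ri)\<^sup>2"
  define v where "v = (norm \<sigma>)\<^sup>2"
  define r2 where "r2 = 2 * (real CARD('r))\<^sup>2"
  have nonneg: "0 \<le> \<kappa>" "0 \<le> v" "0 \<le> r2" by (simp_all add: \<kappa>_def v_def r2_def)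
  have close: "\<forall>\<^sub>F n in sequentially. \<exists>E\<in>sets M. measure M E \<le> \<eta> \<and> (\<forall>\<omega>\<in>space M - E. \<bar>V n \<omega> - T n \<omega>\<bar> \<le> \<eta>)"
    if \<eta>: "0 < \<eta>" for \<eta>
  proof -
    \<comment> \<open>By Markov's inequality |A| reaches \<open>a\<close> with probability at most
      r2 / a^2, which is at most \<eta> / 2; the summand 1 keeps \<open>a\<close> positive.\<close>
    define a where "a = sqrt (2 * r2 / \<eta>) + 1"
    have a: "0 < a" "r2 / a\<^sup>2 \<le> \<eta> / 2"
    proof -
      have s: "0 \<le> sqrt (2 * r2 / \<eta>)" using nonneg \<eta> by simp
      then show a0: "0 < a" by (simp add: a_def add_nonneg_pos)
      have "(sqrt (2 * r2 / \<eta>))\<^sup>2 \<le> a\<^sup>2" using s by (intro power_mono) (auto simp: a_def)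
      then have "2 * r2 / \<eta> \<le> a\<^sup>2" using nonneg \<eta> by simp
      then show "r2 / a\<^sup>2 \<le> \<eta> / 2" using \<eta> a0 by (simp add: field_simps)
    qed
    \<comment> \<open>\<open>u\<close> bounds sqrt n |Q - S| off the exceptional event; \<epsilon>
      is then chosen so that n times the expansion error is at most \<eta> / 2.\<close>
    define u where "u = v * a + 1"
    have u: "0 < u" using nonneg a by (simp add: u_def add_nonneg_pos)
    define \<epsilon> where "\<epsilon> = \<eta> / (2 * u\<^sup>2)"
    have \<epsilon>: "0 < \<epsilon>" "\<epsilon> * u\<^sup>2 = \<eta> / 2" using \<eta> u by (simp_all add: \<epsilon>_def)
    obtain \<delta>1 where \<delta>1: "0 < \<delta>1"
      "\<And>Q \<theta>. pos_def Q \<Longrightarrow> norm (Q - S) < \<delta>1 \<Longrightarrow> \<theta> \<in> \<Theta> \<Longrightarrow>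
        contrast Q (G \<theta>) = (INF \<theta>\<in>\<Theta>. contrast Q (G \<theta>)) \<Longrightarrow>
        \<bar>contrast Q (G \<theta>) - (\<Sum>b\<in>B. (J (Q - S) \<bullet> b)\<^sup>2) / 2\<bar> \<le> \<epsilon> * (norm (Q - S))\<^sup>2"
      using contrast_min_expansion[OF \<Theta> \<theta>0 pd cont inj deriv injG' R[unfolded S_def] B(1-3) B(4)[unfolded J_def Ri_def] \<epsilon>(1)]
      unfolding S_def J_def Ri_def by metis
    obtain \<delta>2 where \<delta>2: "0 < \<delta>2" "\<And>Q. norm (Q - S) < \<delta>2 \<Longrightarrow> invertible Q"
      using invertible_near[OF pos_def_invertible[OF Spd]] by blast
    \<comment> \<open>\<open>\<rho> * L\<close> bounds the total change of the squares over
      \<open>B\<close> when \<open>Rem\<close> is dropped from \<open>Z\<close>.\<close>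
    define L where "L = real k * \<kappa> * (2 * a + \<kappa>)"
    have L: "0 \<le> L" using nonneg a by (simp add: L_def)
    define \<rho> where "\<rho> = min 1 (\<eta> / (L + 1))"
    have \<rho>: "0 < \<rho>" "\<rho> \<le> 1" "\<rho> * L \<le> \<eta>"
    proof -
      show "0 < \<rho>" "\<rho> \<le> 1" using \<eta> L by (auto simp: \<rho>_def)
      have "\<rho> * L \<le> \<eta> / (L + 1) * L" using L by (intro mult_right_mono) (auto simp: \<rho>_def)
      also have "\<dots> \<le> \<eta>" using \<eta> L by (simp add: field_simps)
      finally show "\<rho> * L \<le> \<eta>" .
    qed
    have "\<forall>\<^sub>F n in sequentially. h n < 1" using h(2) by (rule order_tendstoD) simp
    moreover have "\<forall>\<^sub>F n in sequentially. K * (sqrt (real n) * h n + sqrt (h n)) < \<rho> * \<eta> / 2"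
      using K0 by (rule order_tendstoD) (use \<rho> \<eta> in simp)
    moreover have "\<forall>\<^sub>F n in sequentially. u / sqrt (real n) < min \<delta>1 \<delta>2"
    proof (rule order_tendstoD)
      show "(\<lambda>n. u / sqrt (real n)) \<longlonglongrightarrow> 0"
        by (intro tendsto_divide_0[OF tendsto_const] filterlim_at_top_imp_at_infinity
            filterlim_compose[OF sqrt_at_top filterlim_real_sequentially])
    qed (use \<delta>1 \<delta>2 in simp)
    ultimately show ?thesis using eventually_gt_at_top[of 0]
    proof eventually_elim
      case (elim n)
      have n: "0 < n" "1 \<le> n" and hn: "h n \<le> 1" using elim by auto
      have sn: "0 < sqrt (real n)" using n by simp
      note Kn = K[OF hn n(1)]
      have [measurable]: "Rem n \<in> borel_measurable M" using Kn by blast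
      define E where "E = {\<omega>\<in>space M. a\<^sup>2 \<le> (norm (A n \<omega>))\<^sup>2} \<union> {\<omega>\<in>space M. \<rho> \<le> norm (Rem n \<omega>)}"
      have E[measurable]: "E \<in> sets M" unfolding E_def by measurable
      have AL: "integrable M (\<lambda>\<omega>. (norm (A n \<omega>))\<^sup>2)" "(\<integral>\<omega>. (norm (A n \<omega>))\<^sup>2 \<partial>M) \<le> r2"
        unfolding A_def r2_def using centred_gram_L2(2,3)[OF M W h(1) n(1)] by auto
      have "measure M {\<omega>\<in>space M. a\<^sup>2 \<le> (norm (A n \<omega>))\<^sup>2} \<le> (\<integral>\<omega>. (norm (A n \<omega>))\<^sup>2 \<partial>M) / a\<^sup>2"
        by (rule integral_Markov_inequality_measure[OF AL(1), where A="{}"]) (use a in auto)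
      also have "\<dots> \<le> r2 / a\<^sup>2" using AL(2) by (intro divide_right_mono) auto
      finally have 1: "measure M {\<omega>\<in>space M. a\<^sup>2 \<le> (norm (A n \<omega>))\<^sup>2} \<le> \<eta> / 2"
        by (rule order_trans[OF _ a(2)])
      have "measure M {\<omega>\<in>space M. \<rho> \<le> norm (Rem n \<omega>)} \<le> (\<integral>\<omega>. norm (Rem n \<omega>) \<partial>M) / \<rho>"
        by (rule integral_Markov_inequality_measure[where A="{}"]) (use Kn \<rho> in auto)
      also have "\<dots> \<le> (\<rho> * \<eta> / 2) / \<rho>" using Kn elim \<rho> by (intro divide_right_mono) auto
      finally have 2: "measure M {\<omega>\<in>space M. \<rho> \<le> norm (Rem n \<omega>)} \<le> \<eta> / 2" using \<rho> by simp
      have "measure M E \<le> measure M {\<omega>\<in>space M. a\<^sup>2 \<le> (norm (A n \<omega>))\<^sup>2} + measure M {\<omega>\<in>space M. \<rho> \<le> norm (Rem n \<omega>)}"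
        unfolding E_def by (rule measure_Un_le) measurable
      then have mE: "measure M E \<le> \<eta>" using 1 2 by simp
      have "\<bar>V n \<omega> - T n \<omega>\<bar> \<le> \<eta>" if \<omega>: "\<omega> \<in> space M - E" for \<omega>
      proof -
        have \<omega>M: "\<omega> \<in> space M" and An2: "(norm (A n \<omega>))\<^sup>2 < a\<^sup>2" and Rn: "norm (Rem n \<omega>) \<le> \<rho>"
          using \<omega> by (auto simp: E_def not_le)
        have An: "norm (A n \<omega>) \<le> a"
          by (rule power2_le_imp_le[OF less_imp_le[OF An2] less_imp_le[OF a(1)]])
        define Z where "Z = sqrt (real n) *\<^sub>R (Q n \<omega> - S)"
        have Z: "Z = \<sigma> ** A n \<omega> ** transpose \<sigma> + Rem n \<omega>"
          by (simp add: Z_def Rem_def S_def G0)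
        have "norm Z \<le> v * norm (A n \<omega>) + norm (Rem n \<omega>)"
          unfolding Z v_def by (intro norm_triangle_le add_mono norm_congruence_le order_refl)
        also have "\<dots> \<le> u" unfolding u_def using An Rn \<rho> nonneg by (intro add_mono mult_left_mono) auto
        finally have Zu: "norm Z \<le> u" .
        have "norm (Q n \<omega> - S) = norm Z / sqrt (real n)" using sn by (simp add: Z_def)
        also have "\<dots> \<le> u / sqrt (real n)" using Zu sn by (intro divide_right_mono) auto
        finally have Qn: "norm (Q n \<omega> - S) < \<delta>1" "norm (Q n \<omega> - S) < \<delta>2" using elim by auto
        have pdQ: "pos_def (Q n \<omega>)" by (rule Qpd[OF \<delta>2(2)[OF Qn(2)]])
        have main: "\<bar>contrast (Q n \<omega>) (G (\<theta>_hat n \<omega>)) - (\<Sum>b\<in>B. (J (Q n \<omega> - S) \<bullet> b)\<^sup>2) / 2\<bar> \<le> \<epsilon> * (norm (Q n \<omega> - S))\<^sup>2"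
          using hat[OF n(2) \<omega>M] unfolding Q_def[symmetric] by (intro \<delta>1(2)[OF pdQ Qn(1)]) auto
        have JZ: "J Z \<bullet> b = sqrt (real n) * (J (Q n \<omega> - S) \<bullet> b)" for b
          by (simp add: Z_def linear_scale[OF linJ])
        have sumZ: "(\<Sum>b\<in>B. (J Z \<bullet> b)\<^sup>2) = real n * (\<Sum>b\<in>B. (J (Q n \<omega> - S) \<bullet> b)\<^sup>2)"
          by (simp add: JZ power_mult_distrib sum_distrib_left)
        have nZ: "(norm Z)\<^sup>2 = real n * (norm (Q n \<omega> - S))\<^sup>2"
          by (simp add: Z_def power_mult_distrib)
        have "\<bar>V n \<omega> - (\<Sum>b\<in>B. (J Z \<bullet> b)\<^sup>2) / 2\<bar> =
            real n * \<bar>contrast (Q n \<omega>) (G (\<theta>_hat n \<omega>)) - (\<Sum>b\<in>B. (J (Q n \<omega> - S) \<bullet> b)\<^sup>2) / 2\<bar>"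
          unfolding V_def sumZ by (subst abs_of_nonneg[of "real n", symmetric], simp, subst abs_mult[symmetric]) (simp add: right_diff_distrib)
        also have "\<dots> \<le> real n * (\<epsilon> * (norm (Q n \<omega> - S))\<^sup>2)" by (intro mult_left_mono main) simp
        also have "\<dots> = \<epsilon> * (norm Z)\<^sup>2" by (simp add: nZ)
        also have "\<dots> \<le> \<epsilon> * u\<^sup>2" using \<epsilon> Zu by (intro mult_left_mono power_mono) auto
        finally have part1: "\<bar>V n \<omega> - (\<Sum>b\<in>B. (J Z \<bullet> b)\<^sup>2) / 2\<bar> \<le> \<eta> / 2" by (simp add: \<epsilon>)
        have "\<bar>(J Z \<bullet> b)\<^sup>2 - (A n \<omega> \<bullet> Fm b)\<^sup>2\<bar> \<le> \<kappa> * \<rho> * (2 * a + \<kappa>)" if b: "b \<in> B" for b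
        proof (rule abs_diff_squares_le)
          have "J Z \<bullet> b - A n \<omega> \<bullet> Fm b = J (Rem n \<omega>) \<bullet> b"
            unfolding Z linear_add[OF linJ] inner_add_left Fm_J by simp
          also have "\<bar>\<dots>\<bar> \<le> norm (J (Rem n \<omega>)) * norm b" by (rule Cauchy_Schwarz_ineq2)
          also have "\<dots> \<le> \<kappa> * norm (Rem n \<omega>)"
            using B(3)[OF b] norm_congruence_le[of Ri "Rem n \<omega>"] by (simp add: J_def \<kappa>_def)
          also have "\<dots> \<le> \<kappa> * \<rho>" using Rn nonneg by (intro mult_left_mono)
          finally show "\<bar>J Z \<bullet> b - A n \<omega> \<bullet> Fm b\<bar> \<le> \<kappa> * \<rho>" .
          have "\<bar>A n \<omega> \<bullet> Fm b\<bar> \<le> norm (A n \<omega>) * norm (Fm b)" by (rule Cauchy_Schwarz_ineq2)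
          then show "\<bar>A n \<omega> \<bullet> Fm b\<bar> \<le> a" using Fm_norm[OF b] An by simp
          show "\<kappa> * \<rho> \<le> \<kappa>" using nonneg \<rho> by (intro mult_left_le) auto
        qed
        then have "(\<Sum>b\<in>B. \<bar>(J Z \<bullet> b)\<^sup>2 - (A n \<omega> \<bullet> Fm b)\<^sup>2\<bar>) \<le> (\<Sum>b\<in>B. \<kappa> * \<rho> * (2 * a + \<kappa>))"
          by (rule sum_mono)
        also have "\<dots> = \<rho> * L" by (simp add: L_def k_def)
        finally have "\<bar>(\<Sum>b\<in>B. (J Z \<bullet> b)\<^sup>2) - (\<Sum>b\<in>B. (A n \<omega> \<bullet> Fm b)\<^sup>2)\<bar> \<le> \<eta>"
          unfolding sum_subtractf[symmetric] using \<rho>(3) order_trans[OF sum_abs] by fastforce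
        then have part2: "\<bar>(\<Sum>b\<in>B. (J Z \<bullet> b)\<^sup>2) / 2 - T n \<omega>\<bar> \<le> \<eta> / 2"
          unfolding TB diff_divide_distrib[symmetric] by simp
        show ?thesis using part1 part2 by linarith
      qed
      with E mE show ?case by blast
    qed
  qed
  have "weak_conv_m (\<lambda>n. distr M borel (V n)) (chi_squared k)"
  proof (rule weak_conv_m_perturb[OF M Vm Tm real_distribution_chi_squared close])
    fix x y :: real assume "x < y"
    then show "(\<lambda>n. \<integral>\<omega>. cts_step x y (T n \<omega>) \<partial>M) \<longlonglongrightarrow> integral\<^sup>L (chi_squared k) (cts_step x y)"
      unfolding T_def by (intro cts_step_sum_squares_tendsto[OF M Ym char])
  qed
  then show ?thesis
    unfolding V_def[abs_def] Q_def k_def cardB .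
qed

theorem theorem3:
  fixes M :: "'a measure"
    and m :: "('k1::finite, 'k2::finite, 'p1::finite, 'p2::finite, 'q::finite) sem"
    and \<Theta> :: "(real^'q) set" and \<theta>0 :: "real^'q"
    and ms :: "('l1::finite, 'l2::finite, 'p1, 'p2, 'qs::finite) sem"
    and \<Theta>s :: "(real^'qs) set" and \<theta>s0 :: "real^'qs"
    and W1 :: "real \<Rightarrow> 'a \<Rightarrow> real^'r1::finite" and W2 :: "real \<Rightarrow> 'a \<Rightarrow> real^'r2::finite"
    and W3 :: "real \<Rightarrow> 'a \<Rightarrow> real^'r3::finite" and W4 :: "real \<Rightarrow> 'a \<Rightarrow> real^'r4::finite"
    and B1 :: "real^'k1 \<Rightarrow> real^'k1" and B2 :: "real^'p1 \<Rightarrow> real^'p1"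
    and B3 :: "real^'p2 \<Rightarrow> real^'p2" and B4 :: "real^'k2 \<Rightarrow> real^'k2"
    and S1 :: "real^'r1^'k1" and S2 :: "real^'r2^'p1"
    and S3 :: "real^'r3^'p2" and S4 :: "real^'r4^'k2"
    and \<xi>0 :: "real^'k1" and \<delta>0 :: "real^'p1" and \<epsilon>0 :: "real^'p2" and \<zeta>0 :: "real^'k2"
    and \<xi> :: "real \<Rightarrow> 'a \<Rightarrow> real^'k1" and \<delta> :: "real \<Rightarrow> 'a \<Rightarrow> real^'p1"
    and \<epsilon> :: "real \<Rightarrow> 'a \<Rightarrow> real^'p2" and \<zeta> :: "real \<Rightarrow> 'a \<Rightarrow> real^'k2"
    and \<eta> :: "real \<Rightarrow> 'a \<Rightarrow> real^'k2"
    and X1 :: "real \<Rightarrow> 'a \<Rightarrow> real^'p1" and X2 :: "real \<Rightarrow> 'a \<Rightarrow> real^'p2"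
    and h :: "nat \<Rightarrow> real"
    and Q :: "nat \<Rightarrow> 'a \<Rightarrow> real^('p1 + 'p2)^('p1 + 'p2)"
    and \<theta>_hat :: "nat \<Rightarrow> 'a \<Rightarrow> real^'qs"
  assumes "prob_space M"
    \<comment> \<open>the two models\<close>
    and "sem_model m \<Theta>" and "\<theta>0 \<in> \<Theta>"
    and "sem_model ms \<Theta>s"
    \<comment> \<open>the latent processes\<close>
    and "std_wiener M W1" and "std_wiener M W2" and "std_wiener M W3" and "std_wiener M W4"
    and "prob_space.indep_sets M
           (\<lambda>i. [generated_sigma M {0..} W1, generated_sigma M {0..} W2,
                 generated_sigma M {0..} W3, generated_sigma M {0..} W4] ! i) {..<4}"
    and "sde_solution M W1 B1 S1 \<xi>0 \<xi>" and "sde_solution M W2 B2 S2 \<delta>0 \<delta>"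
    and "sde_solution M W3 B3 S3 \<epsilon>0 \<epsilon>" and "sde_solution M W4 B4 S4 \<zeta>0 \<zeta>"
    and "S1 ** transpose S1 = fill (Sigma_xi m) \<theta>0"
    and "S2 ** transpose S2 = fill (Sigma_delta m) \<theta>0"
    and "S3 ** transpose S3 = fill (Sigma_eps m) \<theta>0"
    and "S4 ** transpose S4 = fill (Sigma_zeta m) \<theta>0"
    \<comment> \<open>the observed process; \<open>mat 1 - \<Psi>\<close> is \<open>B\<^sub>0\<close>\<close>
    and "\<And>t \<omega>. 0 \<le> t \<Longrightarrow> \<omega> \<in> space M \<Longrightarrow>
           \<eta> t \<omega> = (mat 1 - fill (Psi_pat m) \<theta>0) *v \<eta> t \<omega> + fill (Gamma_pat m) \<theta>0 *v \<xi> t \<omega> + \<zeta> t \<omega>"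
    and "\<And>t \<omega>. 0 \<le> t \<Longrightarrow> \<omega> \<in> space M \<Longrightarrow> X1 t \<omega> = fill (Lambda_x1 m) \<theta>0 *v \<xi> t \<omega> + \<delta> t \<omega>"
    and "\<And>t \<omega>. 0 \<le> t \<Longrightarrow> \<omega> \<in> space M \<Longrightarrow> X2 t \<omega> = fill (Lambda_x2 m) \<theta>0 *v \<eta> t \<omega> + \<epsilon> t \<omega>"
    \<comment> \<open>(a)\<close>
    and "regular_drift B1" and "regular_drift B2" and "regular_drift B3" and "regular_drift B4"
    and "bounded_moments M \<xi>" and "bounded_moments M \<delta>"
    and "bounded_moments M \<epsilon>" and "bounded_moments M \<zeta>"
    \<comment> \<open>(b)\<close>
    and "ergodic M W1 B1 S1 \<xi>" and "ergodic M W2 B2 S2 \<delta>"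
    and "ergodic M W3 B3 S3 \<epsilon>" and "ergodic M W4 B4 S4 \<zeta>"
    \<comment> \<open>(c)\<close>
    and "sem_regular m \<Theta>" and "sem_regular ms \<Theta>s"
    \<comment> \<open>(d)\<close>
    and "\<And>\<theta> \<theta>'. \<theta> \<in> \<Theta>s \<Longrightarrow> \<theta>' \<in> \<Theta>s \<Longrightarrow> Sigma_struct ms \<theta> = Sigma_struct ms \<theta>' \<Longrightarrow> \<theta> = \<theta>'"
    \<comment> \<open>(e), with the true value an interior point, where the Jacobian in (f) is taken\<close>
    and "\<theta>s0 \<in> \<Theta>s" and "Sigma_struct m \<theta>0 = Sigma_struct ms \<theta>s0"
    and "\<theta>s0 \<in> interior \<Theta>s"
    \<comment> \<open>(f)\<close>
    and "rank (jacobian (\<lambda>\<theta>. vech (Sigma_struct ms \<theta>)) (at \<theta>s0)) = CARD('qs)"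
    \<comment> \<open>observations and estimator\<close>
    and "\<And>n. 0 < h n" and "h \<longlonglongrightarrow> 0"
    and "filterlim (\<lambda>n. real n * h n) at_top sequentially"
    and "(\<lambda>n. real n * (h n)\<^sup>2) \<longlonglongrightarrow> 0"
    and "\<And>n \<omega>. Q n \<omega> = realized_cov n (h n) (\<lambda>t. stack_vec (X1 t \<omega>) (X2 t \<omega>))"
    and "\<And>n. \<theta>_hat n \<in> borel_measurable M"
    and "\<And>n \<omega>. 1 \<le> n \<Longrightarrow> \<omega> \<in> space M \<Longrightarrow> \<theta>_hat n \<omega> \<in> \<Theta>s \<and>
           contrast (Q n \<omega>) (Sigma_struct ms (\<theta>_hat n \<omega>)) =
             (INF \<theta>\<in>\<Theta>s. contrast (Q n \<omega>) (Sigma_struct ms \<theta>))"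
  shows "weak_conv_m
           (\<lambda>n. distr M borel (\<lambda>\<omega>. real n * contrast (Q n \<omega>) (Sigma_struct ms (\<theta>_hat n \<omega>))))
           (chi_squared
             ((CARD('p1) + CARD('p2)) * (CARD('p1) + CARD('p2) + 1) div 2 - CARD('qs)))"
proof -
  let ?I = "matrix_inv (fill (Psi_pat m) \<theta>0)"
  \<comment> \<open>Loadings of \<xi> and \<zeta> on the stacked observation with \<eta> eliminated,
    in the form of \<open>Sigma_struct_sum\<close>.\<close>
  define A :: "real^'k1^('p1 + 'p2)" where "A = emb1 ** fill (Lambda_x1 m) \<theta>0 + emb2 ** (fill (Lambda_x2 m) \<theta>0 ** ?I ** fill (Gamma_pat m) \<theta>0)"
  define D :: "real^'k2^('p1 + 'p2)" where "D = emb2 ** (fill (Lambda_x2 m) \<theta>0 ** ?I)"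
  define X where "X t \<omega> = A *v \<xi> t \<omega> + emb1 *v \<delta> t \<omega> + emb2 *v \<epsilon> t \<omega> + D *v \<zeta> t \<omega>" for t \<omega>
  \<comment> \<open>One matrix for the four Wiener processes together; its Gram matrix is the
    covariance structure, whatever the numbers of driving noises.\<close>
  define \<sigma> where "\<sigma> = joint_matrix (A ** S1) (emb1 ** S2) (emb2 ** S3) (D ** S4)"
  let ?W = "joint_noise W1 W2 W3 W4" and ?F = "joint_past M W1 W2 W3 W4"
  have inv: "invertible (fill (Psi_pat m) \<theta>0)" using assms(3,33) by (simp add: sem_regular_def)
  have \<eta>: "\<eta> t \<omega> = ?I *v (fill (Gamma_pat m) \<theta>0 *v \<xi> t \<omega> + \<zeta> t \<omega>)" if "0 \<le> t" "\<omega> \<in> space M" for t \<omega>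
  proof -
    have "fill (Psi_pat m) \<theta>0 *v \<eta> t \<omega> = fill (Gamma_pat m) \<theta>0 *v \<xi> t \<omega> + \<zeta> t \<omega>"
      using assms(18)[OF that] by (simp add: matrix_vector_mult_diff_rdistrib algebra_simps)
    then show ?thesis
      using matrix_inv_left_right(2)[OF inv] by (metis matrix_vector_mul_assoc matrix_vector_mul_lid)
  qed
  have XX: "stack_vec (X1 t \<omega>) (X2 t \<omega>) = X t \<omega>" if "0 \<le> t" "\<omega> \<in> space M" for t \<omega>
    unfolding stack_vec_emb assms(19)[OF that] assms(20)[OF that] \<eta>[OF that] X_def A_def D_def
    by (simp add: matrix_vector_right_distrib matrix_vector_mult_add_rdistrib matrix_vector_mul_assoc matrix_mul_assoc)
  \<comment> \<open>The model equations hold at non-negative times and on the space of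
    \<open>M\<close>, which covers all points of the grid.\<close>
  have Q: "Q n \<omega> = realized_cov n (h n) (\<lambda>t. X t \<omega>)" if "\<omega> \<in> space M" for n \<omega>
    unfolding assms(44) realized_cov_def
    using assms(40)[of n] that by (intro arg_cong2[where f="(*\<^sub>R)"] sum.cong refl arg_cong2[where f=outer]) (simp_all add: XX)
  have noise: "gaussian_noise M ?F ?W"
    by (rule gaussian_noise_joint[OF assms(1) assms(5-9)])
  have subF: "subalgebra M (?F t)" if "0 \<le> t" for t
    using noise that unfolding gaussian_noise_def by blast
  have lip: "\<exists>L. L-lipschitz_on UNIV B1" "\<exists>L. L-lipschitz_on UNIV B2" "\<exists>L. L-lipschitz_on UNIV B3" "\<exists>L. L-lipschitz_on UNIV B4"
    using assms(21-24) by (auto simp: regular_drift_def)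
  then obtain L1 L2 L3 L4 where L: "L1-lipschitz_on UNIV B1" "L2-lipschitz_on UNIV B2" "L3-lipschitz_on UNIV B3" "L4-lipschitz_on UNIV B4"
    by blast
  have ito: "ito_increments M ?F (\<lambda>t \<omega>. \<sigma> *v ?W t \<omega>) X"
    unfolding X_def[abs_def] \<sigma>_def joint_matrix_noise matrix_vector_mul_assoc[symmetric]
    by (intro ito_increments_add ito_increments_linear[OF matrix_vector_mul_bounded_linear]
        ito_increments_mono[OF ito_increments_sde[OF assms(1,5,10) L(1) assms(25)] subF subalgebra_joint_past(1)]
        ito_increments_mono[OF ito_increments_sde[OF assms(1,6,11) L(2) assms(26)] subF subalgebra_joint_past(2)]
        ito_increments_mono[OF ito_increments_sde[OF assms(1,7,12) L(3) assms(27)] subF subalgebra_joint_past(3)]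
        ito_increments_mono[OF ito_increments_sde[OF assms(1,8,13) L(4) assms(28)] subF subalgebra_joint_past(4)])
  have sym: "transpose (Sigma_xi m) = Sigma_xi m" using assms(2) by (simp add: sem_model_def)
  have "\<sigma> ** transpose \<sigma> = A ** (S1 ** transpose S1) ** transpose A + emb1 ** (S2 ** transpose S2) ** transpose emb1 +
      emb2 ** (S3 ** transpose S3) ** transpose emb2 + D ** (S4 ** transpose S4) ** transpose D"
    unfolding \<sigma>_def joint_matrix_gram by (simp only: matrix_transpose_mul matrix_mul_assoc)
  also have "\<dots> = Sigma_struct m \<theta>0"
    unfolding assms(14-17) Sigma_struct_sum[OF sym] A_def D_def ..
  finally have G0: "Sigma_struct ms \<theta>s0 = \<sigma> ** transpose \<sigma>" using assms(37) by simp
  have diff: "Sigma_struct ms differentiable (at \<theta>)" if "\<theta> \<in> \<Theta>s" for \<theta>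
    using assms(34) that by (intro Sigma_struct_differentiable) (simp add: sem_regular_def)
  then obtain G' where G': "(Sigma_struct ms has_derivative G') (at \<theta>s0)"
    using assms(36) unfolding differentiable_def by blast
  have injG': "inj G'"
    by (rule inj_derivative_of_full_rank[OF Sigma_struct_sym[OF assms(4)] G' assms(39)])
  have cont: "continuous_on \<Theta>s (Sigma_struct ms)"
    using diff by (intro continuous_at_imp_continuous_on ballI differentiable_imp_continuous_within)
  have inj: "inj_on (Sigma_struct ms) \<Theta>s" using assms(35) by (intro inj_onI)
  have compact: "compact \<Theta>s" using assms(4) by (simp add: sem_model_def)
  have hat: "\<theta>_hat n \<omega> \<in> \<Theta>s \<and> contrast (realized_cov n (h n) (\<lambda>t. X t \<omega>)) (Sigma_struct ms (\<theta>_hat n \<omega>)) =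
        (INF \<theta>\<in>\<Theta>s. contrast (realized_cov n (h n) (\<lambda>t. X t \<omega>)) (Sigma_struct ms \<theta>))"
    if "1 \<le> n" "\<omega> \<in> space M" for n \<omega>
    using assms(46)[OF that] unfolding Q[OF that(2)] .
  have "distr M borel (\<lambda>\<omega>. real n * contrast (Q n \<omega>) (Sigma_struct ms (\<theta>_hat n \<omega>))) =
      distr M borel (\<lambda>\<omega>. real n * contrast (realized_cov n (h n) (\<lambda>t. X t \<omega>)) (Sigma_struct ms (\<theta>_hat n \<omega>)))" for n
    by (intro distr_cong refl) (simp add: Q)
  moreover have "CARD('p1 + 'p2) = CARD('p1) + CARD('p2)"
    by (simp add: UNIV_Plus_UNIV[symmetric] card_Plus del: UNIV_Plus_UNIV)
  ultimately show ?thesis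
    using likelihood_ratio_weak_conv[OF assms(1) noise ito compact assms(38) pos_def_Sigma_struct[OF assms(4,34)] cont inj
        G' injG' G0 assms(40,41,43,45) hat]
    by simp
qed

end
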